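(* Let $-3<\gamma\le 1$, let the collision kernel be $q(\theta,v-u)=|v-u|^{\gamma}h(\theta)$ with $h\ge 0$ and $\int_0^{\pi/2}h(\theta)\,d\theta<+\infty$, let $\beta>8+2\max\{0,\gamma\}$ and let $w(v)=(1+|v|^2)^{\beta/2}$. Let the initial datum $F_0=F_0(x,v)\ge 0$ on $\mathbb{R}^3\times\mathbb{R}^3$ satisfy $\|wF_0\|_{L^\infty_{x,v}}<+\infty$ and, for every fixed $(x,t)\in\mathbb{R}^3\times(0,+\infty)$ and every bounded measurable set $K\subset\mathbb{R}^3$, $$\int_{K}\big|F_0(x+\delta-v(t+\sigma),v)-F_0(x-vt,v)\big|\,dv\to 0\quad\text{as }(\sigma,\delta)\to(0,0),\ \sigma\in\mathbb{R},\ \delta\in\mathbb{R}^3 .$$ Let $t_1,T$ be any given times with $0<t_1<T<+\infty$, and suppose in addition that for every bounded measurable set $K\subset\mathbb{R}^3$, $$\sup_{(x,t)\in\mathbb{R}^3\times[t_1,T]}\int_{K}\big|F_0(x+\delta-v(t+\sigma),v)-F_0(x-vt,v)\big|\,dv\to 0\quad\text{as }(\sigma,\delta)\to(0,0).$$ Let $F(t,x,v)$ be a solution of the Boltzmann equation $F_t+v\cdot\nabla_xF=Q(F,F)$ with initial datum $F_0$ that belongs to the space $\mathbf{X}$ (defined in the context). Then the macroscopic components of $F$, namely the density $\int_{\mathbb{R}^3}F(t,x,v)\,dv$, the momentum $\int_{\mathbb{R}^3}vF(t,x,v)\,dv$ and the total energy $\int_{\mathbb{R}^3}|v|^2F(t,x,v)\,dv$,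 are uniformly continuous functions of $(x,t)$ in $\mathbb{R}^3\times[t_1,T]$.
   Context: Collision operator: $Q(F_1,F_2)=Q_+(F_1,F_2)-Q_-(F_1,F_2)$, where $$Q_+(F_1,F_2)(v)=\int_{\mathbb{R}^3}\int_{\mathbb{S}^2}q(\theta,v-u)F_1(u')F_2(v')\,du\,d\omega,\qquad Q_-(F_1,F_2)(v)=\int_{\mathbb{R}^3}\int_{\mathbb{S}^2}q(\theta,v-u)F_1(u)F_2(v)\,du\,d\omega,$$ with $u'=u+[(v-u)\cdot\omega]\omega$, $v'=v-[(v-u)\cdot\omega]\omega$, and $\theta\in[0,\pi/2]$ given by $\cos\theta=|(v-u)\cdot\omega|/|v-u|$. $Q$ acts on the velocity variable only, with $(t,x)$ as parameters. The global Maxwellian is $\mu(v)=(2\pi)^{-3/2}e^{-|v|^2/2}$. Space $\mathbf{X}$: $F\in\mathbf{X}$ means that $F(t,x,v)\ge 0$ for a.e. $(t,x,v)\in(0,+\infty)\times\mathbb{R}^3\times\mathbb{R}^3$ and that, for some $b>2$, one of the following two cases holds for every $T'>0$: (near Maxwellian) $w(F-\mu)\in L^{b/(b-1)}(0,T';L^2_{x,v})$ and $wF\in L^b(0,T';L^\infty_{x,v})$; or (near vacuum) $wF\in L^{b/(b-1)}(0,T';L^2_{x,v})$ and $wF\in L^b(0,T';L^\infty_{x,v})$. Here $L^p_{x,v}=L^p(\mathbb{R}^3_x\times\mathbb{R}^3_v)$ and $w=w(v)$. Solution: $F$ is a solution with initial datum $F_0$ in the Duhamel form: for $(t,x,v)\in(0,+\infty)\times\mathbb{R}^3\times\mathbb{R}^3$,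 $$F(t,x,v)=F_0(x-vt,v)e^{-\int_0^tg(\tau;t,x,v)\,d\tau}+\int_0^te^{-\int_s^tg(\tau;t,x,v)\,d\tau}Q_+(F,F)(s,x-v(t-s),v)\,ds,$$ where $g(\tau;t,x,v)=\int_{\mathbb{R}^3}\int_{\mathbb{S}^2}q(\theta,v-u)F(\tau,x-v(t-\tau),u)\,d\omega\,du$. $F_0$ is a measurable function defined at every point of $\mathbb{R}^3\times\mathbb{R}^3$ (it is evaluated along the sets $\{(x-vt,v):v\in\mathbb{R}^3\}$), and $\|wF_0\|_{L^\infty_{x,v}}$ is accordingly the supremum of $w(v)|F_0(x,v)|$ over all $(x,v)$. *)

theory Defs
  imports "HOL-Analysis.Analysis" "HOL-Probability.Essential_Supremum"
begin

text \<open>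
  Surface measure on the unit sphere of \<^typ>\<open>real^3\<close>, obtained from Lebesgue measure by polar
  coordinates: the area of \<open>A\<close> is three times the volume of the solid cone over \<open>A\<close> in the
  unit ball.
\<close>

definition sphere_measure :: "(real^3) measure" where
  "sphere_measure =
     scale_measure 3 (distr (restrict_space lborel (ball 0 1 - {0})) (restrict_space borel (sphere 0 1)) sgn)"

lemma space_sphere_measure: "space sphere_measure = sphere 0 1"
  by (simp add: sphere_measure_def space_restrict_space space_scale_measure)

lemma emeasure_sphere_measure: "emeasure sphere_measure (sphere 0 1) = ennreal (4 * pi)"
proof -
  let ?B = "ball (0::real^3) 1 - {0}"
  have sgn: "sgn \<in> restrict_space lborel ?B \<rightarrow>\<^sub>M restrict_space borel (sphere (0::real^3) 1)"
  proof (rule measurable_restrict_space2)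
    show "sgn \<in> space (restrict_space lborel ?B) \<rightarrow> sphere (0::real^3) 1"
      by (auto simp: space_restrict_space norm_sgn)
    show "sgn \<in> borel_measurable (restrict_space lborel ?B)"
      unfolding sgn_div_norm
      by (rule measurable_restrict_space1) measurable
  qed
  have "sgn -` sphere 0 1 \<inter> ?B = ?B"
    by (auto simp: norm_sgn)
  moreover have "emeasure lborel ?B = emeasure lborel (ball (0::real^3) 1)"
    by (intro emeasure_Diff_null_set) auto
  moreover have "sphere (0::real^3) 1 \<in> sets (restrict_space borel (sphere 0 1))"
    by (simp add: sets_restrict_space_iff)
  ultimately have "emeasure sphere_measure (sphere 0 1) = 3 * emeasure lborel (ball (0::real^3) 1)"
    using sgn by (simp add: sphere_measure_def emeasure_distr space_restrict_space emeasure_restrict_space)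
  also have "\<dots> = 3 * ennreal (4 / 3 * pi)"
    by (simp add: emeasure_ball unit_ball_vol_3)
  also have "\<dots> = ennreal (4 * pi)"
    by (subst ennreal_numeral[symmetric], subst ennreal_mult'[symmetric]) auto
  finally show ?thesis .
qed

definition maxwellian :: "real^3 \<Rightarrow> real" where
  "maxwellian v = (2 * pi) powr (-3/2) * exp (- (norm v)\<^sup>2 / 2)"

definition weight :: "real \<Rightarrow> real^3 \<Rightarrow> real" where
  "weight \<beta> v = (1 + (norm v)\<^sup>2) powr (\<beta> / 2)"

definition post_u :: "real^3 \<Rightarrow> real^3 \<Rightarrow> real^3 \<Rightarrow> real^3" where
  "post_u u v \<omega> = u + ((v - u) \<bullet> \<omega>) *\<^sub>R \<omega>"

definition post_v :: "real^3 \<Rightarrow> real^3 \<Rightarrow> real^3 \<Rightarrow> real^3" where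
  "post_v u v \<omega> = v - ((v - u) \<bullet> \<omega>) *\<^sub>R \<omega>"

definition coll_angle :: "real^3 \<Rightarrow> real^3 \<Rightarrow> real^3 \<Rightarrow> real" where
  "coll_angle u v \<omega> = arccos (\<bar>(v - u) \<bullet> \<omega>\<bar> / norm (v - u))"

definition Q_gain ::
  "(real \<Rightarrow> real^3 \<Rightarrow> real) \<Rightarrow> (real^3 \<Rightarrow> real) \<Rightarrow> (real^3 \<Rightarrow> real) \<Rightarrow> real^3 \<Rightarrow> real" where
  "Q_gain q f\<^sub>1 f\<^sub>2 v =
     (LINT (u, \<omega>)|(lborel \<Otimes>\<^sub>M sphere_measure).
        q (coll_angle u v \<omega>) (v - u) * f\<^sub>1 (post_u u v \<omega>) * f\<^sub>2 (post_v u v \<omega>))"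

text \<open>
  The loss term factors as \<open>Q\<^sub>-(f\<^sub>1, f\<^sub>2)(v) = loss_freq q f\<^sub>1 v * f\<^sub>2 v\<close>; evaluated along the
  backward characteristic through \<open>(t, x, v)\<close>, the frequency is the \<open>g\<close> of the Duhamel formula.
\<close>

definition loss_freq :: "(real \<Rightarrow> real^3 \<Rightarrow> real) \<Rightarrow> (real^3 \<Rightarrow> real) \<Rightarrow> real^3 \<Rightarrow> real" where
  "loss_freq q f v =
     (LINT (u, \<omega>)|(lborel \<Otimes>\<^sub>M sphere_measure).
        q (coll_angle u v \<omega>) (v - u) * f u)"

definition g_char ::
  "(real \<Rightarrow> real^3 \<Rightarrow> real) \<Rightarrow> (real \<Rightarrow> real^3 \<Rightarrow> real^3 \<Rightarrow> real) \<Rightarrow>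
   real \<Rightarrow> real \<Rightarrow> real^3 \<Rightarrow> real^3 \<Rightarrow> real" where
  "g_char q F \<tau> t x v = loss_freq q (F \<tau> (x - (t - \<tau>) *\<^sub>R v)) v"

text \<open>
  The integrals are Bochner integrals, and no convergence is required here: for \<open>F\<close> in the space
  \<open>space_X (weight \<beta>)\<close> below, with \<open>\<beta>\<close> in the range considered, their convergence is automatic.
\<close>

definition duhamel_solution ::
  "(real \<Rightarrow> real^3 \<Rightarrow> real) \<Rightarrow> (real^3 \<Rightarrow> real^3 \<Rightarrow> real) \<Rightarrow>
   (real \<Rightarrow> real^3 \<Rightarrow> real^3 \<Rightarrow> real) \<Rightarrow> bool" where
  "duhamel_solution q F\<^sub>0 F \<longleftrightarrow>
     (\<forall>t>0. \<forall>x v. F t x v =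
        F\<^sub>0 (x - t *\<^sub>R v) v * exp (- (LINT \<tau>:{0<..<t}|lborel. g_char q F \<tau> t x v)) +
        (LINT s:{0<..<t}|lborel.
           exp (- (LINT \<tau>:{s<..<t}|lborel. g_char q F \<tau> t x v)) *
           Q_gain q (F s (x - (t - s) *\<^sub>R v)) (F s (x - (t - s) *\<^sub>R v)) v))"

definition epowr :: "ennreal \<Rightarrow> real \<Rightarrow> ennreal" where
  "epowr a p = (if a = \<infinity> then \<infinity> else ennreal (enn2real a powr p))"

definition L2_xv :: "(real^3 \<Rightarrow> real^3 \<Rightarrow> real) \<Rightarrow> ennreal" where
  "L2_xv f = epowr (\<integral>\<^sup>+ (x, v). ennreal (\<bar>f x v\<bar>\<^sup>2) \<partial>lborel) (1/2)"

definition Linf_xv :: "(real^3 \<Rightarrow> real^3 \<Rightarrow> real) \<Rightarrow> ennreal" where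
  "Linf_xv f = esssup lborel (\<lambda>(x, v). ennreal \<bar>f x v\<bar>)"

text \<open>
  \<open>f \<in> L\<^sup>p(0,T;Y)\<close>, where \<open>N\<close> is the norm of \<open>Y\<close>, with value \<open>\<infinity>\<close> outside \<open>Y\<close>.
  Only the finiteness of the norm is expressed; measurability is part of \<open>space_X\<close>.
\<close>

definition in_Lp_time ::
  "real \<Rightarrow> real \<Rightarrow> ((real^3 \<Rightarrow> real^3 \<Rightarrow> real) \<Rightarrow> ennreal) \<Rightarrow>
   (real \<Rightarrow> real^3 \<Rightarrow> real^3 \<Rightarrow> real) \<Rightarrow> bool" where
  "in_Lp_time p T N f \<longleftrightarrow> (\<integral>\<^sup>+ t\<in>{0<..<T}. epowr (N (f t)) p \<partial>lborel) < \<infinity>"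

text \<open>
  A solution is evaluated along characteristics, which are null sets, so the elements of the space are
  Borel functions rather than classes modulo null sets. Values at \<open>t \<le> 0\<close> are irrelevant.
\<close>

definition space_X :: "(real^3 \<Rightarrow> real) \<Rightarrow> (real \<Rightarrow> real^3 \<Rightarrow> real^3 \<Rightarrow> real) set" where
  "space_X w = {F.
     (\<lambda>(t, x, v). F t x v) \<in> borel_measurable (restrict_space borel ({0<..} \<times> UNIV)) \<and>
     (AE (t, x, v) in lborel. 0 < t \<longrightarrow> 0 \<le> F t x v) \<and>
     (\<exists>b>2.
        (\<forall>T'>0. in_Lp_time (b / (b - 1)) T' L2_xv (\<lambda>t x v. w v * (F t x v - maxwellian v)) \<and>
                in_Lp_time b T' Linf_xv (\<lambda>t x v. w v * F t x v)) \<or>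
        (\<forall>T'>0. in_Lp_time (b / (b - 1)) T' L2_xv (\<lambda>t x v. w v * F t x v) \<and>
                in_Lp_time b T' Linf_xv (\<lambda>t x v. w v * F t x v)))}"

end

theory Submission
  imports Defs
begin

text \<open>
  The moments of order at most two are shown to be continuous along pairs of sequences: if
  \<open>x'\<^sub>n - x\<^sub>n \<rightarrow> 0\<close> and \<open>t'\<^sub>n - t\<^sub>n \<rightarrow> 0\<close> with all times in \<open>[t\<^sub>1, T]\<close>, then
  \<open>\<integral> (1 + |v|\<^sup>2) |F(t'\<^sub>n, x'\<^sub>n, v) - F(t\<^sub>n, x\<^sub>n, v)| dv \<rightarrow> 0\<close>. The points \<open>x\<^sub>n\<close> may tend to infinity, and this
  is what makes the continuity uniform.

  Two facts make it true. First, there is a majorant. Let \<open>a(s)\<close> be the norm of \<open>w F(s)\<close> in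
  \<open>L\<^sup>\<infinity>\<close>. Energy conservation gives \<open>w(u') w(v') \<ge> (1 + |u|\<^sup>2 + |v|\<^sup>2)\<^sup>\<beta>\<^sup>/\<^sup>2\<close>, so the gain term at time \<open>s\<close> is
  at most \<open>a(s)\<^sup>2 \<Gamma>(v)\<close> with a function \<open>\<Gamma>\<close> independent of \<open>F\<close>, and \<open>(1 + |v|\<^sup>2) \<Gamma>\<close> is integrable
  because \<open>\<beta> > 8 + 2 max 0 \<gamma>\<close> (\<open>nn_integral_\<Gamma>_moment\<close>, which rests on the angular bound
  \<open>nn_integral_sphere_angle_bound\<close>). Since \<open>b > 2\<close>, \<open>a\<^sup>2\<close> is integrable over bounded time intervals. Hence
  \<open>|F(t, x, v)|\<close> is at most a constant times \<open>1 / w(v) + \<Gamma>(v)\<close>, uniformly in \<open>(t, x)\<close>, and it suffices to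
  prove convergence for almost every \<open>v\<close> along a subsequence.

  Second, there is continuity in the mean along characteristics. For \<open>\<tau> < t\<close> the map
  \<open>v \<mapsto> x - (t - \<tau>) v\<close> is an affine bijection whose Jacobian does not depend on \<open>x\<close>. So if
  \<open>F(\<tau>) - c \<mu>\<close> is square integrable in \<open>(x, v)\<close>, with \<open>c\<close> equal to \<open>0\<close> or \<open>1\<close>, it may be replaced by a
  uniformly continuous function, and the values of \<open>F(\<tau>)\<close> at \<open>(x'\<^sub>n - (t'\<^sub>n - \<tau>) v, u)\<close> and
  \<open>(x\<^sub>n - (t\<^sub>n - \<tau>) v, u)\<close> approach each other in the mean over \<open>(\<tau>, v, u)\<close>
  (\<open>mean_continuity_along_characteristics\<close>). The Maxwellian drops out since it is constant in \<open>x\<close>. A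
  subsequence converges for almost all \<open>(v, \<tau>, u)\<close> (\<open>AE_subsequence_along_characteristics\<close>), and
  then, at almost every fixed \<open>v\<close>, dominated convergence carries the convergence through the loss
  frequency, the exponential, the gain term and the time integral of the Duhamel formula
  (\<open>duhamel_diff_tendsto\<close>). The term with the initial datum converges by hypothesis.

  The Duhamel formula holds at every point, whereas the bounds on \<open>F\<close> hold almost everywhere. Two
  null set arguments bridge this: for fixed \<open>(t, x)\<close> the characteristics with all velocities fill
  the space at each earlier time (\<open>AE_raw_duhamel_eq\<close>), and for fixed \<open>v\<close> the maps \<open>(u, \<omega>) \<mapsto> u'\<close> and
  \<open>(u, \<omega>) \<mapsto> v'\<close> pull null sets back to null sets (\<open>AE_post_velocities_avoid_null\<close>).
\<close>

section \<open>The surface measure of the sphere\<close>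

lemma sets_sphere_measure:
  "sets sphere_measure = sets (restrict_space borel (sphere 0 1))"
  by (simp add: sphere_measure_def)

lemma measurable_sphere_measure_ident: "(\<lambda>\<omega>. \<omega>) \<in> borel_measurable sphere_measure"
  by (subst measurable_cong_sets[OF sets_sphere_measure refl]) (simp add: measurable_restrict_space1)

lemma borel_measurable_sphere_measure:
  "g \<in> borel_measurable borel \<Longrightarrow> g \<in> borel_measurable sphere_measure"
  by (rule measurable_compose[OF measurable_sphere_measure_ident, of g borel, unfolded o_def]) simp

lemma finite_measure_sphere_measure: "finite_measure sphere_measure"
  by (rule finite_measureI) (simp add: space_sphere_measure emeasure_sphere_measure)

interpretation sphere: finite_measure sphere_measure
  by (rule finite_measure_sphere_measure)

abbreviation phase_measure :: "((real^3) \<times> (real^3)) measure" where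
  "phase_measure \<equiv> lborel \<Otimes>\<^sub>M sphere_measure"

lemma sgn_measurable_ball:
  "sgn \<in> restrict_space lborel (ball 0 1 - {0}) \<rightarrow>\<^sub>M restrict_space borel (sphere (0::real^3) 1)"
proof (rule measurable_restrict_space2)
  show "sgn \<in> space (restrict_space lborel (ball 0 1 - {0})) \<rightarrow> sphere (0::real^3) 1"
    by (auto simp: space_restrict_space norm_sgn)
  show "sgn \<in> borel_measurable (restrict_space lborel (ball (0::real^3) 1 - {0}))"
    unfolding sgn_div_norm by (rule measurable_restrict_space1) measurable
qed

lemma borel_measurable_sgn_vec [measurable]: "(sgn :: real^3 \<Rightarrow> real^3) \<in> borel_measurable borel"
  unfolding sgn_div_norm by measurable

lemma nn_integral_sphere_measure:
  fixes g :: "real^3 \<Rightarrow> ennreal"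
  assumes g [measurable]: "g \<in> borel_measurable borel"
  shows "(\<integral>\<^sup>+\<omega>. g \<omega> \<partial>sphere_measure) = 3 * (\<integral>\<^sup>+y. g (sgn y) * indicator (ball 0 1 - {0}) y \<partial>lborel)"
proof -
  let ?B = "ball (0::real^3) 1 - {0}"
  have m: "g \<in> borel_measurable (restrict_space borel (sphere 0 1))"
    by (rule measurable_restrict_space1) measurable
  have "(\<integral>\<^sup>+\<omega>. g \<omega> \<partial>sphere_measure) =
      3 * (\<integral>\<^sup>+\<omega>. g \<omega> \<partial>distr (restrict_space lborel ?B) (restrict_space borel (sphere 0 1)) sgn)"
    unfolding sphere_measure_def by (subst nn_integral_scale_measure) (use m in auto)
  also have "\<dots> = 3 * (\<integral>\<^sup>+y. g (sgn y) \<partial>restrict_space lborel ?B)"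
    using m by (subst nn_integral_distr[OF sgn_measurable_ball]) simp_all
  also have "\<dots> = 3 * (\<integral>\<^sup>+y. g (sgn y) * indicator ?B y \<partial>lborel)"
    by (subst nn_integral_restrict_space) auto
  finally show ?thesis .
qed

lemma AE_sphere_measure:
  assumes P [measurable]: "Measurable.pred borel P" and ae: "AE y in lborel. P (sgn y)"
  shows "AE \<omega> in sphere_measure. P \<omega>"
proof -
  have "(\<integral>\<^sup>+\<omega>. indicator {\<omega>. \<not> P \<omega>} \<omega> \<partial>sphere_measure)
      = 3 * (\<integral>\<^sup>+y. indicator {\<omega>. \<not> P \<omega>} (sgn y) * indicator (ball 0 1 - {0}) y \<partial>lborel)"
    by (rule nn_integral_sphere_measure) measurable
  also have "(\<integral>\<^sup>+y. indicator {\<omega>. \<not> P \<omega>} (sgn y) * indicator (ball 0 1 - {0}) y \<partial>lborel) = 0"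
    using ae by (subst nn_integral_0_iff_AE) (auto simp: indicator_def)
  finally have "(\<integral>\<^sup>+\<omega>. indicator {\<omega>. \<not> P \<omega>} \<omega> \<partial>sphere_measure) = 0"
    by simp
  then have "AE \<omega> in sphere_measure. indicator {\<omega>. \<not> P \<omega>} \<omega> = (0::ennreal)"
    by (subst (asm) nn_integral_0_iff_AE) (auto intro!: borel_measurable_sphere_measure)
  then show ?thesis by (auto simp: indicator_def split: if_splits)
qed

section \<open>Lebesgue measure under translations and rotations\<close>

lemma distr_lborel_orthogonal:
  fixes T :: "real^3 \<Rightarrow> real^3"
  assumes T: "orthogonal_transformation T"
  shows "distr lborel borel T = lborel"
proof (rule lborel_eqI[symmetric])
  have lin: "linear T" using T by (rule orthogonal_transformation_linear)
  have m [measurable]: "T \<in> borel_measurable borel"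
    by (intro borel_measurable_continuous_onI linear_continuous_on) (simp add: lin linear_linear)
  fix l u :: "real^3"
  assume lu: "\<And>b. b \<in> Basis \<Longrightarrow> l \<bullet> b \<le> u \<bullet> b"
  obtain T' where T': "orthogonal_transformation T'" "\<And>x. T' (T x) = x" "\<And>x. T (T' x) = x"
    using orthogonal_transformation_inv[OF T] orthogonal_transformation_bij[OF T]
    by (metis bij_inv_eq_iff)
  have vim: "T -` box l u = T' ` box l u"
    using T'(2,3) by (auto simp: image_iff) metis
  have lm: "T' ` box l u \<in> lmeasurable"
    by (rule measurable_orthogonal_image[OF T'(1)]) simp
  have b: "T -` box l u \<in> sets borel" using measurable_sets_borel[OF m, of "box l u"] by simp
  have "emeasure (distr lborel borel T) (box l u) = emeasure lebesgue (T' ` box l u)"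
    using b by (simp add: emeasure_distr vim)
  also have "\<dots> = ennreal (measure lebesgue (T' ` box l u))"
    using lm by (simp add: emeasure_eq_measure2 fmeasurableD2)
  also have "\<dots> = ennreal (measure lebesgue (box l u))"
    by (simp add: measure_orthogonal_image[OF T'(1)])
  also have "\<dots> = emeasure lborel (box l u)"
    using emeasure_eq_ennreal_measure[of lborel "box l u"] emeasure_lborel_box_finite[of l u] by simp
  also have "\<dots> = (\<Prod>b\<in>Basis. (u - l) \<bullet> b)" using lu by (simp add: emeasure_lborel_box)
  finally show "emeasure (distr lborel borel T) (box l u) = (\<Prod>b\<in>Basis. (u - l) \<bullet> b)" .
qed simp

lemma nn_integral_lborel_translate:
  fixes f :: "'a::euclidean_space \<Rightarrow> ennreal"
  assumes [measurable]: "f \<in> borel_measurable borel"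
  shows "(\<integral>\<^sup>+y. f (y + a) \<partial>lborel) = (\<integral>\<^sup>+y. f y \<partial>lborel)"
proof -
  have "(\<integral>\<^sup>+y. f y \<partial>lborel) = (\<integral>\<^sup>+y. f y \<partial>distr lborel borel (\<lambda>y. a + y))"
    by (simp add: lborel_distr_plus)
  also have "\<dots> = (\<integral>\<^sup>+y. f (y + a) \<partial>lborel)"
    by (subst nn_integral_distr) (auto simp: add.commute)
  finally show ?thesis by simp
qed

lemma nn_integral_lborel_affine:
  fixes f :: "'a::euclidean_space \<Rightarrow> ennreal"
  assumes [measurable]: "f \<in> borel_measurable borel" and "c \<noteq> 0"
  shows "(\<integral>\<^sup>+y. f y \<partial>lborel) = ennreal (\<bar>c\<bar> ^ DIM('a)) * (\<integral>\<^sup>+y. f (a + c *\<^sub>R y) \<partial>lborel)"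
proof -
  have "(\<integral>\<^sup>+y. f y \<partial>lborel) = (\<integral>\<^sup>+y. f y \<partial>density (distr lborel borel (\<lambda>x. a + c *\<^sub>R x)) (\<lambda>_. \<bar>c\<bar>^DIM('a)))"
    using lborel_affine[OF \<open>c \<noteq> 0\<close>, of a] by simp
  also have "\<dots> = ennreal (\<bar>c\<bar> ^ DIM('a)) * (\<integral>\<^sup>+y. f (a + c *\<^sub>R y) \<partial>lborel)"
    by (simp add: nn_integral_density nn_integral_distr nn_integral_cmult)
  finally show ?thesis .
qed

lemma AE_lborel_affine:
  fixes P :: "'a::euclidean_space \<Rightarrow> bool"
  assumes ae: "AE y in lborel. P y" and c: "c \<noteq> 0"
  shows "AE y in lborel. P (a + c *\<^sub>R y)"
proof -
  from ae obtain N where N: "N \<in> null_sets lborel" "{y. \<not> P y} \<subseteq> N"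
    by (auto elim!: AE_E3 simp: eventually_ae_filter)
  have [measurable]: "N \<in> sets borel" using N by auto
  have "0 = (\<integral>\<^sup>+y. indicator N y \<partial>lborel)" using N by (simp add: null_setsD1)
  also have "\<dots> = ennreal (\<bar>c\<bar> ^ DIM('a)) * (\<integral>\<^sup>+y. indicator N (a + c *\<^sub>R y) \<partial>lborel)"
    using c by (intro nn_integral_lborel_affine) auto
  finally have "(\<integral>\<^sup>+y. indicator N (a + c *\<^sub>R y) \<partial>lborel) = 0"
    using c by auto
  then have "AE y in lborel. indicator N (a + c *\<^sub>R y) = (0::ennreal)"
    by (subst (asm) nn_integral_0_iff_AE) auto
  then show ?thesis
  proof eventually_elim
    case (elim y)
    then show ?case using N(2) by (auto simp: indicator_def split: if_splits)
  qed
qed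

lemma AE_lborel_translate:
  fixes P :: "'a::euclidean_space \<Rightarrow> bool"
  assumes "AE y in lborel. P y"
  shows "AE y in lborel. P (a + y)"
  using AE_lborel_affine[OF assms, of 1 a] by simp

lemma AE_lborel_swap:
  fixes P :: "'a::euclidean_space \<Rightarrow> 'b::euclidean_space \<Rightarrow> bool"
  assumes "Measurable.pred (borel \<Otimes>\<^sub>M borel) (\<lambda>z. P (fst z) (snd z))"
  shows "(AE x in lborel. AE y in lborel. P x y) \<longleftrightarrow> (AE y in lborel. AE x in lborel. P x y)"
proof -
  show ?thesis using assms
    by (intro lborel_pair.AE_commute) (simp add: pred_def space_pair_measure)
qed

text \<open>
  This replaces a choice of coordinates adapted to the directions \<open>w s\<close>: by Tonelli the exceptional
  set has a null translate, hence is null itself.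
\<close>

lemma AE_lborel_if_translates:
  fixes P :: "'a::euclidean_space \<Rightarrow> bool" and w :: "'b::euclidean_space \<Rightarrow> 'a"
  assumes P [measurable]: "Measurable.pred borel P" and w [measurable]: "w \<in> borel_measurable borel"
    and ae: "\<And>y. AE s in lborel. P (y + w s)"
  shows "AE y in lborel. P y"
proof -
  have sw: "(AE s in lborel. AE y in lborel. P (y + w s)) \<longleftrightarrow> (AE y in lborel. AE s in lborel. P (y + w s))"
    by (rule AE_lborel_swap) measurable
  with ae have *: "AE s in lborel. AE y in lborel. P (y + w s)" by simp
  have "\<exists>s::'b. AE y in lborel. P (y + w s)"
  proof (rule ccontr)
    assume "\<nexists>s::'b. AE y in lborel. P (y + w s)"
    with * have "AE s in (lborel :: 'b measure). False" by simp
    then show False by (simp add: AE_iff_measurable[OF _ refl])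
  qed
  then obtain s where "AE y in lborel. P (y + w s)" by blast
  from AE_lborel_translate[OF this, of "- w s"] show ?thesis by simp
qed

section \<open>Angular integrals\<close>

lemma borel_measurable_arccos [measurable]: "(arccos :: real \<Rightarrow> real) \<in> borel_measurable borel"
proof -
  \<comment> \<open>outside \<open>[-1, 1]\<close> the defining description is empty, so \<open>arccos\<close> is constant there\<close>
  have out: "arccos y = arccos 2" if "\<not> \<bar>y\<bar> \<le> 1" for y :: real
  proof -
    have "cos x \<noteq> y" "cos x \<noteq> 2" for x using cos_le_one[of x] cos_ge_minus_one[of x] that by linarith+
    then show ?thesis unfolding arccos_def by simp
  qed
  have "(\<lambda>y. if y \<in> {-1..1} then arccos y else arccos 2) \<in> borel_measurable borel"
    by (intro borel_measurable_continuous_on_if continuous_on_arccos' continuous_on_const) auto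
  also have "(\<lambda>y. if y \<in> {-1..1} then arccos y else arccos 2) = arccos"
  proof
    fix y :: real
    show "(if y \<in> {-1..1} then arccos y else arccos 2) = arccos y"
    proof (cases "y \<in> {-1..1}")
      case False
      then have "arccos y = arccos 2" by (intro out) auto
      with False show ?thesis by presburger
    qed presburger
  qed
  finally show ?thesis .
qed

lemma arccos_eq_arctan:
  fixes r \<rho> :: real
  assumes "0 \<le> r" "0 < \<rho>"
  shows "arccos (r / sqrt (\<rho>\<^sup>2 + r\<^sup>2)) = pi/2 - arctan (r / \<rho>)"
proof -
  have "cos (pi/2 - arctan (r/\<rho>)) = sin (arctan (r/\<rho>))" by (simp add: cos_diff)
  also have "\<dots> = (r/\<rho>) / sqrt (1 + (r/\<rho>)\<^sup>2)" by (rule sin_arctan)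
  also have "sqrt (1 + (r/\<rho>)\<^sup>2) = sqrt (\<rho>\<^sup>2 + r\<^sup>2) / \<rho>"
  proof -
    have "1 + (r/\<rho>)\<^sup>2 = (\<rho>\<^sup>2 + r\<^sup>2) / \<rho>\<^sup>2" using assms by (simp add: field_simps power2_eq_square)
    then show ?thesis using assms by (simp add: real_sqrt_divide)
  qed
  finally have c: "cos (pi/2 - arctan (r/\<rho>)) = r / sqrt (\<rho>\<^sup>2 + r\<^sup>2)" using assms by simp
  have "0 \<le> arctan (r/\<rho>)" "arctan (r/\<rho>) < pi/2" using assms arctan_ubound by auto
  then have "arccos (cos (pi/2 - arctan (r/\<rho>))) = pi/2 - arctan (r/\<rho>)"
    by (intro arccos_cos) (auto intro: order_trans[of _ "pi/2"])
  then show ?thesis using c by simp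
qed

text \<open>
  Along a line parallel to an axis, at distance \<open>\<rho>\<close> from it, the angle with the axis has speed
  \<open>\<rho> / (\<rho>\<^sup>2 + r\<^sup>2)\<close>, so integrating a function of the angle costs a factor of order \<open>1 / \<rho>\<close>.
\<close>

lemma nn_integral_angle_along_line:
  fixes h :: "real \<Rightarrow> real"
  assumes h [measurable]: "h \<in> borel_measurable borel" and nn: "\<And>\<theta>. 0 \<le> h \<theta>"
    and \<rho>: "0 < \<rho>" "\<rho> \<le> 2"
  shows "(\<integral>\<^sup>+r. ennreal (h (arccos (\<bar>r\<bar> / sqrt (\<rho>\<^sup>2 + r\<^sup>2)))) * indicator {-2..2} r \<partial>lborel)
      \<le> ennreal (16 / \<rho>) * (\<integral>\<^sup>+\<theta>. ennreal (h \<theta>) * indicator {0..pi/2} \<theta> \<partial>lborel)"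
proof -
  let ?H = "\<lambda>r. ennreal (h (arccos (\<bar>r\<bar> / sqrt (\<rho>\<^sup>2 + r\<^sup>2))))"
  let ?g = "\<lambda>r. arctan (r / \<rho>)" and ?g' = "\<lambda>r. \<rho> / (\<rho>\<^sup>2 + r\<^sup>2)"
  have der: "(?g has_real_derivative ?g' r) (at r)" for r
  proof -
    have "(?g has_real_derivative (1 / \<rho>) * (1 / (1 + (r/\<rho>)\<^sup>2))) (at r)"
      using \<rho> by (auto intro!: derivative_eq_intros simp: field_simps)
    also have "(1 / \<rho>) * (1 / (1 + (r/\<rho>)\<^sup>2)) = ?g' r"
      using \<rho> by (simp add: field_simps power2_eq_square)
    finally show ?thesis .
  qed
  have sub: "(\<integral>\<^sup>+x. h (pi/2 - x) * indicator {?g 0..?g 2} x \<partial>lborel) =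
             (\<integral>\<^sup>+x. h (pi/2 - ?g x) * ?g' x * indicator {0..2} x \<partial>lborel)"
  proof (rule nn_integral_substitution)
    show "continuous_on {0..2} ?g'" using \<rho> by (intro continuous_intros) (auto simp: add_pos_nonneg less_imp_neq[symmetric])
    show "\<And>x. 0 \<le> ?g' x" using \<rho> by simp
    show "set_borel_measurable borel {arctan (0 / \<rho>)..arctan (2 / \<rho>)} (\<lambda>x. h (pi / 2 - x))"
      unfolding set_borel_measurable_def by measurable
  qed (use der in auto)
  have half: "(\<integral>\<^sup>+r. ?H r * indicator {0..2} r \<partial>lborel)
      \<le> ennreal (8 / \<rho>) * (\<integral>\<^sup>+\<theta>. ennreal (h \<theta>) * indicator {0..pi/2} \<theta> \<partial>lborel)"
  proof -
    have "(\<integral>\<^sup>+r. ?H r * indicator {0..2} r \<partial>lborel)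
        \<le> (\<integral>\<^sup>+r. ennreal (8 / \<rho>) * ennreal (h (pi/2 - ?g r) * ?g' r * indicator {0..2} r) \<partial>lborel)"
    proof (rule nn_integral_mono)
      fix r :: real
      show "?H r * indicator {0..2} r \<le> ennreal (8/\<rho>) * ennreal (h (pi/2 - ?g r) * ?g' r * indicator {0..2} r)"
      proof (cases "r \<in> {0..2}")
        case True
        \<comment> \<open>the lower bound \<open>\<rho> / 8\<close> for the angular speed on the range of integration\<close>
        have "\<rho>\<^sup>2 + r\<^sup>2 \<le> 2\<^sup>2 + 2\<^sup>2" using True \<rho> by (intro add_mono power_mono) auto
        then have "1 \<le> (8/\<rho>) * ?g' r"
          using \<rho> by (simp add: field_simps add_pos_nonneg)
        then have "h (pi/2 - ?g r) * 1 \<le> h (pi/2 - ?g r) * ((8/\<rho>) * ?g' r)"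
          by (intro mult_left_mono nn)
        then have "h (pi/2 - ?g r) \<le> (8/\<rho>) * (h (pi/2 - ?g r) * ?g' r)"
            by (simp only: mult_1_right mult.left_commute)
        then have "ennreal (h (pi/2 - ?g r)) \<le> ennreal (8/\<rho>) * ennreal (h (pi/2 - ?g r) * ?g' r)"
          using \<rho>(1) nn by (subst ennreal_mult[symmetric]) (auto intro!: ennreal_leI simp del: times_divide_eq_left times_divide_eq_right)
        then show ?thesis using True \<rho> by (simp add: arccos_eq_arctan)
      qed simp
    qed
    also have "\<dots> = ennreal (8 / \<rho>) * (\<integral>\<^sup>+r. ennreal (h (pi/2 - ?g r) * ?g' r * indicator {0..2} r) \<partial>lborel)"
      by (rule nn_integral_cmult) measurable
    also have "(\<integral>\<^sup>+r. ennreal (h (pi/2 - ?g r) * ?g' r * indicator {0..2} r) \<partial>lborel)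
        = (\<integral>\<^sup>+x. h (pi/2 - x) * indicator {?g 0..?g 2} x \<partial>lborel)"
      by (rule sub[symmetric])
    also have "\<dots> \<le> (\<integral>\<^sup>+x. ennreal (h (pi/2 + (-1) *\<^sub>R x)) * indicator {0..pi/2} (pi/2 + (-1) *\<^sub>R x) \<partial>lborel)"
      using arctan_ubound[of "2/\<rho>"]
      by (intro nn_integral_mono) (auto simp: indicator_def)
    also have "\<dots> = (\<integral>\<^sup>+\<theta>. ennreal (h \<theta>) * indicator {0..pi/2} \<theta> \<partial>lborel)"
      by (subst (2) nn_integral_lborel_affine[where c="-1" and a="pi/2"]) auto
    finally show ?thesis by (simp add: mult_left_mono)
  qed
  have [measurable]: "?H \<in> borel_measurable borel" by measurable
  have neg: "(\<integral>\<^sup>+r. ?H r * indicator {-2..0} r \<partial>lborel) = (\<integral>\<^sup>+r. ?H r * indicator {0..2} r \<partial>lborel)"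
    by (subst nn_integral_lborel_affine[where c="-1" and a="0"])
       (auto intro!: nn_integral_cong simp: indicator_def)
  have "(\<integral>\<^sup>+r. ?H r * indicator {-2..2} r \<partial>lborel)
      \<le> (\<integral>\<^sup>+r. ?H r * indicator {0..2} r + ?H r * indicator {-2..0} r \<partial>lborel)"
    by (intro nn_integral_mono) (auto simp: indicator_def)
  also have "\<dots> = (\<integral>\<^sup>+r. ?H r * indicator {0..2} r \<partial>lborel) + (\<integral>\<^sup>+r. ?H r * indicator {-2..0} r \<partial>lborel)"
    by (rule nn_integral_add) measurable
  also have "\<dots> \<le> ennreal (8 / \<rho>) * (\<integral>\<^sup>+\<theta>. ennreal (h \<theta>) * indicator {0..pi/2} \<theta> \<partial>lborel)
     + ennreal (8 / \<rho>) * (\<integral>\<^sup>+\<theta>. ennreal (h \<theta>) * indicator {0..pi/2} \<theta> \<partial>lborel)"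
    unfolding neg by (intro add_mono half)
  also have "\<dots> = ennreal (16 / \<rho>) * (\<integral>\<^sup>+\<theta>. ennreal (h \<theta>) * indicator {0..pi/2} \<theta> \<partial>lborel)"
    using \<rho> by (simp add: distrib_right[symmetric] ennreal_plus[symmetric] del: ennreal_plus)
  finally show ?thesis .
qed

lemma AE_lborel_not_in_negligible:
  assumes "negligible N" "N \<in> sets borel"
  shows "AE y in lborel. y \<notin> N"
  using assms by (intro AE_not_in) (simp add: negligible_iff_null_sets null_sets_completion_iff)

lemma AE_component_nonzero: "AE y in (lborel :: (real^3) measure). y $ i \<noteq> 0"
proof -
  have "negligible {y::real^3. y \<bullet> axis i 1 = 0}"
    by (rule negligible_standard_hyperplane) (auto simp: Basis_vec_def)
  then have "AE y in (lborel :: (real^3) measure). y \<notin> {y. y \<bullet> axis i 1 = 0}"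
    by (rule AE_lborel_not_in_negligible) measurable
  then show ?thesis by (simp add: inner_axis)
qed

lemma norm_real3_square: "(norm y)\<^sup>2 = (y $ 1)\<^sup>2 + (y $ 2)\<^sup>2 + (y $ 3)\<^sup>2" for y :: "real^3"
  by (simp add: norm_vec_def L2_set_def sum_3)

lemma Basis_real3: "(Basis :: (real^3) set) = {axis 1 1, axis 2 1, axis 3 1}"
  by (auto simp: Basis_vec_def UNIV_3)

lemma axis_real3_distinct: "axis i (1::real) = axis j 1 \<longleftrightarrow> i = j"
  by (simp add: axis_eq_axis)

lemma prod_Basis_real3:
  "(\<Prod>b\<in>Basis. G b) = G (axis 1 1 :: real^3) * G (axis 2 1) * G (axis 3 1)"
  unfolding Basis_real3 by (simp add: axis_real3_distinct mult.assoc)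

lemma nn_integral_lborel_real3_product:
  fixes f1 f2 f3 :: "real \<Rightarrow> real"
  assumes [measurable]: "f1 \<in> borel_measurable borel" "f2 \<in> borel_measurable borel" "f3 \<in> borel_measurable borel"
    and nn: "\<And>x. 0 \<le> f1 x" "\<And>x. 0 \<le> f2 x" "\<And>x. 0 \<le> f3 x"
  shows "(\<integral>\<^sup>+y. ennreal (f1 (y $ 1) * f2 (y $ 2) * f3 (y $ 3)) \<partial>(lborel :: (real^3) measure))
       = (\<integral>\<^sup>+x. f1 x \<partial>lborel) * (\<integral>\<^sup>+x. f2 x \<partial>lborel) * (\<integral>\<^sup>+x. f3 x \<partial>lborel)"
proof -
  let ?f = "\<lambda>(b::real^3) x. ennreal (if b = axis 1 1 then f1 x else if b = axis 2 1 then f2 x else f3 x)"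
  have "(\<integral>\<^sup>+y. (\<Prod>b\<in>Basis. ?f b (y \<bullet> b)) \<partial>(lborel :: (real^3) measure))
     = (\<Prod>b\<in>Basis. (\<integral>\<^sup>+x. ?f b x \<partial>lborel))"
    by (intro nn_integral_lborel_prod) auto
  then show ?thesis
    by (simp add: prod_Basis_real3 axis_real3_distinct inner_axis ennreal_mult nn)
qed

lemma nn_integral_abs_powr_finite:
  fixes a M :: real
  assumes "-1 < a"
  shows "(\<integral>\<^sup>+x. ennreal (\<bar>x\<bar> powr a * indicator {-M..M} x) \<partial>lborel) < \<infinity>"
proof (cases "0 < M")
  case False
  have "AE x in (lborel :: real measure). \<bar>x\<bar> powr a * indicator {-M..M} x = 0"
    using AE_lborel_singleton[of "0::real"] by eventually_elim (use False in \<open>auto simp: indicator_def\<close>)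
  then have "(\<integral>\<^sup>+x. ennreal (\<bar>x\<bar> powr a * indicator {-M..M} x) \<partial>lborel) = (\<integral>\<^sup>+x. 0 \<partial>(lborel::real measure))"
    by (intro nn_integral_cong_AE) auto
  then show ?thesis by simp
next
  case True
  have "set_integrable lebesgue {0..M} (\<lambda>x. x powr a)"
    using integrable_on_powr_from_0[of a M] assms True
    by (intro nonnegative_absolutely_integrable_1) auto
  then have "set_integrable lborel {0..M} (\<lambda>x. x powr a)"
    unfolding set_integrable_def by (subst (asm) integrable_completion) auto
  then have fin: "(\<integral>\<^sup>+x. ennreal (indicator {0..M} x * x powr a) \<partial>lborel) < \<infinity>"
    unfolding set_integrable_def using nn_integral_eq_integral[of lborel "\<lambda>x. indicator {0..M} x * x powr a"]
    by simp
  have "(\<integral>\<^sup>+x. ennreal (\<bar>x\<bar> powr a * indicator {-M..M} x) \<partial>lborel)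
     \<le> (\<integral>\<^sup>+x. ennreal (indicator {0..M} x * x powr a) + ennreal (indicator {0..M} (-x) * (-x) powr a) \<partial>lborel)"
    by (intro nn_integral_mono) (auto simp: indicator_def)
  also have "\<dots> = (\<integral>\<^sup>+x. ennreal (indicator {0..M} x * x powr a) \<partial>lborel)
      + (\<integral>\<^sup>+x. ennreal (indicator {0..M} (-x) * (-x) powr a) \<partial>lborel)"
    by (rule nn_integral_add) measurable
  also have "(\<integral>\<^sup>+x. ennreal (indicator {0..M} (-x) * (-x) powr a) \<partial>lborel)
      = (\<integral>\<^sup>+x. ennreal (indicator {0..M} x * x powr a) \<partial>lborel)"
    by (subst (2) nn_integral_lborel_affine[where c="-1" and a=0]) auto
  finally show ?thesis using fin by (auto simp: ennreal_add_less_top top.not_eq_extremum intro: le_less_trans)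
qed

text \<open>
  Averaging the integrand over translations along the axis leaves the inverse distance to the axis,
  which is integrable near the origin because the axis has codimension two. This
  compensates the factor \<open>1 / \<rho>\<close> lost along each line.
\<close>

lemma nn_integral_angle_ball:
  fixes h :: "real \<Rightarrow> real"
  assumes h [measurable]: "h \<in> borel_measurable borel" and nn: "\<And>\<theta>. 0 \<le> h \<theta>"
    and fin: "(\<integral>\<^sup>+\<theta>. ennreal (h \<theta>) * indicator {0..pi/2} \<theta> \<partial>lborel) < \<infinity>"
  shows "(\<integral>\<^sup>+y. ennreal (h (arccos (\<bar>y $ 1\<bar> / norm y))) * indicator (ball (0::real^3) 1 - {0}) y \<partial>lborel) < \<infinity>"
proof -
  let ?I = "\<integral>\<^sup>+\<theta>. ennreal (h \<theta>) * indicator {0..pi/2} \<theta> \<partial>lborel"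
  let ?\<Phi> = "\<lambda>y::real^3. ennreal (h (arccos (\<bar>y $ 1\<bar> / norm y))) * indicator (ball 0 1 - {0}) y"
  let ?e = "axis 1 1 :: real^3"
  let ?b = "\<lambda>x::real. \<bar>x\<bar> powr (-1/2) * indicator {-2..2} x"
  let ?c = "\<lambda>y::real^3. ?b (y $ 2) * ?b (y $ 3)"
  let ?k = "\<lambda>y::real^3. indicator {-2..2} (y $ 1) * ?b (y $ 2) * ?b (y $ 3)"
  have [measurable]: "ball (0::real^3) 1 \<in> sets borel" "{0::real^3} \<in> sets borel" by auto
  have [measurable]: "(\<lambda>y::real^3. y $ i) \<in> borel_measurable borel" for i
    by (intro borel_measurable_continuous_onI continuous_intros)
  have [measurable]: "?\<Phi> \<in> borel_measurable borel" by measurable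
  have line: "(\<integral>\<^sup>+s. ?\<Phi> (y + s *\<^sub>R ?e) * indicator {-1..1} s \<partial>lborel) \<le> (ennreal 16 * ?I) * ennreal (?k y)"
    if ne: "y $ 2 \<noteq> 0" "y $ 3 \<noteq> 0" for y
  proof (cases "\<bar>y $ 1\<bar> \<le> 2 \<and> (y $ 2)\<^sup>2 + (y $ 3)\<^sup>2 \<le> 1")
    case True
    define \<rho> where "\<rho> = sqrt ((y $ 2)\<^sup>2 + (y $ 3)\<^sup>2)"
    have \<rho>2: "\<rho>\<^sup>2 = (y $ 2)\<^sup>2 + (y $ 3)\<^sup>2" by (simp add: \<rho>_def)
    have \<rho>: "0 < \<rho>" "\<rho> \<le> 2"
      using ne True by (auto simp: \<rho>_def sum_power2_gt_zero_iff intro: order_trans[OF _ one_le_numeral])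
    have ns: "norm (y + s *\<^sub>R ?e) = sqrt (\<rho>\<^sup>2 + (y $ 1 + s)\<^sup>2)" for s
    proof -
      have "(norm (y + s *\<^sub>R ?e))\<^sup>2 = \<rho>\<^sup>2 + (y $ 1 + s)\<^sup>2"
        unfolding norm_real3_square by (simp add: \<rho>2 axis_def)
      then show ?thesis by (metis norm_ge_zero real_sqrt_unique)
    qed
    have small: "\<bar>y $ 2\<bar> \<le> \<rho>" "\<bar>y $ 3\<bar> \<le> \<rho>" by (auto simp: \<rho>_def intro!: real_le_rsqrt)
    have le1: "\<rho> \<le> 1" using True by (simp add: \<rho>_def)
    have "(\<integral>\<^sup>+s. ?\<Phi> (y + s *\<^sub>R ?e) * indicator {-1..1} s \<partial>lborel)
      \<le> (\<integral>\<^sup>+s. ennreal (h (arccos (\<bar>s + y $ 1\<bar> / sqrt (\<rho>\<^sup>2 + (s + y $ 1)\<^sup>2)))) * indicator {-2..2} (s + y $ 1) \<partial>lborel)"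
    proof (intro nn_integral_mono)
      fix s :: real
      show "?\<Phi> (y + s *\<^sub>R ?e) * indicator {-1..1} s
        \<le> ennreal (h (arccos (\<bar>s + y $ 1\<bar> / sqrt (\<rho>\<^sup>2 + (s + y $ 1)\<^sup>2)))) * indicator {-2..2} (s + y $ 1)"
      proof (cases "norm (y + s *\<^sub>R ?e) < 1")
        case t: True
        have "\<bar>(y + s *\<^sub>R ?e) $ 1\<bar> \<le> norm (y + s *\<^sub>R ?e)" by (rule component_le_norm_cart)
        then have "s + y $ 1 \<in> {-2..2}" using t by (auto simp: axis_def)
        moreover have "(y + s *\<^sub>R ?e) $ 1 = s + y $ 1" by (simp add: axis_def)
        moreover have "norm (y + s *\<^sub>R ?e) = sqrt (\<rho>\<^sup>2 + (s + y $ 1)\<^sup>2)" by (simp add: ns add.commute)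
        ultimately show ?thesis by (auto simp: indicator_def add.commute)
      qed (simp add: indicator_def)
    qed
    also have "\<dots> = (\<integral>\<^sup>+r. ennreal (h (arccos (\<bar>r\<bar> / sqrt (\<rho>\<^sup>2 + r\<^sup>2)))) * indicator {-2..2} r \<partial>lborel)"
      by (rule nn_integral_lborel_translate) measurable
    also have "\<dots> \<le> ennreal (16 / \<rho>) * ?I"
      by (rule nn_integral_angle_along_line[OF h nn \<rho>])
    also have "ennreal (16 / \<rho>) \<le> ennreal (16 * ?k y)"
    proof (rule ennreal_leI)
      have "\<rho> powr (-1/2) * \<rho> powr (-1/2) \<le> \<bar>y $ 2\<bar> powr (-1/2) * \<bar>y $ 3\<bar> powr (-1/2)"
        using ne small by (intro mult_mono powr_mono2') auto
      moreover have "\<rho> powr (-1/2) * \<rho> powr (-1/2) = 1 / \<rho>"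
        using \<rho> by (simp add: powr_add[symmetric] powr_minus_divide)
      moreover have "y $ 1 \<in> {-2..2}" "y $ 2 \<in> {-2..2}" "y $ 3 \<in> {-2..2}"
        using True small le1 by auto
      ultimately show "16 / \<rho> \<le> 16 * ?k y" by simp
    qed
    also have "ennreal (16 * ?k y) * ?I = (ennreal 16 * ?I) * ennreal (?k y)"
      by (subst ennreal_mult) (auto simp: mult_ac)
    finally show ?thesis by (simp add: mult_right_mono)
  next
    case False
    have "?\<Phi> (y + s *\<^sub>R ?e) * indicator {-1..1} s = 0" for s
    proof (cases "norm (y + s *\<^sub>R ?e) < 1 \<and> s \<in> {-1..1}")
      case t: True
      have "\<bar>(y + s *\<^sub>R ?e) $ 1\<bar> \<le> norm (y + s *\<^sub>R ?e)" by (rule component_le_norm_cart)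
      then have "\<bar>y $ 1\<bar> \<le> 2" using t by (auto simp: axis_def)
      moreover have "(norm (y + s *\<^sub>R ?e))\<^sup>2 \<le> 1" using t by (simp add: power_le_one)
      then have "(y $ 1 + s)\<^sup>2 + (y $ 2)\<^sup>2 + (y $ 3)\<^sup>2 \<le> 1" unfolding norm_real3_square by (simp add: axis_def)
      then have "(y $ 2)\<^sup>2 + (y $ 3)\<^sup>2 \<le> 1"
        using zero_le_power2[of "y $ 1 + s"] by linarith
      ultimately show ?thesis using False by simp
    qed (auto simp: indicator_def)
    then show ?thesis by (simp only: nn_integral_const mult_zero_left zero_le)
  qed
  have "2 * (\<integral>\<^sup>+y. ?\<Phi> y \<partial>lborel) = (\<integral>\<^sup>+s. indicator {-1..1::real} s * (\<integral>\<^sup>+y. ?\<Phi> y \<partial>lborel) \<partial>lborel)"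
    by (subst nn_integral_multc) auto
  also have "\<dots> = (\<integral>\<^sup>+s. (\<integral>\<^sup>+y. ?\<Phi> (y + s *\<^sub>R ?e) * indicator {-1..1} s \<partial>lborel) \<partial>lborel)"
  proof (intro nn_integral_cong)
    fix s :: real
    have "(\<integral>\<^sup>+y. ?\<Phi> (y + s *\<^sub>R ?e) * indicator {-1..1} s \<partial>lborel) = (\<integral>\<^sup>+y. ?\<Phi> (y + s *\<^sub>R ?e) \<partial>lborel) * indicator {-1..1} s"
      by (rule nn_integral_multc) measurable
    also have "(\<integral>\<^sup>+y. ?\<Phi> (y + s *\<^sub>R ?e) \<partial>lborel) = (\<integral>\<^sup>+y. ?\<Phi> y \<partial>lborel)"
      by (rule nn_integral_lborel_translate) measurable
    finally show "indicator {-1..1::real} s * (\<integral>\<^sup>+y. ?\<Phi> y \<partial>lborel) =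
       (\<integral>\<^sup>+y. ?\<Phi> (y + s *\<^sub>R ?e) * indicator {-1..1} s \<partial>lborel)" by (simp add: mult.commute)
  qed
  also have "\<dots> = (\<integral>\<^sup>+y. (\<integral>\<^sup>+s. ?\<Phi> (y + s *\<^sub>R ?e) * indicator {-1..1} s \<partial>lborel) \<partial>lborel)"
    by (rule lborel_pair.Fubini') measurable
  also have "\<dots> \<le> (\<integral>\<^sup>+y. (ennreal 16 * ?I) * ennreal (?k y) \<partial>lborel)"
  proof (rule nn_integral_mono_AE)
    show "AE y in lborel. (\<integral>\<^sup>+s. ?\<Phi> (y + s *\<^sub>R ?e) * indicator {-1..1} s \<partial>lborel) \<le> (ennreal 16 * ?I) * ennreal (?k y)"
      using AE_component_nonzero[of 2] AE_component_nonzero[of 3] by eventually_elim (rule line)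
  qed
  also have "\<dots> = (ennreal 16 * ?I) * (\<integral>\<^sup>+y. ennreal (?k y) \<partial>lborel)"
    by (rule nn_integral_cmult) measurable
  also have "(\<integral>\<^sup>+y. ennreal (?k y) \<partial>lborel) =
     (\<integral>\<^sup>+x. ennreal (indicator {-2..2::real} x) \<partial>lborel) * (\<integral>\<^sup>+x. ennreal (?b x) \<partial>lborel) * (\<integral>\<^sup>+x. ennreal (?b x) \<partial>lborel)"
    by (rule nn_integral_lborel_real3_product) auto
  finally have le: "2 * (\<integral>\<^sup>+y. ?\<Phi> y \<partial>lborel) \<le> (ennreal 16 * ?I) *
     ((\<integral>\<^sup>+x. ennreal (indicator {-2..2::real} x) \<partial>lborel) * (\<integral>\<^sup>+x. ennreal (?b x) \<partial>lborel) * (\<integral>\<^sup>+x. ennreal (?b x) \<partial>lborel))" .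
  have b: "(\<integral>\<^sup>+x. ennreal (?b x) \<partial>lborel) < \<infinity>" by (rule nn_integral_abs_powr_finite) simp
  have i: "(\<integral>\<^sup>+x. ennreal (indicator {-2..2::real} x) \<partial>lborel) < \<infinity>"
    by (simp add: ennreal_indicator)
  have "2 * (\<integral>\<^sup>+y. ?\<Phi> y \<partial>lborel) < \<infinity>"
    by (rule le_less_trans[OF le]) (use b i fin in \<open>auto simp: ennreal_mult_less_top\<close>)
  then show ?thesis by (auto simp: ennreal_mult_less_top)
qed

text \<open>
  A rotation takes \<open>z\<close> to the first coordinate axis, so the integral does not depend on \<open>z\<close> at all;
  finiteness is the computation for that axis.
\<close>

lemma nn_integral_sphere_angle_bound:
  fixes h :: "real \<Rightarrow> real"
  assumes h [measurable]: "h \<in> borel_measurable borel" and nn: "\<And>\<theta>. 0 \<le> h \<theta>"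
    and fin: "(\<integral>\<^sup>+\<theta>. ennreal (h \<theta>) * indicator {0..pi/2} \<theta> \<partial>lborel) < \<infinity>"
  obtains C where "0 \<le> C"
    "\<And>z. z \<noteq> 0 \<Longrightarrow> (\<integral>\<^sup>+\<omega>. ennreal (h (arccos (\<bar>z \<bullet> \<omega>\<bar> / norm z))) \<partial>sphere_measure) \<le> ennreal C"
proof -
  let ?\<Phi> = "\<lambda>y::real^3. ennreal (h (arccos (\<bar>y $ 1\<bar> / norm y))) * indicator (ball 0 1 - {0}) y"
  let ?J = "3 * (\<integral>\<^sup>+y. ?\<Phi> y \<partial>lborel)"
  have [measurable]: "ball (0::real^3) 1 \<in> sets borel" "{0::real^3} \<in> sets borel" by auto
  have [measurable]: "(\<lambda>y::real^3. y $ i) \<in> borel_measurable borel" for i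
    by (intro borel_measurable_continuous_onI continuous_intros)
  have J: "?J < \<infinity>" using nn_integral_angle_ball[OF h nn fin] by (simp add: ennreal_mult_less_top)
  have eq: "(\<integral>\<^sup>+\<omega>. ennreal (h (arccos (\<bar>z \<bullet> \<omega>\<bar> / norm z))) \<partial>sphere_measure) = ?J"
    if z: "z \<noteq> 0" for z :: "real^3"
  proof -
    have "norm (axis 1 1 :: real^3) = norm (z /\<^sub>R norm z)" using z by simp
    from orthogonal_transformation_exists[OF this]
    obtain T :: "real^3 \<Rightarrow> real^3" where T: "orthogonal_transformation T" and Tz: "T (axis 1 1) = z /\<^sub>R norm z"
      by metis
    have [measurable]: "T \<in> borel_measurable borel"
      using T by (intro borel_measurable_continuous_onI linear_continuous_on)
        (simp add: linear_linear orthogonal_transformation_linear)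
    have "(\<integral>\<^sup>+\<omega>. ennreal (h (arccos (\<bar>z \<bullet> \<omega>\<bar> / norm z))) \<partial>sphere_measure)
        = 3 * (\<integral>\<^sup>+y. ennreal (h (arccos (\<bar>z \<bullet> sgn y\<bar> / norm z))) * indicator (ball 0 1 - {0}) y \<partial>lborel)"
      by (rule nn_integral_sphere_measure) measurable
    also have "(\<integral>\<^sup>+y. ennreal (h (arccos (\<bar>z \<bullet> sgn y\<bar> / norm z))) * indicator (ball 0 1 - {0}) y \<partial>lborel)
        = (\<integral>\<^sup>+y. ennreal (h (arccos (\<bar>z \<bullet> sgn y\<bar> / norm z))) * indicator (ball 0 1 - {0}) y \<partial>distr lborel borel T)"
      by (simp add: distr_lborel_orthogonal[OF T])
    also have "\<dots> = (\<integral>\<^sup>+y. ennreal (h (arccos (\<bar>z \<bullet> sgn (T y)\<bar> / norm z))) * indicator (ball 0 1 - {0}) (T y) \<partial>lborel)"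
      by (rule nn_integral_distr) measurable
    also have "\<dots> = (\<integral>\<^sup>+y. ?\<Phi> y \<partial>lborel)"
    proof (rule nn_integral_cong)
      fix y :: "real^3"
      have n: "norm (T y) = norm y" using T by (rule orthogonal_transformation_norm)
      have "z = norm z *\<^sub>R T (axis 1 1)" using z by (simp add: Tz)
      then have "z \<bullet> T y = norm z * (T (axis 1 1) \<bullet> T y)" by (metis inner_scaleR_left)
      also have "T (axis 1 1) \<bullet> T y = y $ 1" using T by (simp add: orthogonal_transformation_def inner_axis' )
      finally have "\<bar>z \<bullet> sgn (T y)\<bar> / norm z = \<bar>y $ 1\<bar> / norm y"
        using z by (simp add: sgn_div_norm n abs_mult divide_inverse mult_ac)
      moreover have "T y = 0 \<longleftrightarrow> y = 0" by (metis n norm_eq_zero)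
      then have "T y \<in> ball 0 1 - {0} \<longleftrightarrow> y \<in> ball 0 1 - {0}" by (simp add: n)
      ultimately show "ennreal (h (arccos (\<bar>z \<bullet> sgn (T y)\<bar> / norm z))) * indicator (ball 0 1 - {0}) (T y) = ?\<Phi> y"
        unfolding indicator_def by presburger
    qed
    finally show ?thesis .
  qed
  have "(\<integral>\<^sup>+\<omega>. ennreal (h (arccos (\<bar>z \<bullet> \<omega>\<bar> / norm z))) \<partial>sphere_measure) \<le> ennreal (enn2real ?J)"
    if "z \<noteq> 0" for z :: "real^3"
    using eq[OF that] J by simp
  then show ?thesis by (intro that[of "enn2real ?J"]) auto
qed

section \<open>Integrability of the weighted kernel\<close>

lemma nn_integral_one_plus_square_powr_finite:
  fixes a :: real
  assumes "1 < a"
  shows "(\<integral>\<^sup>+(x::real). ennreal ((1 + x\<^sup>2) powr (-a/2)) \<partial>lborel) < \<infinity>"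
proof -
  have "set_integrable lebesgue {1..} (\<lambda>x::real. x powr (-a))"
    using has_integral_powr_to_inf[where a=1 and e="-a"] assms
    by (intro nonnegative_absolutely_integrable_1) (auto simp: integrable_on_def)
  then have "set_integrable lborel {1..} (\<lambda>x::real. x powr (-a))"
    unfolding set_integrable_def by (subst (asm) integrable_completion) auto
  then have fin: "(\<integral>\<^sup>+(x::real). ennreal (indicator {1..} x * x powr (-a)) \<partial>lborel) < \<infinity>"
    unfolding set_integrable_def using nn_integral_eq_integral[of lborel "\<lambda>x::real. indicator {1..} x * x powr (-a)"]
    by simp
  have pt: "(1 + x\<^sup>2) powr (-a/2) \<le> indicator {-1..1} x + indicator {1..} x * x powr (-a) + indicator {1..} (-x) * (-x) powr (-a)"
    for x :: real
  proof (cases "\<bar>x\<bar> \<le> 1")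
    case True
    have "(1 + x\<^sup>2) powr (-a/2) \<le> 1 powr (-a/2)" using assms by (intro powr_mono2') auto
    then show ?thesis using True by (auto simp: indicator_def abs_le_iff intro: order_trans)
  next
    case False
    have "(1 + x\<^sup>2) powr (-a/2) \<le> (x\<^sup>2) powr (-a/2)" using assms False by (intro powr_mono2') auto
    also have "x\<^sup>2 = \<bar>x\<bar> powr 2" using False by (simp add: powr_numeral)
    also have "(\<bar>x\<bar> powr 2) powr (-a/2) = \<bar>x\<bar> powr (-a)" unfolding powr_powr by simp
    finally show ?thesis using False by (auto simp: indicator_def abs_if split: if_splits)
  qed
  have "(\<integral>\<^sup>+(x::real). ennreal ((1 + x\<^sup>2) powr (-a/2)) \<partial>lborel)
      \<le> (\<integral>\<^sup>+(x::real). indicator {-1..1} x + ennreal (indicator {1..} x * x powr (-a)) + ennreal (indicator {1..} (-x) * (-x) powr (-a)) \<partial>lborel)"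
    using pt by (intro nn_integral_mono) (simp add: ennreal_indicator[symmetric] ennreal_plus[symmetric] del: ennreal_plus ennreal_indicator)
  also have "\<dots> = (\<integral>\<^sup>+(x::real). indicator {-1..1} x \<partial>lborel) + (\<integral>\<^sup>+x. ennreal (indicator {1..} x * x powr (-a)) \<partial>lborel)
      + (\<integral>\<^sup>+x. ennreal (indicator {1..} (-x) * (-x) powr (-a)) \<partial>lborel)"
    by (subst nn_integral_add, measurable, subst nn_integral_add, measurable)
  also have "(\<integral>\<^sup>+x. ennreal (indicator {1..} (-x) * (-x) powr (-a)) \<partial>lborel)
      = (\<integral>\<^sup>+x. ennreal (indicator {1..} x * x powr (-a)) \<partial>lborel)"
    by (subst (2) nn_integral_lborel_affine[where c="-1" and a=0]) auto
  finally show ?thesis using fin by (auto simp: ennreal_add_less_top intro: le_less_trans)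
qed

lemma nn_integral_japanese_bracket_finite:
  fixes a :: real
  assumes "3 < a"
  shows "(\<integral>\<^sup>+(u::real^3). ennreal ((1 + (norm u)\<^sup>2) powr (-a/2)) \<partial>lborel) < \<infinity>"
proof -
  let ?f = "\<lambda>x::real. (1 + x\<^sup>2) powr (-(a/3)/2)"
  have "(1 + (norm u)\<^sup>2) powr (-a/2) \<le> ?f (u $ 1) * ?f (u $ 2) * ?f (u $ 3)" for u :: "real^3"
  proof -
    have le: "(1 + (norm u)\<^sup>2) powr (-(a/3)/2) \<le> ?f (u $ i)" if "i \<in> {1,2,3}" for i
      using assms that by (intro powr_mono2') (auto simp: norm_real3_square add_pos_nonneg)
    have "(1 + (norm u)\<^sup>2) powr (-a/2) = (1 + (norm u)\<^sup>2) powr (-(a/3)/2) * (1 + (norm u)\<^sup>2) powr (-(a/3)/2) * (1 + (norm u)\<^sup>2) powr (-(a/3)/2)"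
      by (simp add: powr_add[symmetric])
    also have "\<dots> \<le> ?f (u $ 1) * ?f (u $ 2) * ?f (u $ 3)"
      by (intro mult_mono le) auto
    finally show ?thesis .
  qed
  then have "(\<integral>\<^sup>+(u::real^3). ennreal ((1 + (norm u)\<^sup>2) powr (-a/2)) \<partial>lborel)
     \<le> (\<integral>\<^sup>+(u::real^3). ennreal (?f (u $ 1) * ?f (u $ 2) * ?f (u $ 3)) \<partial>lborel)"
    by (intro nn_integral_mono ennreal_leI)
  also have "\<dots> = (\<integral>\<^sup>+x. ?f x \<partial>lborel) * (\<integral>\<^sup>+x. ?f x \<partial>lborel) * (\<integral>\<^sup>+x. ?f x \<partial>lborel)"
    by (rule nn_integral_lborel_real3_product) auto
  finally show ?thesis
    using nn_integral_one_plus_square_powr_finite[of "a/3"] assms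
    by (auto simp: ennreal_mult_less_top intro: le_less_trans)
qed

lemma nn_integral_norm_powr_ball_finite:
  fixes a :: real
  assumes "-3 < a"
  shows "(\<integral>\<^sup>+(z::real^3). ennreal (indicator (ball 0 1) z * norm z powr a) \<partial>lborel) < \<infinity>"
proof -
  define b where "b = min a 0"
  let ?f = "\<lambda>x::real. \<bar>x\<bar> powr (b/3) * indicator {-1..1} x"
  have b: "-1 < b/3" "b \<le> a" "b \<le> 0" using assms by (auto simp: b_def)
  have pt: "indicator (ball 0 1) z * norm z powr a \<le> ?f (z $ 1) * ?f (z $ 2) * ?f (z $ 3)"
    if nz: "z $ 1 \<noteq> 0" "z $ 2 \<noteq> 0" "z $ 3 \<noteq> 0" for z :: "real^3"
  proof (cases "norm z < 1")
    case True
    have c: "\<bar>z $ i\<bar> \<le> norm z" for i by (rule component_le_norm_cart)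
    have le: "norm z powr (b/3) \<le> ?f (z $ i)" if "z $ i \<noteq> 0" for i
    proof -
      have "norm z powr (b/3) \<le> \<bar>z $ i\<bar> powr (b/3)"
        using that c[of i] b by (intro powr_mono2') auto
      then show ?thesis using c[of i] True by (simp add: indicator_def abs_le_iff)
    qed
    have "0 < norm z" using nz c[of 1] by auto
    then have "norm z powr a \<le> norm z powr b" using True b by (intro powr_mono') auto
    also have "\<dots> = norm z powr (b/3) * norm z powr (b/3) * norm z powr (b/3)"
      by (simp add: powr_add[symmetric])
    also have "\<dots> \<le> ?f (z $ 1) * ?f (z $ 2) * ?f (z $ 3)"
      using nz by (intro mult_mono le) auto
    finally show ?thesis using True by simp
  qed simp
  have "(\<integral>\<^sup>+(z::real^3). ennreal (indicator (ball 0 1) z * norm z powr a) \<partial>lborel)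
     \<le> (\<integral>\<^sup>+(z::real^3). ennreal (?f (z $ 1) * ?f (z $ 2) * ?f (z $ 3)) \<partial>lborel)"
    using AE_component_nonzero[of 1] AE_component_nonzero[of 2] AE_component_nonzero[of 3]
    by (intro nn_integral_mono_AE) (auto elim!: eventually_elim2 intro!: ennreal_leI pt simp del: indicator_simps)
  also have "\<dots> = (\<integral>\<^sup>+x. ?f x \<partial>lborel) * (\<integral>\<^sup>+x. ?f x \<partial>lborel) * (\<integral>\<^sup>+x. ?f x \<partial>lborel)"
    by (rule nn_integral_lborel_real3_product) auto
  finally show ?thesis
    using nn_integral_abs_powr_finite[OF b(1), of 1]
    by (auto simp: ennreal_mult_less_top intro: le_less_trans)
qed

text \<open>
  With \<open>N = 1 + |u|\<^sup>2 + |v|\<^sup>2\<close>, \<open>|v - u|\<close> to the power \<open>\<gamma>\<close> is at most \<open>2 N\<close> to the power \<open>max 0 \<gamma> / 2\<close>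
  away from the diagonal and locally integrable near it. What remains of the weight is
  \<open>N\<close> to the power \<open>-\<kappa>\<close> with \<open>\<kappa> = \<beta>/2 - 1 - max 0 \<gamma> / 2\<close>. The condition \<open>\<beta> > 8 + 2 max 0 \<gamma>\<close>
  gives \<open>\<kappa> > 3\<close>, which is integrability over the six-dimensional space of pairs \<open>(u, v)\<close>.
\<close>

lemma nn_integral_weighted_kernel_finite:
  fixes \<gamma> \<beta> :: real
  assumes \<gamma>: "-3 < \<gamma>" "\<gamma> \<le> 1" and \<beta>: "8 + 2 * max 0 \<gamma> < \<beta>"
  shows "(\<integral>\<^sup>+(v::real^3). (\<integral>\<^sup>+(u::real^3). ennreal (norm (v - u) powr \<gamma> *
            (1 + (norm u)\<^sup>2 + (norm v)\<^sup>2) powr (-\<beta>/2) * (1 + (norm v)\<^sup>2)) \<partial>lborel) \<partial>lborel) < \<infinity>"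
proof -
  define g where "g = max 0 \<gamma>"
  define \<kappa> where "\<kappa> = \<beta>/2 - 1 - g/2"
  have g: "0 \<le> g" "g \<le> 1" "\<gamma> \<le> g" using \<gamma> by (auto simp: g_def)
  have \<kappa>: "3 < \<kappa>" using \<beta> g by (simp add: \<kappa>_def g_def[symmetric])
  let ?J = "\<lambda>u::real^3. (1 + (norm u)\<^sup>2) powr (-\<kappa>/2)"
  let ?S = "\<lambda>z::real^3. indicator (ball 0 1) z * norm z powr \<gamma>"
  have pt: "norm (v - u) powr \<gamma> * (1 + (norm u)\<^sup>2 + (norm v)\<^sup>2) powr (-\<beta>/2) * (1 + (norm v)\<^sup>2)
     \<le> ?S (u - v) * ?J v + 2 * ?J u * ?J v" for u v :: "real^3"
  proof -
    define N where "N = 1 + (norm u)\<^sup>2 + (norm v)\<^sup>2"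
    have N1: "1 \<le> N" by (simp add: N_def)
    have NJ: "N powr (-\<kappa>) \<le> ?J u * ?J v"
    proof -
      have "N powr (-\<kappa>) = N powr (-\<kappa>/2) * N powr (-\<kappa>/2)" by (simp add: powr_add[symmetric])
      also have "\<dots> \<le> ?J u * ?J v"
        using \<kappa> by (intro mult_mono powr_mono2') (auto simp: N_def add_pos_nonneg)
      finally show ?thesis .
    qed
    have J1: "?J u \<le> 1"
    proof -
      have "?J u \<le> 1 powr (-\<kappa>/2)" using \<kappa> by (intro powr_mono2') auto
      then show ?thesis by simp
    qed
    have red: "N powr (-\<beta>/2) * (1 + (norm v)\<^sup>2) \<le> N powr (1 - \<beta>/2)"
    proof -
      have "N powr (-\<beta>/2) * (1 + (norm v)\<^sup>2) \<le> N powr (-\<beta>/2) * N powr 1"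
        using N1 by (intro mult_left_mono) (auto simp: N_def)
      also have "\<dots> = N powr (1 - \<beta>/2)" by (subst powr_add[symmetric]) (simp add: algebra_simps)
      finally show ?thesis .
    qed
    show ?thesis
    proof (cases "norm (v - u) < 1")
      case True
      have "N powr (1 - \<beta>/2) \<le> N powr (-\<kappa>)" using N1 g by (intro powr_mono) (auto simp: \<kappa>_def)
      also have "\<dots> \<le> 1 * ?J v" using NJ J1 mult_right_mono[OF J1, of "?J v"] by simp
      finally have "norm (v - u) powr \<gamma> * (N powr (-\<beta>/2) * (1 + (norm v)\<^sup>2)) \<le> norm (v - u) powr \<gamma> * ?J v"
        using red by (intro mult_left_mono) auto
      also have "\<dots> \<le> norm (v - u) powr \<gamma> * ?J v + 2 * ?J u * ?J v" by simp
      finally show ?thesis using True by (simp add: N_def mult.assoc norm_minus_commute)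
    next
      case False
      have "(norm (v - u))\<^sup>2 \<le> (norm u + norm v)\<^sup>2"
        by (intro power_mono) (metis add.commute norm_triangle_ineq4, simp)
      also have "\<dots> \<le> 2 * N"
        using sum_squares_bound[of "norm u" "norm v"] by (simp add: N_def power2_sum)
      finally have n2: "norm (v - u) powr 2 \<le> 2 * N" using False by (simp add: powr_numeral)
      have "norm (v - u) powr \<gamma> \<le> norm (v - u) powr g" using False g by (intro powr_mono) auto
      also have "\<dots> = (norm (v - u) powr 2) powr (g/2)" unfolding powr_powr by simp
      also have "\<dots> \<le> (2 * N) powr (g/2)" using n2 g by (intro powr_mono2) auto
      also have "\<dots> = 2 powr (g/2) * N powr (g/2)" using N1 by (simp add: powr_mult)
      also have "\<dots> \<le> 2 powr 1 * N powr (g/2)" using g by (intro mult_right_mono powr_mono) auto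
      finally have k: "norm (v - u) powr \<gamma> \<le> 2 * N powr (g/2)" by simp
      have "norm (v - u) powr \<gamma> * (N powr (-\<beta>/2) * (1 + (norm v)\<^sup>2)) \<le> (2 * N powr (g/2)) * N powr (1 - \<beta>/2)"
        using k red by (intro mult_mono) auto
      also have "\<dots> = 2 * N powr (-\<kappa>)" by (simp add: powr_add[symmetric] \<kappa>_def algebra_simps)
      also have "\<dots> \<le> 2 * (?J u * ?J v)" using NJ by simp
      also have "\<dots> \<le> ?S (u - v) * ?J v + 2 * (?J u * ?J v)" by simp
      finally show ?thesis by (simp only: N_def mult.assoc)
    qed
  qed
  let ?A = "\<integral>\<^sup>+z. ennreal (?S z) \<partial>lborel" and ?B = "\<integral>\<^sup>+u. ennreal (?J u) \<partial>lborel"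
  have [measurable]: "ball (0::real^3) 1 \<in> sets borel" by simp
  have inner: "(\<integral>\<^sup>+u. ennreal (norm (v - u) powr \<gamma> * (1 + (norm u)\<^sup>2 + (norm v)\<^sup>2) powr (-\<beta>/2) * (1 + (norm v)\<^sup>2)) \<partial>lborel)
      \<le> (?A + 2 * ?B) * ennreal (?J v)" for v :: "real^3"
  proof -
    have "(\<integral>\<^sup>+u. ennreal (norm (v - u) powr \<gamma> * (1 + (norm u)\<^sup>2 + (norm v)\<^sup>2) powr (-\<beta>/2) * (1 + (norm v)\<^sup>2)) \<partial>lborel)
      \<le> (\<integral>\<^sup>+u. ennreal (?S (u + - v)) * ennreal (?J v) + 2 * ennreal (?J u) * ennreal (?J v) \<partial>lborel)"
    proof (rule nn_integral_mono)
      fix u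
      have "ennreal (?S (u - v) * ?J v + 2 * ?J u * ?J v)
          = ennreal (?S (u + - v)) * ennreal (?J v) + 2 * ennreal (?J u) * ennreal (?J v)"
        by (simp add: ennreal_mult)
      with ennreal_leI[OF pt[where u=u and v=v]]
      show "ennreal (norm (v - u) powr \<gamma> * (1 + (norm u)\<^sup>2 + (norm v)\<^sup>2) powr (-\<beta>/2) * (1 + (norm v)\<^sup>2))
         \<le> ennreal (?S (u + - v)) * ennreal (?J v) + 2 * ennreal (?J u) * ennreal (?J v)" by metis
    qed
    also have "\<dots> = (\<integral>\<^sup>+u. ennreal (?S (u + - v)) * ennreal (?J v) \<partial>lborel) + (\<integral>\<^sup>+u. 2 * ennreal (?J u) * ennreal (?J v) \<partial>lborel)"
      by (rule nn_integral_add) measurable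
    also have "(\<integral>\<^sup>+u. ennreal (?S (u + - v)) * ennreal (?J v) \<partial>lborel) = (\<integral>\<^sup>+u. ennreal (?S (u + - v)) \<partial>lborel) * ennreal (?J v)"
      by (rule nn_integral_multc) measurable
    also have "(\<integral>\<^sup>+u. ennreal (?S (u + - v)) \<partial>lborel) = ?A"
      by (rule nn_integral_lborel_translate) measurable
    also have "(\<integral>\<^sup>+u. 2 * ennreal (?J u) * ennreal (?J v) \<partial>lborel) = 2 * ?B * ennreal (?J v)"
      by (simp add: nn_integral_multc nn_integral_cmult)
    finally show ?thesis by (simp add: distrib_right)
  qed
  have "(\<integral>\<^sup>+(v::real^3). (\<integral>\<^sup>+(u::real^3). ennreal (norm (v - u) powr \<gamma> *
            (1 + (norm u)\<^sup>2 + (norm v)\<^sup>2) powr (-\<beta>/2) * (1 + (norm v)\<^sup>2)) \<partial>lborel) \<partial>lborel)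
     \<le> (\<integral>\<^sup>+v. (?A + 2 * ?B) * ennreal (?J v) \<partial>lborel)"
    by (intro nn_integral_mono inner)
  also have "\<dots> = (?A + 2 * ?B) * ?B" by (rule nn_integral_cmult) measurable
  also have "\<dots> < \<infinity>"
    using nn_integral_norm_powr_ball_finite[OF \<gamma>(1)] nn_integral_japanese_bracket_finite[OF \<kappa>]
    by (auto simp: ennreal_mult_less_top ennreal_add_less_top)
  finally show ?thesis .
qed

section \<open>Post-collisional velocities avoid null sets\<close>

lemma pred_AE_lborel:
  fixes P :: "'a \<Rightarrow> 'b::euclidean_space \<Rightarrow> bool"
  assumes [measurable]: "Measurable.pred (M \<Otimes>\<^sub>M borel) (\<lambda>z. P (fst z) (snd z))"
  shows "Measurable.pred M (\<lambda>x. AE y in lborel. P x y)"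
proof -
  have [measurable]: "Measurable.pred (M \<Otimes>\<^sub>M lborel) (\<lambda>z. P (fst z) (snd z))"
    using assms by (simp cong: measurable_cong_sets)
  have eq: "(AE y in lborel. P x y) \<longleftrightarrow> (\<integral>\<^sup>+y. (if P x y then 0 else 1) \<partial>lborel) = (0::ennreal)"
    if "x \<in> space M" for x
  proof -
    have "(\<lambda>y. if P x y then 0 else (1::ennreal)) \<in> borel_measurable lborel"
      using measurable_compose[OF measurable_Pair1'[OF that] assms] by (intro measurable_If) auto
    then show ?thesis by (subst nn_integral_0_iff_AE) (auto intro!: AE_cong)
  qed
  have m: "Measurable.pred M (\<lambda>x. (\<integral>\<^sup>+y. (if P x y then 0 else 1) \<partial>lborel) = (0::ennreal))"
    by measurable
  show ?thesis by (rule measurable_cong[THEN iffD2, OF eq m])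
qed

text \<open>
  For each fixed \<open>s \<noteq> 0\<close> the dilation \<open>y \<mapsto> v + s y\<close> preserves null sets; exchanging the order of
  the two variables gives the statement about lines.
\<close>

lemma AE_lborel_line_avoids_null:
  fixes N :: "'a::euclidean_space set"
  assumes N: "N \<in> null_sets lborel"
  shows "AE y in lborel. AE s::real in lborel. v + s *\<^sub>R y \<notin> N"
proof -
  have [measurable]: "N \<in> sets borel" using N by auto
  have nN: "AE y in lborel. y \<notin> N" using N by (rule AE_not_in)
  have "AE s::real in lborel. AE y in lborel. v + s *\<^sub>R y \<notin> N"
    using AE_lborel_singleton[of "0::real"]
    by eventually_elim (rule AE_lborel_affine[OF nN])
  then show ?thesis by (subst AE_lborel_swap) auto
qed

lemma AE_sphere_line_avoids_null:
  fixes N :: "(real^3) set" and v :: "real^3"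
  assumes N: "N \<in> null_sets lborel"
  shows "AE \<omega> in sphere_measure. AE s in lborel. v + s *\<^sub>R \<omega> \<notin> N"
proof -
  have [measurable]: "N \<in> sets borel" using N by auto
  have [measurable]: "Measurable.pred borel (\<lambda>y. AE s in lborel. v + s *\<^sub>R y \<notin> N)"
    by (rule pred_AE_lborel) measurable
  note AE_lborel_line_avoids_null[OF N, of v]
  moreover have "AE y in lborel. y \<noteq> (0::real^3)" by (rule AE_lborel_singleton)
  ultimately have "AE y in lborel. AE s::real in lborel. v + s *\<^sub>R sgn y \<notin> N"
  proof eventually_elim
    case (elim y)
    from AE_lborel_affine[OF elim(1), of "inverse (norm y)" 0] elim(2)
    show ?case by (simp add: sgn_div_norm mult.commute)
  qed
  then show ?thesis by (intro AE_sphere_measure) auto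
qed

text \<open>
  Moving \<open>u\<close> along \<open>\<omega>\<close> moves \<open>v'\<close> along the line through \<open>v\<close> in direction \<open>\<omega>\<close> at unit speed.
\<close>

lemma AE_post_v_avoids_null:
  assumes N: "N \<in> null_sets lborel"
  shows "AE \<omega> in sphere_measure. AE u in lborel. post_v u v \<omega> \<notin> N"
  using AE_sphere_line_avoids_null[OF N, of v] AE_space
proof eventually_elim
  case (elim \<omega>)
  have [measurable]: "N \<in> sets borel" using N by auto
  have n: "\<omega> \<bullet> \<omega> = 1" using elim(2) by (simp add: space_sphere_measure dot_square_norm)
  show ?case
  proof (rule AE_lborel_if_translates[where w="\<lambda>s::real. s *\<^sub>R \<omega>"])
    show "Measurable.pred borel (\<lambda>u. post_v u v \<omega> \<notin> N)" unfolding post_v_def by measurable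
    fix u
    have "post_v (u + s *\<^sub>R \<omega>) v \<omega> = v + (s - (v - u) \<bullet> \<omega>) *\<^sub>R \<omega>" for s
      by (simp add: post_v_def inner_diff_left inner_add_left n algebra_simps)
    then show "AE s in lborel. post_v (u + s *\<^sub>R \<omega>) v \<omega> \<notin> N"
      using AE_lborel_translate[OF elim(1), of "- ((v - u) \<bullet> \<omega>)"] by simp
  qed simp
qed

text \<open>
  For fixed \<open>z\<close>, the quadratic map \<open>y \<mapsto> |y|\<^sup>2 z - (y \<bullet> z) y\<close> turns the direction of \<open>y\<close> into the
  direction of the component of \<open>z\<close> orthogonal to \<open>y\<close>, and up to sign it is an involution on
  directions in the plane of \<open>y\<close> and \<open>z\<close>. So it exchanges the components of \<open>z\<close> along \<open>y\<close> and orthogonal to \<open>y\<close>,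
  and being smooth it preserves null sets. This reduces the statement for the orthogonal component to
  the statement for the parallel one.
\<close>

lemma AE_orthogonal_part_avoids_null:
  fixes z :: "real^3"
  assumes z: "z \<noteq> 0" and N [measurable]: "N \<in> sets borel"
    and par: "AE y in lborel. v + ((z \<bullet> y) / (norm y)\<^sup>2) *\<^sub>R y \<notin> N"
  shows "AE y in lborel. v + (z - ((z \<bullet> y) / (norm y)\<^sup>2) *\<^sub>R y) \<notin> N"
proof -
  define \<Psi> where "\<Psi> y = (norm y)\<^sup>2 *\<^sub>R z - (y \<bullet> z) *\<^sub>R y" for y
  define A where "A = {y. v + (z - ((z \<bullet> y) / (norm y)\<^sup>2) *\<^sub>R y) \<in> N}"
  define M where "M = {y. v + ((z \<bullet> y) / (norm y)\<^sup>2) *\<^sub>R y \<in> N}"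
  define H where "H = {y. z \<bullet> y = 0}"
  define L where "L = span {z}"
  have [measurable]: "A \<in> sets borel" "M \<in> sets borel" unfolding A_def M_def by measurable
  have "M \<in> null_sets lborel" using par by (subst AE_iff_null_sets) (auto simp: M_def)
  then have nM: "negligible M" by (simp add: negligible_iff_null_sets null_sets_completion_iff)
  have "(\<Psi> has_derivative (\<lambda>d. (2 * (y \<bullet> d)) *\<^sub>R z - ((y \<bullet> z) *\<^sub>R d + (d \<bullet> z) *\<^sub>R y))) (at y)" for y
    unfolding \<Psi>_def power2_norm_eq_inner
    by (auto intro!: derivative_eq_intros simp: inner_commute)
  then have "\<Psi> differentiable_on S" for S
    unfolding differentiable_on_def differentiable_def by (meson has_derivative_at_withinI)
  then have nP: "negligible (\<Psi> ` M)" by (intro negligible_differentiable_image_negligible[OF _ nM]) auto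
  have "(uminus :: real^3 \<Rightarrow> real^3) differentiable_on S" for S
    by (intro linear_imp_differentiable_on linear_uminus)
  then have nP': "negligible (uminus ` \<Psi> ` M)"
    by (rule negligible_differentiable_image_negligible[OF order_refl nP])
  have nH: "negligible H" unfolding H_def using z by (intro negligible_hyperplane) simp
  have nL: "negligible L"
    unfolding L_def by (rule negligible_lowdim) (use z in \<open>simp add: dim_span dim_singleton\<close>)
  have sub: "A \<subseteq> \<Psi> ` M \<union> uminus ` \<Psi> ` M \<union> H \<union> L"
  proof
    fix y assume y: "y \<in> A"
    show "y \<in> \<Psi> ` M \<union> uminus ` \<Psi> ` M \<union> H \<union> L"
    proof (cases "y \<in> H \<union> L")
      case False
      define c where "c = y \<bullet> z"
      define n where "n = (norm y)\<^sup>2"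
      define m where "m = (norm z)\<^sup>2"
      \<comment> \<open>\<open>w\<close> is the direction orthogonal to \<open>y\<close> in the plane of \<open>y\<close> and \<open>z\<close>, so \<open>w\<close> lies in \<open>M\<close>\<close>
      define w where "w = \<Psi> y"
      have c0: "c \<noteq> 0" using False by (auto simp: H_def c_def inner_commute)
      have y0: "y \<noteq> 0" using False by (auto simp: L_def span_zero)
      have n0: "0 < n" using y0 by (simp add: n_def)
      have wdef: "w = n *\<^sub>R z - c *\<^sub>R y" by (simp add: w_def \<Psi>_def n_def c_def)
      have w0: "w \<noteq> 0"
      proof
        assume "w = 0"
        then have "c *\<^sub>R y = n *\<^sub>R z" by (simp add: wdef)
        then have "y = (n / c) *\<^sub>R z" using c0 by (metis divide_inverse_commute left_inverse scaleR_one scaleR_scaleR)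
        then have "y \<in> L" unfolding L_def by (metis span_base span_scale singletonI)
        then show False using False by simp
      qed
      have yy: "y \<bullet> y = n" and zz: "z \<bullet> z = m" by (simp_all add: n_def m_def power2_norm_eq_inner)
      have wz: "w \<bullet> z = n * m - c * c" unfolding wdef by (simp add: inner_diff_left zz c_def)
      have zw: "z \<bullet> w = n * m - c * c" using wz by (simp add: inner_commute)
      have ww: "(norm w)\<^sup>2 = n * (n * m - c * c)"
        unfolding power2_norm_eq_inner wdef
        by (simp add: inner_diff_left inner_diff_right yy zz inner_commute[of z y] c_def[symmetric] algebra_simps)
      define d where "d = n * m - c * c"
      have d0: "0 < d"
      proof -
        have "0 < n * d" using w0 ww by (simp add: d_def) (metis zero_less_norm_iff zero_less_power ww)
        then show ?thesis using n0 zero_less_mult_pos by blast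
      qed
      have \<Psi>w: "\<Psi> w = (d * c) *\<^sub>R y"
        unfolding \<Psi>_def ww wz unfolding wdef by (simp add: d_def algebra_simps)
      have "((z \<bullet> w) / (norm w)\<^sup>2) *\<^sub>R w = z - ((z \<bullet> y) / (norm y)\<^sup>2) *\<^sub>R y"
      proof -
        have "(z \<bullet> w) / (norm w)\<^sup>2 = 1 / n" using d0 n0 by (simp add: zw ww d_def[symmetric])
        then show ?thesis using n0 by (simp add: wdef scaleR_diff_right n_def[symmetric] inner_commute[of z y] c_def[symmetric])
      qed
      then have wM: "w \<in> M" using y by (simp add: A_def M_def)
      \<comment> \<open>\<open>\<Psi>\<close> is homogeneous of degree two and \<open>M\<close> is a cone, so \<open>w\<close> can be rescaled within \<open>M\<close> to a
        preimage of \<open>y\<close> or of \<open>- y\<close>, according to the sign of \<open>c\<close>\<close>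
      define k where "k = 1 / sqrt (d * \<bar>c\<bar>)"
      have k0: "k \<noteq> 0" using d0 c0 by (simp add: k_def)
      have k2: "k\<^sup>2 * (d * \<bar>c\<bar>) = 1" using d0 c0 by (simp add: k_def power_divide)
      have kM: "k *\<^sub>R w \<in> M"
      proof -
        have "(z \<bullet> (k *\<^sub>R w)) / (norm (k *\<^sub>R w))\<^sup>2 * k = (z \<bullet> w) / (norm w)\<^sup>2"
          using k0 w0 by (simp add: power_mult_distrib field_simps power2_eq_square)
        then show ?thesis using wM by (simp add: M_def)
      qed
      have "\<Psi> (k *\<^sub>R w) = k\<^sup>2 *\<^sub>R \<Psi> w"
        by (simp add: \<Psi>_def power_mult_distrib scaleR_diff_right) (simp add: power2_eq_square mult_ac)
      then have im: "\<Psi> (k *\<^sub>R w) = (k\<^sup>2 * (d * c)) *\<^sub>R y" by (simp add: \<Psi>w)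
      show ?thesis
      proof (cases "0 < c")
        case True
        then have "\<Psi> (k *\<^sub>R w) = y" using im k2 by simp
        then show ?thesis using kM by (metis UnI1 image_eqI)
      next
        case False
        then have "k\<^sup>2 * (d * c) = -1" using k2 by simp
        then have "- \<Psi> (k *\<^sub>R w) = y" using im by simp
        then show ?thesis using kM by (metis UnI1 UnI2 image_eqI)
      qed
    qed simp
  qed
  have "negligible A"
    by (rule negligible_subset[OF _ sub]) (intro negligible_Un nP nP' nH nL)
  then have "AE y in lborel. y \<notin> A" by (rule AE_lborel_not_in_negligible) measurable
  then show ?thesis by (simp add: A_def)
qed

text \<open>
  The bounds on \<open>F(s, y, \<cdot>)\<close> hold off a null set that depends on \<open>y\<close>, and \<open>y\<close> depends on \<open>v\<close> along a
  characteristic. So \<open>v\<close> has to stay fixed here, and the usual measure preserving change of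
  variables \<open>(u, v) \<mapsto> (u', v')\<close> cannot be used.
\<close>

lemma AE_post_velocities_avoid_null:
  assumes N: "N \<in> null_sets lborel"
  shows "AE p in phase_measure. post_u (fst p) v (snd p) \<notin> N \<and> post_v (fst p) v (snd p) \<notin> N"
proof -
  have [measurable]: "N \<in> sets borel" using N by auto
  interpret pair_sigma_finite "lborel :: (real^3) measure" sphere_measure
    by (intro pair_sigma_finite.intro sphere.sigma_finite_measure_axioms lborel.sigma_finite_measure_axioms)
  have [measurable]: "snd \<in> borel_measurable phase_measure"
    by (rule measurable_compose[OF measurable_snd measurable_sphere_measure_ident, unfolded id_def])
  have mv: "Measurable.pred phase_measure (\<lambda>p. post_v (fst p) v (snd p) \<notin> N)"
    unfolding post_v_def by measurable
  have mu: "Measurable.pred phase_measure (\<lambda>p. post_u (fst p) v (snd p) \<notin> N)"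
    unfolding post_u_def by measurable
  have "AE u in lborel. AE \<omega> in sphere_measure. post_v u v \<omega> \<notin> N"
    using AE_post_v_avoids_null[OF N, of v] mv
    by (subst AE_commute) (simp_all add: pred_def)
  then have v: "AE p in phase_measure. post_v (fst p) v (snd p) \<notin> N"
    using mv by (subst AE_pair_iff[symmetric, where P="\<lambda>u \<omega>. post_v u v \<omega> \<notin> N"]) (auto simp: pred_def case_prod_beta')
  have "AE y in lborel. AE s::real in lborel. v + s *\<^sub>R y \<notin> N"
    by (rule AE_lborel_line_avoids_null[OF N])
  then have par: "AE y in lborel. AE z in lborel. v + ((z \<bullet> y) / (norm y)\<^sup>2) *\<^sub>R y \<notin> N"
    using AE_lborel_singleton[of "0::real^3"]
  proof eventually_elim
    case (elim y)
    show ?case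
    proof (rule AE_lborel_if_translates[where w="\<lambda>s::real. s *\<^sub>R y"])
      fix z
      have "((z + s *\<^sub>R y) \<bullet> y / (norm y)\<^sup>2) = (z \<bullet> y) / (norm y)\<^sup>2 + s" for s
        using elim(2) by (simp add: inner_add_left power2_norm_eq_inner field_simps)
      then show "AE s in lborel. v + (((z + s *\<^sub>R y) \<bullet> y) / (norm y)\<^sup>2) *\<^sub>R y \<notin> N"
        using AE_lborel_translate[OF elim(1), of "(z \<bullet> y) / (norm y)\<^sup>2"] by simp
    qed measurable
  qed
  have "AE z in lborel. AE y in lborel. v + ((z \<bullet> y) / (norm y)\<^sup>2) *\<^sub>R y \<notin> N"
    using par by (subst AE_lborel_swap) measurable
  then have perp: "AE z in lborel. AE y in lborel. v + (z - ((z \<bullet> y) / (norm y)\<^sup>2) *\<^sub>R y) \<notin> N"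
    using AE_lborel_singleton[of "0::real^3"]
    by eventually_elim (rule AE_orthogonal_part_avoids_null, auto)
  have "AE u in lborel. AE \<omega> in sphere_measure. post_u u v \<omega> \<notin> N"
    using AE_lborel_translate[OF perp, of "- v"]
  proof eventually_elim
    case (elim u)
    have "AE y in lborel. post_u u v (sgn y) \<notin> N"
      using elim AE_lborel_singleton[of "0::real^3"]
    proof eventually_elim
      case (elim y)
      have "v + ((- v + u) - (((- v + u) \<bullet> y) / (norm y)\<^sup>2) *\<^sub>R y) = post_u u v (sgn y)"
        by (simp add: post_u_def sgn_div_norm inner_diff_left inner_add_left power2_eq_square divide_inverse algebra_simps)
      then show ?case using elim(1) by simp
    qed
    then show ?case by (intro AE_sphere_measure) (auto simp: post_u_def)
  qed
  then have u: "AE p in phase_measure. post_u (fst p) v (snd p) \<notin> N"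
    using mu by (subst AE_pair_iff[symmetric, where P="\<lambda>u \<omega>. post_u u v \<omega> \<notin> N"]) (auto simp: pred_def case_prod_beta')
  from u v show ?thesis by eventually_elim simp
qed

section \<open>Continuity in the mean along characteristics\<close>

text \<open>
  Outer regularity reduces the claim to open sets \<open>U\<close> of finite measure, whose indicator is the
  increasing limit of the Lipschitz functions \<open>min 1 (n dist(x, - U))\<close>.
\<close>

lemma integrable_approx_uniformly_continuous:
  fixes g :: "'a::euclidean_space \<Rightarrow> real"
  assumes "integrable lborel g"
  shows "\<forall>e>0. \<exists>\<phi>. uniformly_continuous_on UNIV \<phi> \<and> bounded (range \<phi>) \<and> integrable lborel \<phi> \<and>
           (LINT x|lborel. \<bar>g x - \<phi> x\<bar>) < e"
  using assms
proof (induction g rule: integrable_induct)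
  case (base A c)
  have A: "A \<in> sets borel" "emeasure lborel A < \<infinity>" using base by auto
  show ?case
  proof (intro allI impI)
    fix e :: real assume "0 < e"
    define d where "d = e / (2 * (\<bar>c\<bar> + 1))"
    have d: "0 < d" using \<open>0 < e\<close> by (simp add: d_def)
    obtain U where U: "open U" "A \<subseteq> U" "emeasure lborel (U - A) < d"
      using outer_regular_lborel[OF A(1) d] by blast
    have [measurable]: "U \<in> sets borel" "A \<in> sets borel" using U A by auto
    have "emeasure lborel U = emeasure lborel (A \<union> (U - A))" using U(2) by (simp add: Un_absorb1)
    also have "\<dots> \<le> emeasure lborel A + emeasure lborel (U - A)" by (rule emeasure_subadditive) auto
    also have "\<dots> < \<infinity>" using A U(3) by (auto simp: ennreal_add_less_top intro: less_trans[OF _ ennreal_less_top])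
    finally have fU: "emeasure lborel U < \<infinity>" .
    have cne: "- U \<noteq> {}"
    proof
      assume "- U = {}"
      then have "U = UNIV" by blast
      with fU show False by simp
    qed
    define \<phi> where "\<phi> n x = min 1 (real n * infdist x (- U))" for n x
    have \<phi>01: "0 \<le> \<phi> n x" "\<phi> n x \<le> indicator U x" for n x
      using cne by (auto simp: \<phi>_def indicator_def infdist_nonneg)
    have \<phi>m [measurable]: "\<phi> n \<in> borel_measurable borel" for n
      unfolding \<phi>_def by (intro borel_measurable_continuous_onI continuous_intros)
    have iU: "integrable lborel (indicator U :: 'a \<Rightarrow> real)" and iA: "integrable lborel (indicator A :: 'a \<Rightarrow> real)"
      using fU A by (auto intro!: integrable_real_indicator)
    have i\<phi>: "integrable lborel (\<phi> n)" for n
      by (rule Bochner_Integration.integrable_bound[OF iU]) (use \<phi>01 in \<open>auto intro!: AE_I2\<close>)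
    have lim: "(\<lambda>n. \<phi> n x) \<longlonglongrightarrow> indicator U x" for x
    proof (cases "x \<in> U")
      case True
      have pos: "0 < infdist x (- U)"
        using infdist_pos_not_in_closed[of "- U" x] cne U(1) True by (auto simp: closed_Compl)
      obtain m :: nat where m: "1 / infdist x (- U) < real m" using reals_Archimedean2 by blast
      have "eventually (\<lambda>n. \<phi> n x = 1) sequentially"
        using eventually_ge_at_top[of m]
      proof eventually_elim
        case (elim n)
        have "1 \<le> real m * infdist x (- U)" using m pos by (simp add: field_simps)
        also have "\<dots> \<le> real n * infdist x (- U)" using elim pos by (intro mult_right_mono) auto
        finally show ?case by (simp add: \<phi>_def)
      qed
      then show ?thesis using True by (simp add: tendsto_eventually)
    next
      case False
      then have "\<phi> n x = 0" for n using \<phi>01[of n x] by simp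
      then show ?thesis using False by simp
    qed
    have "(\<lambda>n. LINT x|lborel. \<bar>indicator U x - \<phi> n x\<bar>) \<longlonglongrightarrow> (LINT x|lborel. \<bar>indicator U x - indicator U x :: real\<bar>)"
    proof (rule integral_dominated_convergence[where w="\<lambda>x::'a. indicator U x"])
      show "AE x in lborel. (\<lambda>n. \<bar>indicator U x - \<phi> n x\<bar>) \<longlonglongrightarrow> \<bar>indicator U x - indicator U x :: real\<bar>"
        by (intro AE_I2 tendsto_intros lim)
    qed (use \<phi>01 iU in \<open>auto intro!: AE_I2 simp: abs_le_iff\<close>)
    then have "(\<lambda>n. LINT x|lborel. \<bar>indicator U x - \<phi> n x\<bar>) \<longlonglongrightarrow> 0" by simp
    then have "eventually (\<lambda>n. (LINT x|lborel. \<bar>indicator U x - \<phi> n x\<bar>) < d) sequentially"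
      using d by (rule order_tendstoD)
    then obtain n where n: "(LINT x|lborel. \<bar>indicator U x - \<phi> n x\<bar>) < d" by (auto simp: eventually_sequentially)
    have UA: "(LINT x|lborel. \<bar>indicator A x - indicator U x :: real\<bar>) < d"
    proof -
      have "(LINT x|lborel. \<bar>indicator A x - indicator U x :: real\<bar>) = (LINT x|lborel. indicator (U - A) x)"
        using U(2) by (intro Bochner_Integration.integral_cong) (auto simp: indicator_def)
      also have "\<dots> = measure lborel (U - A)" by simp
      also have "\<dots> < d" using U(3) d by (simp add: measure_def enn2real_less_iff less_trans[OF _ ennreal_less_top])
      finally show ?thesis .
    qed
    have "(LINT x|lborel. \<bar>indicator A x - \<phi> n x\<bar>)
        \<le> (LINT x|lborel. \<bar>indicator A x - indicator U x\<bar> + \<bar>indicator U x - \<phi> n x\<bar>)"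
      using iA iU i\<phi> by (intro integral_mono) auto
    also have "\<dots> = (LINT x|lborel. \<bar>indicator A x - indicator U x :: real\<bar>) + (LINT x|lborel. \<bar>indicator U x - \<phi> n x\<bar>)"
      using iA iU i\<phi> by (intro Bochner_Integration.integral_add) auto
    also have "\<dots> < 2 * d" using n UA by simp
    finally have lt: "(LINT x|lborel. \<bar>indicator A x - \<phi> n x\<bar>) < 2 * d" .
    have "(LINT x|lborel. \<bar>indicator A x *\<^sub>R c - c * \<phi> n x\<bar>) = \<bar>c\<bar> * (LINT x|lborel. \<bar>indicator A x - \<phi> n x\<bar>)"
      by (subst integral_mult_right_zero[symmetric])
        (auto intro!: Bochner_Integration.integral_cong simp: abs_mult[symmetric] algebra_simps)
    also have "\<dots> \<le> \<bar>c\<bar> * (2 * d)" using lt by (intro mult_left_mono) auto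
    also have "\<dots> < e" using \<open>0 < e\<close> by (simp add: d_def field_simps)
    finally have "(LINT x|lborel. \<bar>indicator A x *\<^sub>R c - c * \<phi> n x\<bar>) < e" .
    moreover have "uniformly_continuous_on UNIV (\<lambda>x. c * \<phi> n x)"
    proof -
      have lip: "\<bar>\<phi> n x - \<phi> n y\<bar> \<le> real n * dist x y" for x y
      proof -
        have "\<bar>\<phi> n x - \<phi> n y\<bar> \<le> \<bar>real n * infdist x (- U) - real n * infdist y (- U)\<bar>"
          unfolding \<phi>_def by (simp add: min_def)
        also have "\<dots> = real n * \<bar>infdist x (- U) - infdist y (- U)\<bar>"
          by (simp add: right_diff_distrib[symmetric] abs_mult)
        also have "\<dots> \<le> real n * dist x y" by (intro mult_left_mono infdist_triangle_abs) simp
        finally show ?thesis .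
      qed
      have "(real n)-lipschitz_on UNIV (\<phi> n)"
        using lip by (intro lipschitz_onI) (auto simp: dist_real_def)
      then have "uniformly_continuous_on UNIV (\<phi> n)" by (rule lipschitz_on_uniformly_continuous)
      then show ?thesis
        using uniformly_continuous_on_cmul[of UNIV "\<phi> n" c] by simp
    qed
    moreover have "bounded (range (\<lambda>x. c * \<phi> n x))"
    proof (rule boundedI)
      fix y assume "y \<in> range (\<lambda>x. c * \<phi> n x)"
      then obtain x where "y = c * \<phi> n x" by blast
      moreover have "\<bar>\<phi> n x\<bar> \<le> 1" using \<phi>01[of n x] by (auto simp: \<phi>_def)
      ultimately show "norm y \<le> \<bar>c\<bar>" by (simp add: abs_mult mult_left_le)
    qed
    ultimately show "\<exists>\<phi>. uniformly_continuous_on UNIV \<phi> \<and> bounded (range \<phi>) \<and> integrable lborel \<phi> \<and>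
       (LINT x|lborel. \<bar>indicator A x *\<^sub>R c - \<phi> x\<bar>) < e"
      using i\<phi>[of n] by (intro exI[of _ "\<lambda>x. c * \<phi> n x"]) auto
  qed
next
  case (add f g)
  show ?case
  proof (intro allI impI)
    fix e :: real assume "0 < e"
    obtain \<phi> where \<phi>: "uniformly_continuous_on UNIV \<phi>" "bounded (range \<phi>)" "integrable lborel \<phi>"
      "(LINT x|lborel. \<bar>f x - \<phi> x\<bar>) < e/2" using add.IH(1) \<open>0 < e\<close> half_gt_zero by blast
    obtain \<psi> where \<psi>: "uniformly_continuous_on UNIV \<psi>" "bounded (range \<psi>)" "integrable lborel \<psi>"
      "(LINT x|lborel. \<bar>g x - \<psi> x\<bar>) < e/2" using add.IH(2) \<open>0 < e\<close> half_gt_zero by blast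
    have "(LINT x|lborel. \<bar>f x + g x - (\<phi> x + \<psi> x)\<bar>) \<le> (LINT x|lborel. \<bar>f x - \<phi> x\<bar> + \<bar>g x - \<psi> x\<bar>)"
      using add.hyps \<phi>(3) \<psi>(3) by (intro integral_mono) auto
    also have "\<dots> = (LINT x|lborel. \<bar>f x - \<phi> x\<bar>) + (LINT x|lborel. \<bar>g x - \<psi> x\<bar>)"
      using add.hyps \<phi>(3) \<psi>(3) by (intro Bochner_Integration.integral_add) auto
    also have "\<dots> < e" using \<phi>(4) \<psi>(4) by simp
    finally show "\<exists>\<phi>. uniformly_continuous_on UNIV \<phi> \<and> bounded (range \<phi>) \<and> integrable lborel \<phi> \<and>
       (LINT x|lborel. \<bar>f x + g x - \<phi> x\<bar>) < e"
      using \<phi> \<psi> by (intro exI[of _ "\<lambda>x. \<phi> x + \<psi> x"] conjI uniformly_continuous_on_add bounded_plus_comp) auto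
  qed
next
  case (lim f s)
  show ?case
  proof (intro allI impI)
    fix e :: real assume "0 < e"
    have "(\<lambda>i. LINT x|lborel. \<bar>f x - s i x\<bar>) \<longlonglongrightarrow> (LINT x|lborel. \<bar>f x - f x\<bar>)"
    proof (rule integral_dominated_convergence[where w="\<lambda>x. 3 * \<bar>f x\<bar>"])
      show "AE x in lborel. norm \<bar>f x - s i x\<bar> \<le> 3 * \<bar>f x\<bar>" for i
        using lim.hyps(3)[of _ i] by (intro AE_I2) (fastforce simp: abs_le_iff)
      show "AE x in lborel. (\<lambda>i. \<bar>f x - s i x\<bar>) \<longlonglongrightarrow> \<bar>f x - f x\<bar>"
        using lim.hyps(2) by (intro AE_I2 tendsto_intros) auto
    qed (use lim.hyps in auto)
    then have "(\<lambda>i. LINT x|lborel. \<bar>f x - s i x\<bar>) \<longlonglongrightarrow> 0" by simp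
    then have "eventually (\<lambda>i. (LINT x|lborel. \<bar>f x - s i x\<bar>) < e/2) sequentially"
      using \<open>0 < e\<close> by (intro order_tendstoD) auto
    then obtain i where i: "(LINT x|lborel. \<bar>f x - s i x\<bar>) < e/2" by (auto simp: eventually_sequentially)
    obtain \<phi> where \<phi>: "uniformly_continuous_on UNIV \<phi>" "bounded (range \<phi>)" "integrable lborel \<phi>"
      "(LINT x|lborel. \<bar>s i x - \<phi> x\<bar>) < e/2" using lim.IH \<open>0 < e\<close> half_gt_zero by blast
    have "(LINT x|lborel. \<bar>f x - \<phi> x\<bar>) \<le> (LINT x|lborel. \<bar>f x - s i x\<bar> + \<bar>s i x - \<phi> x\<bar>)"
      using lim.hyps \<phi>(3) by (intro integral_mono) auto
    also have "\<dots> = (LINT x|lborel. \<bar>f x - s i x\<bar>) + (LINT x|lborel. \<bar>s i x - \<phi> x\<bar>)"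
      using lim.hyps \<phi>(3) by (intro Bochner_Integration.integral_add) auto
    also have "\<dots> < e" using i \<phi>(4) by simp
    finally show "\<exists>\<phi>. uniformly_continuous_on UNIV \<phi> \<and> bounded (range \<phi>) \<and> integrable lborel \<phi> \<and>
       (LINT x|lborel. \<bar>f x - \<phi> x\<bar>) < e" using \<phi> by blast
  qed
qed


lemma nn_integral_characteristic:
  fixes G :: "'a::euclidean_space \<times> 'b::euclidean_space \<Rightarrow> ennreal"
  assumes [measurable]: "G \<in> borel_measurable (borel \<Otimes>\<^sub>M borel)" and "s \<noteq> 0"
  shows "ennreal (\<bar>s\<bar> ^ DIM('a)) * (\<integral>\<^sup>+v. (\<integral>\<^sup>+u. G (x - s *\<^sub>R v, u) \<partial>lborel) \<partial>lborel) = (\<integral>\<^sup>+z. G z \<partial>lborel)"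
proof -
  have m: "G \<in> borel_measurable (lborel \<Otimes>\<^sub>M lborel)" by (simp cong: measurable_cong_sets)
  have "(\<integral>\<^sup>+z. G z \<partial>lborel) = (\<integral>\<^sup>+y. (\<integral>\<^sup>+u. G (y, u) \<partial>lborel) \<partial>lborel)"
    unfolding lborel_prod[symmetric] by (rule lborel.nn_integral_fst[OF m, symmetric])
  also have "\<dots> = ennreal (\<bar>- s\<bar> ^ DIM('a)) * (\<integral>\<^sup>+v. (\<integral>\<^sup>+u. G (x + (- s) *\<^sub>R v, u) \<partial>lborel) \<partial>lborel)"
    using \<open>s \<noteq> 0\<close> by (intro nn_integral_lborel_affine) auto
  finally show ?thesis by simp
qed

text \<open>
  The factor by which \<open>v \<mapsto> x - (t - \<tau>) v\<close> scales Lebesgue measure does not depend on \<open>x\<close> and stays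
  away from zero as \<open>t\<close> tends to \<open>t0\<close>. So \<open>g\<close> may be replaced by a uniformly continuous function, and
  the starting points may move to infinity along the sequence.
\<close>

lemma mean_continuity_along_characteristics:
  fixes g :: "'a::euclidean_space \<times> 'b::euclidean_space \<Rightarrow> real"
    and P :: "'a \<Rightarrow> real" and R :: "'b \<Rightarrow> real"
  assumes g: "integrable lborel g"
    and P [measurable]: "P \<in> borel_measurable borel" and R [measurable]: "R \<in> borel_measurable borel"
    and P01: "\<And>v. 0 \<le> P v" "\<And>v. P v \<le> 1" and R01: "\<And>u. 0 \<le> R u" "\<And>u. R u \<le> 1"
    and Pfin: "(\<integral>\<^sup>+v. P v \<partial>lborel) < \<infinity>" and Rfin: "(\<integral>\<^sup>+u. R u \<partial>lborel) < \<infinity>"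
    and t: "t \<longlonglongrightarrow> t0" and t': "t' \<longlonglongrightarrow> t0" and x: "(\<lambda>n. x' n - x n) \<longlonglongrightarrow> 0" and \<tau>: "\<tau> \<noteq> t0"
  shows "(\<lambda>n. \<integral>\<^sup>+v. (\<integral>\<^sup>+u. ennreal (\<bar>g (x' n - (t' n - \<tau>) *\<^sub>R v, u) - g (x n - (t n - \<tau>) *\<^sub>R v, u)\<bar> * (P v * R u)) \<partial>lborel) \<partial>lborel)
     \<longlonglongrightarrow> 0"
    (is "?E \<longlonglongrightarrow> 0")
proof (rule order_tendstoI)
  fix e :: ennreal assume "0 < e"
  define s0 where "s0 = \<bar>t0 - \<tau>\<bar> / 2"
  have s0: "0 < s0" using \<tau> by (simp add: s0_def)
  \<comment> \<open>eventually both times are at distance at least \<open>s0\<close> from \<open>\<tau>\<close>, so \<open>K\<close> bounds the Jacobians\<close>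
  define K where "K = 1 / s0 ^ DIM('a)"
  have K: "0 < K" using s0 by (simp add: K_def)
  have [measurable]: "g \<in> borel_measurable (borel \<Otimes>\<^sub>M borel)"
    using borel_measurable_integrable[OF g] by (simp add: borel_prod)
  obtain e' where e': "0 < e'" "ennreal (4 * e') < e"
  proof (cases e)
    case (real r)
    with \<open>0 < e\<close> have "0 < r / 8" "ennreal (4 * (r / 8)) < e" by (auto intro!: ennreal_lessI)
    then show ?thesis by (rule that)
  next
    case top
    then show ?thesis using that[of 1] by simp
  qed
  obtain \<phi> where \<phi>: "uniformly_continuous_on UNIV \<phi>" "bounded (range \<phi>)" "integrable lborel \<phi>"
      and \<phi>g: "(LINT z|lborel. \<bar>g z - \<phi> z\<bar>) < e' / K"
    using integrable_approx_uniformly_continuous[OF g] e'(1) K by (meson divide_pos_pos)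
  have [measurable]: "\<phi> \<in> borel_measurable (borel \<Otimes>\<^sub>M borel)"
    using borel_measurable_integrable[OF \<phi>(3)] by (simp add: borel_prod)
  let ?y = "\<lambda>n v. x n - (t n - \<tau>) *\<^sub>R v" and ?y' = "\<lambda>n v. x' n - (t' n - \<tau>) *\<^sub>R v"
  let ?\<Delta> = "\<lambda>n v u. ennreal (\<bar>\<phi> (?y' n v, u) - \<phi> (?y n v, u)\<bar> * (P v * R u))"
  have far: "\<forall>\<^sub>F n in sequentially. s0 \<le> \<bar>s n - \<tau>\<bar>" if "s \<longlonglongrightarrow> t0" for s
  proof -
    have "(\<lambda>n. \<bar>s n - \<tau>\<bar>) \<longlonglongrightarrow> \<bar>t0 - \<tau>\<bar>" using that by (intro tendsto_intros)
    then have "\<forall>\<^sub>F n in sequentially. s0 < \<bar>s n - \<tau>\<bar>"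
      using \<tau> by (intro order_tendstoD) (auto simp: s0_def)
    then show ?thesis by eventually_elim simp
  qed
  have err: "(\<integral>\<^sup>+v. (\<integral>\<^sup>+u. ennreal (\<bar>g (a - s *\<^sub>R v, u) - \<phi> (a - s *\<^sub>R v, u)\<bar>) \<partial>lborel) \<partial>lborel) \<le> ennreal e'"
    if s: "s0 \<le> \<bar>s\<bar>" for s :: real and a
  proof -
    let ?I = "\<integral>\<^sup>+v. (\<integral>\<^sup>+u. ennreal (\<bar>g (a - s *\<^sub>R v, u) - \<phi> (a - s *\<^sub>R v, u)\<bar>) \<partial>lborel) \<partial>lborel"
    have "ennreal (s0 ^ DIM('a)) * ?I \<le> ennreal (\<bar>s\<bar> ^ DIM('a)) * ?I"
      using s s0 by (intro mult_right_mono ennreal_leI power_mono) auto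
    also have "\<dots> = (\<integral>\<^sup>+z. ennreal (\<bar>g z - \<phi> z\<bar>) \<partial>lborel)"
      using s s0 by (intro nn_integral_characteristic[where G="\<lambda>z. ennreal \<bar>g z - \<phi> z\<bar>"]) auto
    also have "\<dots> = ennreal (LINT z|lborel. \<bar>g z - \<phi> z\<bar>)"
      using g \<phi>(3) by (intro nn_integral_eq_integral) auto
    also have "\<dots> \<le> ennreal (e' / K)" using \<phi>g by (intro ennreal_leI) simp
    finally have "ennreal K * (ennreal (s0 ^ DIM('a)) * ?I) \<le> ennreal K * ennreal (e' / K)" by (rule mult_left_mono) simp
    moreover have "ennreal K * (ennreal (s0 ^ DIM('a)) * ?I) = ?I"
      using s0 K by (simp add: mult.assoc[symmetric] ennreal_mult[symmetric] K_def)
    moreover have "ennreal K * ennreal (e' / K) = ennreal e'"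
      using K e' by (simp add: ennreal_mult[symmetric])
    ultimately show ?thesis by simp
  qed
  obtain C where C: "\<And>z. \<bar>\<phi> z\<bar> \<le> C" using \<phi>(2) by (auto simp: bounded_iff)
  have C0: "0 \<le> C" using C[of undefined] by linarith
  have mid: "(\<lambda>n. \<integral>\<^sup>+v. (\<integral>\<^sup>+u. ?\<Delta> n v u \<partial>lborel) \<partial>lborel)
     \<longlonglongrightarrow> (\<integral>\<^sup>+v. 0 \<partial>(lborel :: 'a measure))"
  proof (rule nn_integral_dominated_convergence)
    let ?R = "\<integral>\<^sup>+u. R u \<partial>lborel"
    have b: "(\<integral>\<^sup>+u. ?\<Delta> n v u \<partial>lborel) \<le> ennreal (2 * C) * ?R * P v" for n v
    proof -
      have "(\<integral>\<^sup>+u. ?\<Delta> n v u \<partial>lborel)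
         \<le> (\<integral>\<^sup>+u. ennreal (2 * C * P v) * ennreal (R u) \<partial>lborel)"
      proof (rule nn_integral_mono)
        fix u :: 'b
        have "\<bar>\<phi> (?y' n v, u) - \<phi> (?y n v, u)\<bar> \<le> 2 * C"
          using C[of "(?y' n v, u)"] C[of "(?y n v, u)"] by linarith
        then have "\<bar>\<phi> (?y' n v, u) - \<phi> (?y n v, u)\<bar> * (P v * R u) \<le> 2 * C * (P v * R u)"
          using P01 R01 by (intro mult_right_mono) auto
        then show "?\<Delta> n v u \<le> ennreal (2 * C * P v) * ennreal (R u)"
          using P01 R01 C0 by (subst ennreal_mult[symmetric]) (auto intro!: ennreal_leI simp: mult.assoc)
      qed
      also have "\<dots> = ennreal (2 * C * P v) * ?R" by (rule nn_integral_cmult) measurable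
      also have "\<dots> = ennreal (2 * C) * ?R * P v" using P01 C0 by (subst ennreal_mult) (auto simp: mult_ac)
      finally show ?thesis .
    qed
    show "AE v in lborel. (\<integral>\<^sup>+u. ?\<Delta> n v u \<partial>lborel) \<le> ennreal (2 * C) * ?R * P v" for n
      using b by auto
    show "(\<integral>\<^sup>+v. ennreal (2 * C) * ?R * P v \<partial>lborel) < \<infinity>"
      using Pfin Rfin by (subst nn_integral_cmult) (auto simp: ennreal_mult_less_top)
    show "AE v in lborel. (\<lambda>n. \<integral>\<^sup>+u. ?\<Delta> n v u \<partial>lborel) \<longlonglongrightarrow> 0"
    proof (rule AE_I2)
      fix v
      have "(\<lambda>n. \<integral>\<^sup>+u. ?\<Delta> n v u \<partial>lborel) \<longlonglongrightarrow> (\<integral>\<^sup>+u. 0 \<partial>(lborel :: 'b measure))"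
      proof (rule nn_integral_dominated_convergence)
        show "AE u in lborel. ?\<Delta> n v u \<le> ennreal (2 * C) * R u" for n
        proof (rule AE_I2)
          fix u :: 'b
          have "\<bar>\<phi> (?y' n v, u) - \<phi> (?y n v, u)\<bar> \<le> 2 * C"
            using C[of "(?y' n v, u)"] C[of "(?y n v, u)"] by linarith
          then have "\<bar>\<phi> (?y' n v, u) - \<phi> (?y n v, u)\<bar> * (P v * R u) \<le> 2 * C * (1 * R u)"
            using P01 R01 C0 by (intro mult_mono) auto
          then show "?\<Delta> n v u \<le> ennreal (2 * C) * R u"
            using R01 C0 by (subst ennreal_mult[symmetric]) (auto intro!: ennreal_leI)
        qed
        show "(\<integral>\<^sup>+u. ennreal (2 * C) * R u \<partial>lborel) < \<infinity>"
          using Rfin by (subst nn_integral_cmult) (auto simp: ennreal_mult_less_top)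
        show "AE u in lborel. (\<lambda>n. ?\<Delta> n v u) \<longlonglongrightarrow> 0"
        proof (rule AE_I2)
          fix u :: 'b
          have "(\<lambda>n. (x' n - x n) - ((t' n - \<tau>) - (t n - \<tau>)) *\<^sub>R v) \<longlonglongrightarrow> 0 - ((t0 - \<tau>) - (t0 - \<tau>)) *\<^sub>R v"
            by (intro tendsto_intros x t t')
          then have "(\<lambda>n. norm (?y' n v - ?y n v)) \<longlonglongrightarrow> 0"
            by (intro tendsto_norm_zero) (simp add: algebra_simps)
          then have "(\<lambda>n. dist (?y' n v, u) (?y n v, u)) \<longlonglongrightarrow> 0"
            by (simp add: dist_Pair_Pair dist_norm)
          then have "(\<lambda>n. dist (\<phi> (?y' n v, u)) (\<phi> (?y n v, u))) \<longlonglongrightarrow> 0"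
            using \<phi>(1) unfolding uniformly_continuous_on_sequentially by simp
          then have "(\<lambda>n. \<bar>\<phi> (?y' n v, u) - \<phi> (?y n v, u)\<bar> * (P v * R u)) \<longlonglongrightarrow> 0 * (P v * R u)"
            unfolding dist_real_def by (intro tendsto_intros)
          then show "(\<lambda>n. ?\<Delta> n v u) \<longlonglongrightarrow> 0"
            using tendsto_ennrealI by fastforce
        qed
      qed measurable
      then show "(\<lambda>n. \<integral>\<^sup>+u. ?\<Delta> n v u \<partial>lborel) \<longlonglongrightarrow> 0" by simp
    qed
  qed measurable
  then have "\<forall>\<^sub>F n in sequentially. (\<integral>\<^sup>+v. (\<integral>\<^sup>+u. ?\<Delta> n v u \<partial>lborel) \<partial>lborel) < ennreal e'"
    using e'(1) by (intro order_tendstoD(2)[where y=0]) auto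
  with far[OF t] far[OF t'] show "\<forall>\<^sub>F n in sequentially. ?E n < e"
  proof eventually_elim
    case (elim n)
    have "?E n \<le> (\<integral>\<^sup>+v. (\<integral>\<^sup>+u. ennreal \<bar>g (?y' n v, u) - \<phi> (?y' n v, u)\<bar> + (?\<Delta> n v u + ennreal \<bar>g (?y n v, u) - \<phi> (?y n v, u)\<bar>) \<partial>lborel) \<partial>lborel)"
    proof (intro nn_integral_mono)
      fix v :: 'a and u :: 'b
      define A B D where "A = g (?y' n v, u) - \<phi> (?y' n v, u)" and "B = \<phi> (?y' n v, u) - \<phi> (?y n v, u)" and "D = g (?y n v, u) - \<phi> (?y n v, u)"
      have w: "0 \<le> P v * R u" "P v * R u \<le> 1" using P01 R01 by (auto intro: mult_le_one)
      have "\<bar>g (?y' n v, u) - g (?y n v, u)\<bar> * (P v * R u) \<le> (\<bar>A\<bar> + \<bar>B\<bar> + \<bar>D\<bar>) * (P v * R u)"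
        using w by (intro mult_right_mono) (auto simp: A_def B_def D_def)
      also have "\<dots> = \<bar>A\<bar> * (P v * R u) + \<bar>B\<bar> * (P v * R u) + \<bar>D\<bar> * (P v * R u)" by (simp add: algebra_simps)
      also have "\<dots> \<le> \<bar>A\<bar> + (\<bar>B\<bar> * (P v * R u) + \<bar>D\<bar>)"
        using w mult_left_le[of "P v * R u" "\<bar>A\<bar>"] mult_left_le[of "P v * R u" "\<bar>D\<bar>"] by simp
      finally have "ennreal (\<bar>g (?y' n v, u) - g (?y n v, u)\<bar> * (P v * R u)) \<le> ennreal (\<bar>A\<bar> + (\<bar>B\<bar> * (P v * R u) + \<bar>D\<bar>))"
        by (rule ennreal_leI)
      also have "\<dots> = ennreal \<bar>A\<bar> + (ennreal (\<bar>B\<bar> * (P v * R u)) + ennreal \<bar>D\<bar>)"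
        using w by simp
      finally show "ennreal (\<bar>g (?y' n v, u) - g (?y n v, u)\<bar> * (P v * R u)) \<le>
         ennreal \<bar>g (?y' n v, u) - \<phi> (?y' n v, u)\<bar> + (?\<Delta> n v u + ennreal \<bar>g (?y n v, u) - \<phi> (?y n v, u)\<bar>)"
        by (simp add: A_def B_def D_def)
    qed
    also have "\<dots> = (\<integral>\<^sup>+v. (\<integral>\<^sup>+u. ennreal \<bar>g (?y' n v, u) - \<phi> (?y' n v, u)\<bar> \<partial>lborel) \<partial>lborel)
        + ((\<integral>\<^sup>+v. (\<integral>\<^sup>+u. ?\<Delta> n v u \<partial>lborel) \<partial>lborel)
        + (\<integral>\<^sup>+v. (\<integral>\<^sup>+u. ennreal \<bar>g (?y n v, u) - \<phi> (?y n v, u)\<bar> \<partial>lborel) \<partial>lborel))"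
      by (simp add: nn_integral_add)
    also have "\<dots> \<le> ennreal e' + (ennreal e' + ennreal e')"
      using elim by (intro add_mono err) auto
    also have "\<dots> \<le> ennreal (4 * e')"
      using e'(1) by (simp add: ennreal_plus[symmetric] ennreal_leI del: ennreal_plus)
    also have "\<dots> < e" by (rule e')
    finally show ?case .
  qed
qed simp

section \<open>Collision integrals of functions below a multiple of the weight\<close>

interpretation phase: pair_sigma_finite "lborel :: (real^3) measure" sphere_measure
  by (intro pair_sigma_finite.intro sphere.sigma_finite_measure_axioms lborel.sigma_finite_measure_axioms)

lemma sigma_finite_phase: "sigma_finite_measure phase_measure"
  by (rule sigma_finite_pair_measure) (intro sphere.sigma_finite_measure_axioms lborel.sigma_finite_measure_axioms)+

lemma borel_measurable_lborel_sphere: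
  assumes "f \<in> borel_measurable (A \<Otimes>\<^sub>M (borel \<Otimes>\<^sub>M borel))"
  shows "f \<in> borel_measurable (A \<Otimes>\<^sub>M phase_measure)"
proof -
  have s: "(\<lambda>z. snd (snd z)) \<in> borel_measurable (A \<Otimes>\<^sub>M phase_measure)"
    by (rule measurable_compose[OF _ measurable_sphere_measure_ident, of "\<lambda>z. snd (snd z)"]) measurable
  have "(\<lambda>z. (fst z, fst (snd z), snd (snd z))) \<in> A \<Otimes>\<^sub>M phase_measure \<rightarrow>\<^sub>M A \<Otimes>\<^sub>M (borel \<Otimes>\<^sub>M borel)"
    using s by measurable
  from measurable_compose[OF this assms] show ?thesis by simp
qed

lemma borel_measurable_lborel_sphere2:
  assumes "f \<in> borel_measurable (borel \<Otimes>\<^sub>M borel)"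
  shows "f \<in> borel_measurable phase_measure"
proof -
  have s: "(\<lambda>z. snd z) \<in> borel_measurable phase_measure"
    by (rule measurable_compose[OF _ measurable_sphere_measure_ident, of "\<lambda>z. snd z"]) measurable
  have "(\<lambda>z. (fst z, snd z)) \<in> phase_measure \<rightarrow>\<^sub>M borel \<Otimes>\<^sub>M borel"
    using s by measurable
  from measurable_compose[OF this assms] show ?thesis by simp
qed

lemma norm_post_square:
  assumes "norm \<omega> = 1"
  shows "(norm (post_u u v \<omega>))\<^sup>2 + (norm (post_v u v \<omega>))\<^sup>2 = (norm u)\<^sup>2 + (norm v)\<^sup>2"
proof -
  have "\<omega> \<bullet> \<omega> = 1" using assms by (simp add: dot_square_norm)
  then show ?thesis
    unfolding power2_norm_eq_inner post_u_def post_v_def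
    by (simp add: inner_add_left inner_add_right inner_diff_left inner_diff_right inner_commute algebra_simps)
qed

locale cutoff_kernel =
  fixes \<gamma> \<beta> :: real and h :: "real \<Rightarrow> real"
  assumes gamma: "-3 < \<gamma>" "\<gamma> \<le> 1"
    and beta: "8 + 2 * max 0 \<gamma> < \<beta>"
    and h_measurable [measurable]: "h \<in> borel_measurable borel"
    and h_nonneg: "\<And>\<theta>. 0 \<le> h \<theta>"
    and h_finite: "(\<integral>\<^sup>+\<theta>. ennreal (h \<theta>) * indicator {0..pi/2} \<theta> \<partial>lborel) < \<infinity>"
begin

definition q :: "real \<Rightarrow> real^3 \<Rightarrow> real" where "q \<theta> z = norm z powr \<gamma> * h \<theta>"

definition p :: "real^3 \<Rightarrow> real" where "p u = (1 + (norm u)\<^sup>2) powr (-\<beta>/2)"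

definition weighted_kernel :: "real^3 \<Rightarrow> (real^3) \<times> (real^3) \<Rightarrow> real" where
  "weighted_kernel v z = q (coll_angle (fst z) v (snd z)) (v - fst z) *
     (1 + (norm (fst z))\<^sup>2 + (norm v)\<^sup>2) powr (-\<beta>/2)"

text \<open>
  \<open>\<Gamma>\<close> dominates both collision integrals of functions below \<open>p = 1 / w\<close>: the gain term because
  energy conservation bounds \<open>p u' p v'\<close> by a power of \<open>1 + |u|\<^sup>2 + |v|\<^sup>2\<close>, the loss term up to a
  factor that depends on \<open>v\<close> only. Velocities with \<open>\<Gamma> v < \<infinity>\<close> are those at which the
  dominated convergence arguments below apply.
\<close>

definition \<Gamma> :: "real^3 \<Rightarrow> ennreal" where
  "\<Gamma> v = (\<integral>\<^sup>+z. weighted_kernel v z \<partial>phase_measure)"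

lemma q_nonneg: "0 \<le> q \<theta> z" by (simp add: q_def h_nonneg)

lemma borel_measurable_kernel [measurable]:
  "(\<lambda>z. q (coll_angle (fst (snd z)) (fst z) (snd (snd z))) (fst z - fst (snd z)))
     \<in> borel_measurable (borel \<Otimes>\<^sub>M (borel \<Otimes>\<^sub>M borel))"
  unfolding q_def coll_angle_def by measurable

lemma p_pos: "0 < p u" unfolding p_def by (simp add: add_pos_nonneg less_imp_neq[symmetric])

lemma p_le_1: "p u \<le> 1"
proof -
  have "p u \<le> 1 powr (-\<beta>/2)" unfolding p_def using beta by (intro powr_mono2') auto
  then show ?thesis by simp
qed

lemma borel_measurable_p [measurable]: "p \<in> borel_measurable borel"
  unfolding p_def by measurable

lemma p_weight: "p u * weight \<beta> u = 1"
  unfolding p_def weight_def by (simp add: powr_add[symmetric] add_pos_nonneg less_imp_neq[symmetric])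

lemma nn_integral_p_moment: "(\<integral>\<^sup>+u. ennreal (p u * (1 + (norm u)\<^sup>2)) \<partial>lborel) < \<infinity>"
proof -
  have "p u * (1 + (norm u)\<^sup>2) = (1 + (norm u)\<^sup>2) powr (-(\<beta> - 2)/2)" for u
  proof -
    have "p u * (1 + (norm u)\<^sup>2) powr 1 = (1 + (norm u)\<^sup>2) powr (-(\<beta> - 2)/2)"
      unfolding p_def by (subst powr_add[symmetric]) (simp add: field_simps)
    then show ?thesis by (simp add: add_pos_nonneg less_imp_le)
  qed
  then show ?thesis using nn_integral_japanese_bracket_finite[of "\<beta> - 2"] beta by simp
qed

lemma nn_integral_p_finite: "(\<integral>\<^sup>+u. ennreal (p u) \<partial>lborel) < \<infinity>"
proof (rule le_less_trans[OF _ nn_integral_p_moment])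
  show "(\<integral>\<^sup>+u. ennreal (p u) \<partial>lborel) \<le> (\<integral>\<^sup>+u. ennreal (p u * (1 + (norm u)\<^sup>2)) \<partial>lborel)"
    using p_pos by (intro nn_integral_mono ennreal_leI) (simp add: less_imp_le)
qed

lemma weighted_kernel_nonneg: "0 \<le> weighted_kernel v z"
  by (simp add: weighted_kernel_def q_nonneg)

lemma borel_measurable_weighted_kernel [measurable]:
  "(\<lambda>z. weighted_kernel (fst z) (snd z)) \<in> borel_measurable (borel \<Otimes>\<^sub>M (borel \<Otimes>\<^sub>M borel))"
  unfolding weighted_kernel_def by measurable

lemma borel_measurable_weighted_kernel_phase:
  "weighted_kernel v \<in> borel_measurable phase_measure"
proof (rule borel_measurable_lborel_sphere2)
  have "(\<lambda>z. weighted_kernel (fst (v, z)) (snd (v, z))) \<in> borel_measurable (borel \<Otimes>\<^sub>M borel)"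
    by measurable
  then show "weighted_kernel v \<in> borel_measurable (borel \<Otimes>\<^sub>M borel)" by simp
qed

lemma borel_measurable_\<Gamma> [measurable]: "\<Gamma> \<in> borel_measurable borel"
proof -
  have "(\<lambda>z. ennreal (weighted_kernel (fst z) (snd z))) \<in> borel_measurable (borel \<Otimes>\<^sub>M phase_measure)"
    by (rule borel_measurable_lborel_sphere) measurable
  from sigma_finite_measure.borel_measurable_nn_integral_fst[OF sigma_finite_phase this] show ?thesis
    by (simp add: \<Gamma>_def[abs_def])
qed

text \<open>
  The second moment enters because the energy is the highest moment to be controlled.
\<close>

lemma nn_integral_\<Gamma>_moment: "(\<integral>\<^sup>+v. \<Gamma> v * ennreal (1 + (norm v)\<^sup>2) \<partial>lborel) < \<infinity>"
proof -
  obtain C where C: "0 \<le> C"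
    "\<And>z. z \<noteq> 0 \<Longrightarrow> (\<integral>\<^sup>+\<omega>. ennreal (h (arccos (\<bar>z \<bullet> \<omega>\<bar> / norm z))) \<partial>sphere_measure) \<le> ennreal C"
    using nn_integral_sphere_angle_bound[OF h_measurable h_nonneg h_finite] by blast
  let ?N = "\<lambda>u v::real^3. (1 + (norm u)\<^sup>2 + (norm v)\<^sup>2) powr (-\<beta>/2)"
  have "\<Gamma> v * ennreal (1 + (norm v)\<^sup>2)
      \<le> ennreal C * (\<integral>\<^sup>+u. ennreal (norm (v - u) powr \<gamma> * ?N u v * (1 + (norm v)\<^sup>2)) \<partial>lborel)" for v
  proof -
    have "\<Gamma> v = (\<integral>\<^sup>+u. (\<integral>\<^sup>+\<omega>. weighted_kernel v (u, \<omega>) \<partial>sphere_measure) \<partial>lborel)"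
      unfolding \<Gamma>_def
      using sphere.nn_integral_fst[OF measurable_compose[OF borel_measurable_weighted_kernel_phase measurable_ennreal], symmetric]
      by simp
    also have "\<dots> \<le> (\<integral>\<^sup>+u. ennreal C * ennreal (norm (v - u) powr \<gamma> * ?N u v) \<partial>lborel)"
    proof (rule nn_integral_mono)
      fix u
      have "(\<integral>\<^sup>+\<omega>. weighted_kernel v (u, \<omega>) \<partial>sphere_measure)
          = (\<integral>\<^sup>+\<omega>. ennreal (norm (v - u) powr \<gamma> * ?N u v) * ennreal (h (arccos (\<bar>(v - u) \<bullet> \<omega>\<bar> / norm (v - u)))) \<partial>sphere_measure)"
        by (intro nn_integral_cong) (simp add: weighted_kernel_def q_def coll_angle_def ennreal_mult[symmetric] h_nonneg mult_ac)
      also have "\<dots> = ennreal (norm (v - u) powr \<gamma> * ?N u v) * (\<integral>\<^sup>+\<omega>. ennreal (h (arccos (\<bar>(v - u) \<bullet> \<omega>\<bar> / norm (v - u)))) \<partial>sphere_measure)"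
        by (intro nn_integral_cmult borel_measurable_sphere_measure) measurable
      also have "\<dots> \<le> ennreal (norm (v - u) powr \<gamma> * ?N u v) * ennreal C"
      proof (cases "v = u")
        case False
        then show ?thesis by (intro mult_left_mono C) auto
      qed simp
      finally show "(\<integral>\<^sup>+\<omega>. weighted_kernel v (u, \<omega>) \<partial>sphere_measure) \<le> ennreal C * ennreal (norm (v - u) powr \<gamma> * ?N u v)"
        by (simp add: mult.commute)
    qed
    finally have "\<Gamma> v * ennreal (1 + (norm v)\<^sup>2)
       \<le> (\<integral>\<^sup>+u. ennreal C * ennreal (norm (v - u) powr \<gamma> * ?N u v) \<partial>lborel) * ennreal (1 + (norm v)\<^sup>2)"
      by (rule mult_right_mono) simp
    also have "\<dots> = (\<integral>\<^sup>+u. ennreal C * ennreal (norm (v - u) powr \<gamma> * ?N u v) * ennreal (1 + (norm v)\<^sup>2) \<partial>lborel)"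
      by (rule nn_integral_multc[symmetric]) measurable
    also have "\<dots> = (\<integral>\<^sup>+u. ennreal C * ennreal (norm (v - u) powr \<gamma> * ?N u v * (1 + (norm v)\<^sup>2)) \<partial>lborel)"
      by (intro nn_integral_cong) (simp add: ennreal_mult mult.assoc)
    also have "\<dots> = ennreal C * (\<integral>\<^sup>+u. ennreal (norm (v - u) powr \<gamma> * ?N u v * (1 + (norm v)\<^sup>2)) \<partial>lborel)"
      by (rule nn_integral_cmult) measurable
    finally show ?thesis .
  qed
  then have "(\<integral>\<^sup>+v. \<Gamma> v * ennreal (1 + (norm v)\<^sup>2) \<partial>lborel)
     \<le> (\<integral>\<^sup>+v. ennreal C * (\<integral>\<^sup>+u. ennreal (norm (v - u) powr \<gamma> * ?N u v * (1 + (norm v)\<^sup>2)) \<partial>lborel) \<partial>lborel)"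
    by (intro nn_integral_mono)
  also have "\<dots> = ennreal C * (\<integral>\<^sup>+v. (\<integral>\<^sup>+u. ennreal (norm (v - u) powr \<gamma> * ?N u v * (1 + (norm v)\<^sup>2)) \<partial>lborel) \<partial>lborel)"
    by (rule nn_integral_cmult) measurable
  also have "\<dots> < \<infinity>"
    using nn_integral_weighted_kernel_finite[OF gamma beta] by (simp add: ennreal_mult_less_top)
  finally show ?thesis .
qed

lemma AE_\<Gamma>_finite: "AE v in lborel. \<Gamma> v < \<infinity>"
proof -
  have "AE v in lborel. \<Gamma> v * ennreal (1 + (norm v)\<^sup>2) \<noteq> \<infinity>"
    using nn_integral_\<Gamma>_moment by (intro nn_integral_noteq_infinite) auto
  then show ?thesis
  proof eventually_elim
    case (elim v)
    have "0 < ennreal (1 + (norm v)\<^sup>2)" by (simp add: add_pos_nonneg)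
    then show ?case using elim by (auto simp: ennreal_mult_eq_top_iff less_top)
  qed
qed

lemma integrable_weighted_kernel:
  assumes "\<Gamma> v < \<infinity>"
  shows "integrable phase_measure (weighted_kernel v)"
    "(LINT z|phase_measure. weighted_kernel v z) = enn2real (\<Gamma> v)"
proof -
  show "integrable phase_measure (weighted_kernel v)"
    using assms weighted_kernel_nonneg
    by (intro integrableI_nonneg borel_measurable_weighted_kernel_phase) (auto simp: \<Gamma>_def)
  show "(LINT z|phase_measure. weighted_kernel v z) = enn2real (\<Gamma> v)"
    unfolding \<Gamma>_def using weighted_kernel_nonneg
    by (intro integral_eq_nn_integral borel_measurable_weighted_kernel_phase) auto
qed

text \<open>
  Conservation of energy, \<open>|u'|\<^sup>2 + |v'|\<^sup>2 = |u|\<^sup>2 + |v|\<^sup>2\<close>, and \<open>1 + a + b \<le> (1 + a) (1 + b)\<close>.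
\<close>

lemma p_post_le:
  assumes "norm \<omega> = 1"
  shows "p (post_u u v \<omega>) * p (post_v u v \<omega>) \<le> (1 + (norm u)\<^sup>2 + (norm v)\<^sup>2) powr (-\<beta>/2)"
proof -
  let ?a = "(norm (post_u u v \<omega>))\<^sup>2" and ?b = "(norm (post_v u v \<omega>))\<^sup>2"
  have "1 + (norm u)\<^sup>2 + (norm v)\<^sup>2 \<le> (1 + ?a) * (1 + ?b)"
  proof -
    have "(1 + ?a) * (1 + ?b) = 1 + (?a + ?b) + ?a * ?b" by algebra
    moreover have "0 \<le> ?a * ?b" by simp
    ultimately show ?thesis using norm_post_square[OF assms, of u v] by linarith
  qed
  then have "((1 + ?a) * (1 + ?b)) powr (-\<beta>/2) \<le> (1 + (norm u)\<^sup>2 + (norm v)\<^sup>2) powr (-\<beta>/2)"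
    using beta by (intro powr_mono2') (auto simp: add_pos_nonneg)
  then show ?thesis by (simp add: p_def powr_mult)
qed

definition \<Lambda> :: "real^3 \<Rightarrow> real" where "\<Lambda> v = (1 + (norm v)\<^sup>2) powr (\<beta>/2) * enn2real (\<Gamma> v)"

lemma p_le_weighted:
  "p u \<le> (1 + (norm v)\<^sup>2) powr (\<beta>/2) * (1 + (norm u)\<^sup>2 + (norm v)\<^sup>2) powr (-\<beta>/2)"
proof -
  have "1 + (norm u)\<^sup>2 + (norm v)\<^sup>2 \<le> (1 + (norm u)\<^sup>2) * (1 + (norm v)\<^sup>2)" by (simp add: algebra_simps)
  then have "((1 + (norm u)\<^sup>2) * (1 + (norm v)\<^sup>2)) powr (-\<beta>/2) \<le> (1 + (norm u)\<^sup>2 + (norm v)\<^sup>2) powr (-\<beta>/2)"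
    using beta by (intro powr_mono2') (auto simp: add_pos_nonneg)
  then have "(1 + (norm v)\<^sup>2) powr (\<beta>/2) * (p u * (1 + (norm v)\<^sup>2) powr (-\<beta>/2)) \<le> (1 + (norm v)\<^sup>2) powr (\<beta>/2) * (1 + (norm u)\<^sup>2 + (norm v)\<^sup>2) powr (-\<beta>/2)"
    by (intro mult_left_mono) (simp_all add: p_def powr_mult)
  moreover have "(1 + (norm v)\<^sup>2) powr (\<beta>/2) * (p u * (1 + (norm v)\<^sup>2) powr (-\<beta>/2)) = p u"
    by (simp add: powr_add[symmetric] add_pos_nonneg less_imp_neq[symmetric])
  ultimately show ?thesis by linarith
qed

definition loss_integrand :: "(real^3 \<Rightarrow> real) \<Rightarrow> real^3 \<Rightarrow> (real^3) \<times> (real^3) \<Rightarrow> real" where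
  "loss_integrand \<phi> v z = q (coll_angle (fst z) v (snd z)) (v - fst z) * \<phi> (fst z)"

definition gain_integrand :: "(real^3 \<Rightarrow> real) \<Rightarrow> real^3 \<Rightarrow> (real^3) \<times> (real^3) \<Rightarrow> real" where
  "gain_integrand \<phi> v z = q (coll_angle (fst z) v (snd z)) (v - fst z) *
     \<phi> (post_u (fst z) v (snd z)) * \<phi> (post_v (fst z) v (snd z))"

lemma loss_freq_eq: "loss_freq q \<phi> v = (LINT z|phase_measure. loss_integrand \<phi> v z)"
  unfolding loss_freq_def loss_integrand_def by (simp add: case_prod_beta')

lemma Q_gain_eq: "Q_gain q \<phi> \<phi> v = (LINT z|phase_measure. gain_integrand \<phi> v z)"
  unfolding Q_gain_def gain_integrand_def by (simp add: case_prod_beta')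

lemma borel_measurable_kernel_fixed:
  "(\<lambda>z. q (coll_angle (fst z) v (snd z)) (v - fst z)) \<in> borel_measurable (borel \<Otimes>\<^sub>M borel)"
  unfolding q_def coll_angle_def by measurable

lemma borel_measurable_loss_integrand:
  assumes [measurable]: "\<phi> \<in> borel_measurable borel"
  shows "loss_integrand \<phi> v \<in> borel_measurable phase_measure"
proof (rule borel_measurable_lborel_sphere2)
  note [measurable] = borel_measurable_kernel_fixed
  show "loss_integrand \<phi> v \<in> borel_measurable (borel \<Otimes>\<^sub>M borel)" unfolding loss_integrand_def by measurable
qed

lemma borel_measurable_gain_integrand:
  assumes [measurable]: "\<phi> \<in> borel_measurable borel"
  shows "gain_integrand \<phi> v \<in> borel_measurable phase_measure"
proof (rule borel_measurable_lborel_sphere2)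
  note [measurable] = borel_measurable_kernel_fixed
  show "gain_integrand \<phi> v \<in> borel_measurable (borel \<Otimes>\<^sub>M borel)"
    unfolding gain_integrand_def post_u_def post_v_def by measurable
qed

lemma loss_integrand_bound:
  assumes "0 \<le> A" "\<And>u. 0 \<le> \<phi> u" "\<And>u. \<phi> u \<le> A * p u"
  shows "0 \<le> loss_integrand \<phi> v z" "loss_integrand \<phi> v z \<le> A * (1 + (norm v)\<^sup>2) powr (\<beta>/2) * weighted_kernel v z"
proof -
  show "0 \<le> loss_integrand \<phi> v z" by (simp add: loss_integrand_def q_nonneg assms)
  have "\<phi> (fst z) \<le> A * ((1 + (norm v)\<^sup>2) powr (\<beta>/2) * (1 + (norm (fst z))\<^sup>2 + (norm v)\<^sup>2) powr (-\<beta>/2))"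
    using assms(3)[of "fst z"] mult_left_mono[OF p_le_weighted[of "fst z" v] assms(1)] by linarith
  from mult_left_mono[OF this q_nonneg[of "coll_angle (fst z) v (snd z)" "v - fst z"]]
  show "loss_integrand \<phi> v z \<le> A * (1 + (norm v)\<^sup>2) powr (\<beta>/2) * weighted_kernel v z"
    by (simp add: loss_integrand_def weighted_kernel_def mult_ac)
qed

lemma gain_integrand_bound:
  assumes "0 \<le> A" "\<And>u. 0 \<le> \<phi> u" "\<And>u. \<phi> u \<le> A * p u" and z: "z \<in> space phase_measure"
  shows "0 \<le> gain_integrand \<phi> v z" "gain_integrand \<phi> v z \<le> A\<^sup>2 * weighted_kernel v z"
proof -
  have n: "norm (snd z) = 1" using z by (auto simp: space_pair_measure space_sphere_measure)
  show "0 \<le> gain_integrand \<phi> v z" by (simp add: gain_integrand_def q_nonneg assms)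
  let ?u = "post_u (fst z) v (snd z)" and ?v = "post_v (fst z) v (snd z)"
  have "\<phi> ?u * \<phi> ?v \<le> (A * p ?u) * (A * p ?v)"
    using assms p_pos by (intro mult_mono) (auto simp: less_imp_le)
  also have "\<dots> = A\<^sup>2 * (p ?u * p ?v)" by (simp add: power2_eq_square mult_ac)
  also have "\<dots> \<le> A\<^sup>2 * ((1 + (norm (fst z))\<^sup>2 + (norm v)\<^sup>2) powr (-\<beta>/2))"
    by (intro mult_left_mono p_post_le n) auto
  finally have "\<phi> ?u * \<phi> ?v \<le> A\<^sup>2 * ((1 + (norm (fst z))\<^sup>2 + (norm v)\<^sup>2) powr (-\<beta>/2))" .
  from mult_left_mono[OF this q_nonneg[of "coll_angle (fst z) v (snd z)" "v - fst z"]]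
  show "gain_integrand \<phi> v z \<le> A\<^sup>2 * weighted_kernel v z"
    by (simp add: gain_integrand_def weighted_kernel_def mult_ac)
qed

lemma loss_freq_bound:
  assumes v: "\<Gamma> v < \<infinity>" and A: "0 \<le> A" "\<And>u. 0 \<le> \<phi> u" "\<And>u. \<phi> u \<le> A * p u"
    and m: "\<phi> \<in> borel_measurable borel"
  shows "integrable phase_measure (loss_integrand \<phi> v)"
    "0 \<le> loss_freq q \<phi> v" "loss_freq q \<phi> v \<le> A * \<Lambda> v"
proof -
  note bd = loss_integrand_bound[OF A, of v]
  have iw: "integrable phase_measure (\<lambda>z. A * (1 + (norm v)\<^sup>2) powr (\<beta>/2) * weighted_kernel v z)"
    using integrable_weighted_kernel(1)[OF v] by simp
  show i: "integrable phase_measure (loss_integrand \<phi> v)"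
    using bd by (intro Bochner_Integration.integrable_bound[OF iw] borel_measurable_loss_integrand m)
      (auto intro!: AE_I2 order_trans[OF _ abs_ge_self])
  show "0 \<le> loss_freq q \<phi> v" unfolding loss_freq_eq using bd by (intro Bochner_Integration.integral_nonneg) auto
  have "loss_freq q \<phi> v \<le> (LINT z|phase_measure. A * (1 + (norm v)\<^sup>2) powr (\<beta>/2) * weighted_kernel v z)"
    unfolding loss_freq_eq using bd by (intro integral_mono i iw) auto
  also have "\<dots> = A * \<Lambda> v" by (simp add: integrable_weighted_kernel(2)[OF v] \<Lambda>_def)
  finally show "loss_freq q \<phi> v \<le> A * \<Lambda> v" .
qed

lemma Q_gain_bound:
  assumes v: "\<Gamma> v < \<infinity>" and A: "0 \<le> A" "\<And>u. 0 \<le> \<phi> u" "\<And>u. \<phi> u \<le> A * p u"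
    and m: "\<phi> \<in> borel_measurable borel"
  shows "integrable phase_measure (gain_integrand \<phi> v)"
    "0 \<le> Q_gain q \<phi> \<phi> v" "Q_gain q \<phi> \<phi> v \<le> A\<^sup>2 * enn2real (\<Gamma> v)"
proof -
  note bd = gain_integrand_bound[OF A, of _ v]
  have iw: "integrable phase_measure (\<lambda>z. A\<^sup>2 * weighted_kernel v z)"
    using integrable_weighted_kernel(1)[OF v] by simp
  show i: "integrable phase_measure (gain_integrand \<phi> v)"
    using bd by (intro Bochner_Integration.integrable_bound[OF iw] borel_measurable_gain_integrand m)
      (auto intro!: AE_I2 order_trans[OF _ abs_ge_self])
  show "0 \<le> Q_gain q \<phi> \<phi> v" unfolding Q_gain_eq using bd by (intro Bochner_Integration.integral_nonneg) auto
  have "Q_gain q \<phi> \<phi> v \<le> (LINT z|phase_measure. A\<^sup>2 * weighted_kernel v z)"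
    unfolding Q_gain_eq using bd by (intro integral_mono i iw) auto
  also have "\<dots> = A\<^sup>2 * enn2real (\<Gamma> v)" by (simp add: integrable_weighted_kernel(2)[OF v])
  finally show "Q_gain q \<phi> \<phi> v \<le> A\<^sup>2 * enn2real (\<Gamma> v)" .
qed

lemma AE_phase_fst:
  fixes P :: "real^3 \<Rightarrow> bool"
  assumes "AE u in lborel. P u"
  shows "AE z in phase_measure. P (fst z)"
proof -
  obtain N where N: "N \<in> null_sets lborel" "\<And>u. u \<notin> N \<Longrightarrow> P u"
    using assms by (auto elim!: AE_E3)
  have "AE z in phase_measure. fst z \<notin> N"
  proof -
    have [measurable]: "N \<in> sets borel" using N by auto
    have "Measurable.pred phase_measure (\<lambda>z. fst z \<notin> N)" by measurable
    moreover have "AE u in lborel. AE \<omega> in sphere_measure. u \<notin> N"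
      using AE_not_in[OF N(1)] by eventually_elim simp
    ultimately show ?thesis
      using phase.AE_pair_iff[where P="\<lambda>u \<omega>. u \<notin> N"] by (simp add: pred_def case_prod_beta')
  qed
  then show ?thesis by eventually_elim (rule N(2))
qed

lemma AE_phase_post:
  fixes P :: "real^3 \<Rightarrow> bool"
  assumes "AE u in lborel. P u"
  shows "AE z in phase_measure. P (post_u (fst z) v (snd z)) \<and> P (post_v (fst z) v (snd z))"
proof -
  obtain N where N: "N \<in> null_sets lborel" "\<And>u. u \<notin> N \<Longrightarrow> P u"
    using assms by (auto elim!: AE_E3)
  show ?thesis using AE_post_velocities_avoid_null[OF N(1), of v]
    by eventually_elim (use N(2) in auto)
qed

lemma loss_freq_cong_AE:
  assumes "\<phi> \<in> borel_measurable borel" "\<psi> \<in> borel_measurable borel" "AE u in lborel. \<phi> u = \<psi> u"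
  shows "loss_freq q \<phi> v = loss_freq q \<psi> v"
  unfolding loss_freq_eq
proof (rule integral_cong_AE)
  show "AE z in phase_measure. loss_integrand \<phi> v z = loss_integrand \<psi> v z"
    using AE_phase_fst[OF assms(3)] by eventually_elim (simp add: loss_integrand_def)
qed (intro borel_measurable_loss_integrand assms)+

lemma Q_gain_cong_AE:
  assumes "\<phi> \<in> borel_measurable borel" "\<psi> \<in> borel_measurable borel" "AE u in lborel. \<phi> u = \<psi> u"
  shows "Q_gain q \<phi> \<phi> v = Q_gain q \<psi> \<psi> v"
  unfolding Q_gain_eq
proof (rule integral_cong_AE)
  show "AE z in phase_measure. gain_integrand \<phi> v z = gain_integrand \<psi> v z"
    using AE_phase_post[OF assms(3), of v] by eventually_elim (simp add: gain_integrand_def)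
qed (intro borel_measurable_gain_integrand assms)+

lemma loss_freq_diff_tendsto:
  fixes \<phi> \<psi> :: "nat \<Rightarrow> real^3 \<Rightarrow> real"
  assumes v: "\<Gamma> v < \<infinity>" and A: "0 \<le> A"
    and \<phi>: "\<And>n. \<phi> n \<in> borel_measurable borel" "\<And>n u. 0 \<le> \<phi> n u" "\<And>n u. \<phi> n u \<le> A * p u"
    and \<psi>: "\<And>n. \<psi> n \<in> borel_measurable borel" "\<And>n u. 0 \<le> \<psi> n u" "\<And>n u. \<psi> n u \<le> A * p u"
    and lim: "AE u in lborel. (\<lambda>n. \<phi> n u - \<psi> n u) \<longlonglongrightarrow> 0"
  shows "(\<lambda>n. loss_freq q (\<phi> n) v - loss_freq q (\<psi> n) v) \<longlonglongrightarrow> 0"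
proof -
  let ?M = phase_measure and ?c = "A * (1 + (norm v)\<^sup>2) powr (\<beta>/2)"
  have eq: "loss_freq q (\<phi> n) v - loss_freq q (\<psi> n) v = (LINT z|?M. loss_integrand (\<phi> n) v z - loss_integrand (\<psi> n) v z)" for n
    unfolding loss_freq_eq
    by (rule Bochner_Integration.integral_diff[symmetric])
       (rule loss_freq_bound[OF v A \<phi>(2,3,1)] loss_freq_bound[OF v A \<psi>(2,3,1)])+
  have "(\<lambda>n. LINT z|?M. loss_integrand (\<phi> n) v z - loss_integrand (\<psi> n) v z) \<longlonglongrightarrow> (LINT z|?M. 0)"
  proof (rule integral_dominated_convergence[where w="\<lambda>z. ?c * weighted_kernel v z"])
    show "integrable ?M (\<lambda>z. ?c * weighted_kernel v z)" using integrable_weighted_kernel(1)[OF v] by simp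
    show "AE z in ?M. norm (loss_integrand (\<phi> n) v z - loss_integrand (\<psi> n) v z) \<le> ?c * weighted_kernel v z" for n
    proof (rule AE_I2)
      fix z
      show "norm (loss_integrand (\<phi> n) v z - loss_integrand (\<psi> n) v z) \<le> ?c * weighted_kernel v z"
        using loss_integrand_bound[OF A \<phi>(2)[of n] \<phi>(3)[of n], of v z] loss_integrand_bound[OF A \<psi>(2)[of n] \<psi>(3)[of n], of v z] by simp
    qed
    show "AE z in ?M. (\<lambda>n. loss_integrand (\<phi> n) v z - loss_integrand (\<psi> n) v z) \<longlonglongrightarrow> 0"
      using AE_phase_fst[OF lim]
    proof eventually_elim
      case (elim z)
      from tendsto_mult_right_zero[OF elim, of "q (coll_angle (fst z) v (snd z)) (v - fst z)"]
      show ?case by (simp add: loss_integrand_def right_diff_distrib)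
    qed
  qed (use \<phi> \<psi> in \<open>auto intro!: borel_measurable_diff borel_measurable_loss_integrand\<close>)
  then show ?thesis by (simp add: eq)
qed

text \<open>
  Convergence for almost every \<open>u\<close> passes to the post-collisional velocities because these avoid
  null sets, and \<open>\<phi> n\<close> and \<open>\<psi> n\<close> are bounded, so that the product of the two values converges as
  well.
\<close>

lemma Q_gain_diff_tendsto:
  fixes \<phi> \<psi> :: "nat \<Rightarrow> real^3 \<Rightarrow> real"
  assumes v: "\<Gamma> v < \<infinity>" and A: "0 \<le> A"
    and \<phi>: "\<And>n. \<phi> n \<in> borel_measurable borel" "\<And>n u. 0 \<le> \<phi> n u" "\<And>n u. \<phi> n u \<le> A * p u"
    and \<psi>: "\<And>n. \<psi> n \<in> borel_measurable borel" "\<And>n u. 0 \<le> \<psi> n u" "\<And>n u. \<psi> n u \<le> A * p u"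
    and lim: "AE u in lborel. (\<lambda>n. \<phi> n u - \<psi> n u) \<longlonglongrightarrow> 0"
  shows "(\<lambda>n. Q_gain q (\<phi> n) (\<phi> n) v - Q_gain q (\<psi> n) (\<psi> n) v) \<longlonglongrightarrow> 0"
proof -
  let ?M = phase_measure
  have eq: "Q_gain q (\<phi> n) (\<phi> n) v - Q_gain q (\<psi> n) (\<psi> n) v = (LINT z|?M. gain_integrand (\<phi> n) v z - gain_integrand (\<psi> n) v z)" for n
    unfolding Q_gain_eq
    by (rule Bochner_Integration.integral_diff[symmetric])
       (rule Q_gain_bound[OF v A \<phi>(2,3,1)] Q_gain_bound[OF v A \<psi>(2,3,1)])+
  have "(\<lambda>n. LINT z|?M. gain_integrand (\<phi> n) v z - gain_integrand (\<psi> n) v z) \<longlonglongrightarrow> (LINT z|?M. 0)"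
  proof (rule integral_dominated_convergence[where w="\<lambda>z. A\<^sup>2 * weighted_kernel v z"])
    show "integrable ?M (\<lambda>z. A\<^sup>2 * weighted_kernel v z)" using integrable_weighted_kernel(1)[OF v] by simp
    show "AE z in ?M. norm (gain_integrand (\<phi> n) v z - gain_integrand (\<psi> n) v z) \<le> A\<^sup>2 * weighted_kernel v z" for n
    proof (rule AE_I2)
      fix z assume "z \<in> space ?M"
      then show "norm (gain_integrand (\<phi> n) v z - gain_integrand (\<psi> n) v z) \<le> A\<^sup>2 * weighted_kernel v z"
        using gain_integrand_bound[OF A \<phi>(2)[of n] \<phi>(3)[of n], of z v] gain_integrand_bound[OF A \<psi>(2)[of n] \<psi>(3)[of n], of z v] by simp
    qed
    show "AE z in ?M. (\<lambda>n. gain_integrand (\<phi> n) v z - gain_integrand (\<psi> n) v z) \<longlonglongrightarrow> 0"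
      using AE_phase_post[OF lim, of v]
    proof eventually_elim
      case (elim z)
      let ?u = "post_u (fst z) v (snd z)" and ?v = "post_v (fst z) v (snd z)"
      have bd: "\<bar>\<phi> n w\<bar> \<le> A" "\<bar>\<psi> n w\<bar> \<le> A" for n w
        using \<phi>(2,3)[of n w] \<psi>(2,3)[of n w] mult_left_mono[OF p_le_1[of w] A] by auto
      have le: "\<bar>\<phi> n ?u * \<phi> n ?v - \<psi> n ?u * \<psi> n ?v\<bar> \<le> A * \<bar>\<phi> n ?u - \<psi> n ?u\<bar> + A * \<bar>\<phi> n ?v - \<psi> n ?v\<bar>" for n
      proof -
        have "\<phi> n ?u * \<phi> n ?v - \<psi> n ?u * \<psi> n ?v = \<phi> n ?v * (\<phi> n ?u - \<psi> n ?u) + \<psi> n ?u * (\<phi> n ?v - \<psi> n ?v)"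
          by (simp add: algebra_simps)
        then have "\<bar>\<phi> n ?u * \<phi> n ?v - \<psi> n ?u * \<psi> n ?v\<bar>
            \<le> \<bar>\<phi> n ?v * (\<phi> n ?u - \<psi> n ?u)\<bar> + \<bar>\<psi> n ?u * (\<phi> n ?v - \<psi> n ?v)\<bar>"
          by (simp only: abs_triangle_ineq)
        also have "\<dots> = \<bar>\<phi> n ?v\<bar> * \<bar>\<phi> n ?u - \<psi> n ?u\<bar> + \<bar>\<psi> n ?u\<bar> * \<bar>\<phi> n ?v - \<psi> n ?v\<bar>"
          by (simp only: abs_mult)
        also have "\<dots> \<le> A * \<bar>\<phi> n ?u - \<psi> n ?u\<bar> + A * \<bar>\<phi> n ?v - \<psi> n ?v\<bar>"
          by (intro add_mono mult_right_mono bd) auto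
        finally show ?thesis .
      qed
      have "(\<lambda>n. A * \<bar>\<phi> n ?u - \<psi> n ?u\<bar> + A * \<bar>\<phi> n ?v - \<psi> n ?v\<bar>) \<longlonglongrightarrow> A * \<bar>0\<bar> + A * \<bar>0\<bar>"
        using elim by (intro tendsto_intros) auto
      then have lim0: "(\<lambda>n. A * \<bar>\<phi> n ?u - \<psi> n ?u\<bar> + A * \<bar>\<phi> n ?v - \<psi> n ?v\<bar>) \<longlonglongrightarrow> 0"
        by simp
      have "(\<lambda>n. \<phi> n ?u * \<phi> n ?v - \<psi> n ?u * \<psi> n ?v) \<longlonglongrightarrow> 0"
        by (rule Lim_null_comparison[OF always_eventually lim0]) (simp only: real_norm_def le simp_thms)
      from tendsto_mult_right_zero[OF this, of "q (coll_angle (fst z) v (snd z)) (v - fst z)"]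
      show ?case by (simp add: gain_integrand_def right_diff_distrib mult.assoc)
    qed
  qed (use \<phi> \<psi> in \<open>auto intro!: borel_measurable_diff borel_measurable_gain_integrand\<close>)
  then show ?thesis by (simp add: eq)
qed

end

section \<open>The Duhamel formula along a sequence of space-time points\<close>

text \<open>
  The sequences \<open>t\<close> and \<open>t'\<close> have the same limit, so off that limit the two indicators eventually
  agree.
\<close>

lemma set_integral_moving_endpoint_tendsto:
  fixes G G' :: "nat \<Rightarrow> real \<Rightarrow> real"
  assumes G: "\<And>n. G n \<in> borel_measurable borel" "\<And>n \<tau>. 0 < \<tau> \<Longrightarrow> \<tau> < T \<Longrightarrow> \<bar>G n \<tau>\<bar> \<le> b \<tau>"
    and G': "\<And>n. G' n \<in> borel_measurable borel" "\<And>n \<tau>. 0 < \<tau> \<Longrightarrow> \<tau> < T \<Longrightarrow> \<bar>G' n \<tau>\<bar> \<le> b \<tau>"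
    and b: "set_integrable lborel {0<..<T} b"
    and t: "t \<longlonglongrightarrow> t0" "\<And>n. t n \<le> T" and t': "t' \<longlonglongrightarrow> t0" "\<And>n. t' n \<le> T" and s: "0 \<le> s"
    and lim: "AE \<tau> in lborel. s < \<tau> \<and> \<tau> < t0 \<longrightarrow> (\<lambda>n. G' n \<tau> - G n \<tau>) \<longlonglongrightarrow> 0"
  shows "(\<lambda>n. (LINT \<tau>:{s<..<t' n}|lborel. G' n \<tau>) - (LINT \<tau>:{s<..<t n}|lborel. G n \<tau>)) \<longlonglongrightarrow> 0"
proof -
  note [measurable] = G(1) G'(1)
  let ?b = "\<lambda>\<tau>. indicator {0<..<T} \<tau> * b \<tau>"
  have ib: "integrable lborel ?b" using b by (simp add: set_integrable_def)
  have bd: "\<bar>indicator {s<..<t n} \<tau> * G n \<tau>\<bar> \<le> ?b \<tau>" "\<bar>indicator {s<..<t' n} \<tau> * G' n \<tau>\<bar> \<le> ?b \<tau>" for n \<tau>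
    using G(2)[of \<tau> n] G'(2)[of \<tau> n] t(2)[of n] t'(2)[of n] s
    by (auto simp: indicator_def)
  have i: "integrable lborel (\<lambda>\<tau>. indicator {s<..<t n} \<tau> * G n \<tau>)" "integrable lborel (\<lambda>\<tau>. indicator {s<..<t' n} \<tau> * G' n \<tau>)" for n
    using bd by (auto intro!: Bochner_Integration.integrable_bound[OF ib] AE_I2 order_trans[OF _ abs_ge_self])
  have eq: "(LINT \<tau>:{s<..<t' n}|lborel. G' n \<tau>) - (LINT \<tau>:{s<..<t n}|lborel. G n \<tau>)
     = (LINT \<tau>|lborel. indicator {s<..<t' n} \<tau> * G' n \<tau> - indicator {s<..<t n} \<tau> * G n \<tau>)" for n
    unfolding set_lebesgue_integral_def using Bochner_Integration.integral_diff[OF i(2)[of n] i(1)[of n]] by simp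
  have "(\<lambda>n. LINT \<tau>|lborel. indicator {s<..<t' n} \<tau> * G' n \<tau> - indicator {s<..<t n} \<tau> * G n \<tau>) \<longlonglongrightarrow> (LINT \<tau>|(lborel::real measure). 0)"
  proof (rule integral_dominated_convergence[where w="\<lambda>\<tau>. 2 * ?b \<tau>"])
    show "integrable lborel (\<lambda>\<tau>. 2 * ?b \<tau>)" using ib by simp
    show "AE \<tau> in lborel. norm (indicator {s<..<t' n} \<tau> * G' n \<tau> - indicator {s<..<t n} \<tau> * G n \<tau>) \<le> 2 * ?b \<tau>" for n
    proof (rule AE_I2)
      fix \<tau> :: real
      show "norm (indicator {s<..<t' n} \<tau> * G' n \<tau> - indicator {s<..<t n} \<tau> * G n \<tau>) \<le> 2 * ?b \<tau>"
        using bd(1)[of n \<tau>] bd(2)[of n \<tau>] unfolding real_norm_def by linarith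
    qed
    show "AE \<tau> in lborel. (\<lambda>n. indicator {s<..<t' n} \<tau> * G' n \<tau> - indicator {s<..<t n} \<tau> * G n \<tau>) \<longlonglongrightarrow> 0"
      using lim AE_lborel_singleton[of t0]
    proof eventually_elim
      case (elim \<tau>)
      show ?case
      proof (cases "\<tau> < t0")
        case True
        have e: "\<forall>\<^sub>F n in sequentially. \<tau> < t n \<and> \<tau> < t' n"
          using order_tendstoD(1)[OF t(1) True] order_tendstoD(1)[OF t'(1) True] by eventually_elim simp
        show ?thesis
        proof (cases "s < \<tau>")
          case st: True
          have "(\<lambda>n. G' n \<tau> - G n \<tau>) \<longlonglongrightarrow> 0" using elim True st by simp
          moreover have "\<forall>\<^sub>F n in sequentially. G' n \<tau> - G n \<tau> = indicator {s<..<t' n} \<tau> * G' n \<tau> - indicator {s<..<t n} \<tau> * G n \<tau>"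
            using e by eventually_elim (simp add: st)
          ultimately show ?thesis by (rule Lim_transform_eventually)
        qed simp
      next
        case False
        then have gt: "t0 < \<tau>" using elim by simp
        have "\<forall>\<^sub>F n in sequentially. indicator {s<..<t' n} \<tau> * G' n \<tau> - indicator {s<..<t n} \<tau> * G n \<tau> = 0"
          using order_tendstoD(2)[OF t(1) gt] order_tendstoD(2)[OF t'(1) gt] by eventually_elim simp
        then show ?thesis by (rule tendsto_eventually)
      qed
    qed
  qed measurable
  then show ?thesis by (simp add: eq)
qed

lemma abs_exp_minus_diff_le:
  fixes a b :: real
  assumes "0 \<le> a" "0 \<le> b"
  shows "\<bar>exp (- a) - exp (- b)\<bar> \<le> \<bar>a - b\<bar>"
proof -
  have *: "exp (- x) - exp (- y) \<le> y - x" if "0 \<le> x" "x \<le> y" for x y :: real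
  proof -
    have "exp (- x) - exp (- y) = exp (- x) * (1 - exp (x - y))"
      by (simp add: right_diff_distrib exp_add[symmetric])
    also have "\<dots> \<le> 1 * (1 - exp (x - y))"
      using that by (intro mult_right_mono) auto
    also have "\<dots> \<le> 1 - (1 + (x - y))"
      unfolding mult_1_left by (rule diff_left_mono[OF exp_ge_add_one_self])
    finally show ?thesis by simp
  qed
  show ?thesis
  proof (cases "a \<le> b")
    case True
    then have "exp (- b) \<le> exp (- a)" by simp
    then show ?thesis using *[of a b] True assms by linarith
  next
    case False
    then have "exp (- a) \<le> exp (- b)" by simp
    then show ?thesis using *[of b a] False assms by linarith
  qed
qed

locale measurable_profile = cutoff_kernel +
  fixes f :: "real \<Rightarrow> real^3 \<Rightarrow> real^3 \<Rightarrow> real"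
  assumes f_measurable: "(\<lambda>z. f (fst z) (fst (snd z)) (snd (snd z))) \<in> borel_measurable (borel \<Otimes>\<^sub>M (borel \<Otimes>\<^sub>M borel))"
begin

lemma f_measurable_raw [measurable (raw)]:
  assumes [measurable]: "A \<in> borel_measurable M" "B \<in> borel_measurable M" "C \<in> borel_measurable M"
  shows "(\<lambda>w. f (A w) (B w) (C w)) \<in> borel_measurable M"
proof -
  have "(\<lambda>w. (A w, B w, C w)) \<in> M \<rightarrow>\<^sub>M borel \<Otimes>\<^sub>M (borel \<Otimes>\<^sub>M borel)" by measurable
  from measurable_compose[OF this f_measurable] show ?thesis by simp
qed

definition loss :: "real \<Rightarrow> real^3 \<Rightarrow> real^3 \<Rightarrow> real" where "loss \<tau> y v = loss_freq q (f \<tau> y) v"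
definition gain :: "real \<Rightarrow> real^3 \<Rightarrow> real^3 \<Rightarrow> real" where "gain \<tau> y v = Q_gain q (f \<tau> y) (f \<tau> y) v"

lemma borel_measurable_phase_integral:
  assumes "(\<lambda>w. g (fst w) (snd w)) \<in> borel_measurable (borel \<Otimes>\<^sub>M (borel \<Otimes>\<^sub>M borel))"
  shows "(\<lambda>x. LINT z|phase_measure. (g x z :: real)) \<in> borel_measurable borel"
proof -
  have "(\<lambda>w. g (fst w) (snd w)) \<in> borel_measurable (borel \<Otimes>\<^sub>M phase_measure)"
    by (rule borel_measurable_lborel_sphere[OF assms])
  then show ?thesis
    by (intro sigma_finite_measure.borel_measurable_lebesgue_integral[OF sigma_finite_phase])
       (simp add: case_prod_beta')
qed

lemma loss_measurable_raw [measurable (raw)]: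
  assumes [measurable]: "A \<in> borel_measurable M" "B \<in> borel_measurable M" "C \<in> borel_measurable M"
  shows "(\<lambda>w. loss (A w) (B w) (C w)) \<in> borel_measurable M"
proof -
  have "(\<lambda>w. loss_integrand (f (fst (fst w)) (fst (snd (fst w)))) (snd (snd (fst w))) (snd w))
     \<in> borel_measurable ((borel \<Otimes>\<^sub>M (borel \<Otimes>\<^sub>M borel)) \<Otimes>\<^sub>M (borel \<Otimes>\<^sub>M borel))"
    unfolding loss_integrand_def q_def coll_angle_def by measurable
  then have "(\<lambda>x. LINT z|phase_measure. loss_integrand (f (fst x) (fst (snd x))) (snd (snd x)) z)
      \<in> borel_measurable borel"
    by (intro borel_measurable_phase_integral) (simp add: borel_prod)
  then have *: "(\<lambda>x. loss (fst x) (fst (snd x)) (snd (snd x))) \<in> borel_measurable (borel \<Otimes>\<^sub>M (borel \<Otimes>\<^sub>M borel))"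
    by (simp add: loss_def loss_freq_eq borel_prod)
  have "(\<lambda>w. (A w, B w, C w)) \<in> M \<rightarrow>\<^sub>M borel \<Otimes>\<^sub>M (borel \<Otimes>\<^sub>M borel)" by measurable
  from measurable_compose[OF this *] show ?thesis by simp
qed

lemma gain_measurable_raw [measurable (raw)]:
  assumes [measurable]: "A \<in> borel_measurable M" "B \<in> borel_measurable M" "C \<in> borel_measurable M"
  shows "(\<lambda>w. gain (A w) (B w) (C w)) \<in> borel_measurable M"
proof -
  have "(\<lambda>w. gain_integrand (f (fst (fst w)) (fst (snd (fst w)))) (snd (snd (fst w))) (snd w))
     \<in> borel_measurable ((borel \<Otimes>\<^sub>M (borel \<Otimes>\<^sub>M borel)) \<Otimes>\<^sub>M (borel \<Otimes>\<^sub>M borel))"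
    unfolding gain_integrand_def q_def coll_angle_def post_u_def post_v_def by measurable
  then have "(\<lambda>x. LINT z|phase_measure. gain_integrand (f (fst x) (fst (snd x))) (snd (snd x)) z)
      \<in> borel_measurable borel"
    by (intro borel_measurable_phase_integral) (simp add: borel_prod)
  then have *: "(\<lambda>x. gain (fst x) (fst (snd x)) (snd (snd x))) \<in> borel_measurable (borel \<Otimes>\<^sub>M (borel \<Otimes>\<^sub>M borel))"
    by (simp add: gain_def Q_gain_eq borel_prod)
  have "(\<lambda>w. (A w, B w, C w)) \<in> M \<rightarrow>\<^sub>M borel \<Otimes>\<^sub>M (borel \<Otimes>\<^sub>M borel)" by measurable
  from measurable_compose[OF this *] show ?thesis by simp
qed

definition depletion :: "real \<Rightarrow> real^3 \<Rightarrow> real^3 \<Rightarrow> real \<Rightarrow> real" where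
  "depletion t x v s = (LINT \<tau>:{s<..<t}|lborel. loss \<tau> (x - (t - \<tau>) *\<^sub>R v) v)"

definition duhamel :: "(real^3 \<Rightarrow> real^3 \<Rightarrow> real) \<Rightarrow> real \<Rightarrow> real^3 \<Rightarrow> real^3 \<Rightarrow> real" where
  "duhamel F\<^sub>0 t x v = F\<^sub>0 (x - t *\<^sub>R v) v * exp (- depletion t x v 0) +
     (LINT s:{0<..<t}|lborel. exp (- depletion t x v s) * gain s (x - (t - s) *\<^sub>R v) v)"

lemma depletion_measurable [measurable]: "depletion t x v \<in> borel_measurable borel"
proof -
  have "(\<lambda>w. (if fst w < snd w \<and> snd w < t then 1 else 0) * loss (snd w) (x - (t - snd w) *\<^sub>R v) v) \<in> borel_measurable (borel \<Otimes>\<^sub>M lborel)"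
    by measurable
  then have "(\<lambda>s. LINT \<tau>|lborel. (if s < \<tau> \<and> \<tau> < t then 1 else 0) * loss \<tau> (x - (t - \<tau>) *\<^sub>R v) v) \<in> borel_measurable borel"
    by (intro lborel.borel_measurable_lebesgue_integral) (simp add: case_prod_beta')
  moreover have "depletion t x v = (\<lambda>s. LINT \<tau>|lborel. (if s < \<tau> \<and> \<tau> < t then 1 else 0) * loss \<tau> (x - (t - \<tau>) *\<^sub>R v) v)"
    unfolding depletion_def set_lebesgue_integral_def
    by (intro ext Bochner_Integration.integral_cong) (auto simp: indicator_def)
  ultimately show ?thesis by simp
qed

end

text \<open>
  A nonnegative profile below \<open>a \<tau> p u\<close> at every point, so that no exceptional sets occur. Square
  integrability of \<open>a\<close> in time matches the gain term, which is quadratic in the profile.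
\<close>

locale bounded_profile = measurable_profile +
  fixes a :: "real \<Rightarrow> real" and T :: real
  assumes f_nonneg: "\<And>\<tau> y u. 0 \<le> f \<tau> y u" and f_le: "\<And>\<tau> y u. f \<tau> y u \<le> a \<tau> * p u"
    and a_measurable [measurable]: "a \<in> borel_measurable borel" and a_nonneg: "\<And>\<tau>. 0 \<le> a \<tau>"
    and a_finite: "(\<integral>\<^sup>+\<tau>. ennreal ((a \<tau>)\<^sup>2) * indicator {0<..<T} \<tau> \<partial>lborel) < \<infinity>"
begin

lemma integrable_a2: "set_integrable lborel {0<..<T} (\<lambda>\<tau>. (a \<tau>)\<^sup>2)"
  unfolding set_integrable_def
proof (rule integrableI_nonneg)
  have "(\<integral>\<^sup>+x. ennreal (indicator {0<..<T} x *\<^sub>R (a x)\<^sup>2) \<partial>lborel) = (\<integral>\<^sup>+\<tau>. ennreal ((a \<tau>)\<^sup>2) * indicator {0<..<T} \<tau> \<partial>lborel)"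
    by (intro nn_integral_cong) (auto simp: indicator_def)
  then show "(\<integral>\<^sup>+x. ennreal (indicator {0<..<T} x *\<^sub>R (a x)\<^sup>2) \<partial>lborel) < \<infinity>" using a_finite by simp
qed auto

lemma integrable_a: "set_integrable lborel {0<..<T} a"
  unfolding set_integrable_def
proof (rule Bochner_Integration.integrable_bound)
  show "integrable lborel (\<lambda>\<tau>. indicator {0<..<T} \<tau> * 1 + indicator {0<..<T} \<tau> * (a \<tau>)\<^sup>2)"
    using integrable_a2 emeasure_bounded_finite[of "{0<..<T}"]
    by (intro Bochner_Integration.integrable_add) (auto simp: set_integrable_def)
  have "a \<tau> \<le> 1 + (a \<tau>)\<^sup>2" for \<tau>
    using zero_le_power2[of "a \<tau> - 1"] a_nonneg[of \<tau>] by (simp add: power2_diff)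
  then show "AE \<tau> in lborel. norm (indicator {0<..<T} \<tau> *\<^sub>R a \<tau>) \<le> norm (indicator {0<..<T} \<tau> * 1 + indicator {0<..<T} \<tau> * (a \<tau>)\<^sup>2)"
    using a_nonneg by (intro AE_I2) (auto simp: indicator_def)
qed measurable

lemma f_section_measurable: "f \<tau> y \<in> borel_measurable borel"
  by measurable

lemma loss_bound:
  assumes "\<Gamma> v < \<infinity>"
  shows "0 \<le> loss \<tau> y v" "loss \<tau> y v \<le> a \<tau> * \<Lambda> v"
  unfolding loss_def using loss_freq_bound[OF assms a_nonneg f_nonneg f_le f_section_measurable] by auto

lemma gain_bound:
  assumes "\<Gamma> v < \<infinity>"
  shows "0 \<le> gain \<tau> y v" "gain \<tau> y v \<le> (a \<tau>)\<^sup>2 * enn2real (\<Gamma> v)"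
  unfolding gain_def using Q_gain_bound[OF assms a_nonneg f_nonneg f_le f_section_measurable] by auto

lemma depletion_nonneg:
  assumes "\<Gamma> v < \<infinity>"
  shows "0 \<le> depletion t x v s"
  unfolding depletion_def set_lebesgue_integral_def
  using loss_bound(1)[OF assms] by (intro Bochner_Integration.integral_nonneg) (auto simp: indicator_def)

text \<open>
  Both exponential factors are at most one, because the loss frequency is nonnegative.
\<close>

lemma duhamel_bound:
  assumes v: "\<Gamma> v < \<infinity>" and t: "t \<le> T"
  shows "\<bar>duhamel F\<^sub>0 t x v\<bar> \<le> \<bar>F\<^sub>0 (x - t *\<^sub>R v) v\<bar> + (LINT \<tau>:{0<..<T}|lborel. (a \<tau>)\<^sup>2) * enn2real (\<Gamma> v)"
proof -
  let ?g = "\<lambda>s. exp (- depletion t x v s) * gain s (x - (t - s) *\<^sub>R v) v"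
  have e: "exp (- depletion t x v s) \<le> 1" for s using depletion_nonneg[OF v] by simp
  have g: "0 \<le> ?g s" "?g s \<le> (a s)\<^sup>2 * enn2real (\<Gamma> v)" for s
  proof -
    show "0 \<le> ?g s" using gain_bound[OF v] by simp
    have "?g s \<le> 1 * ((a s)\<^sup>2 * enn2real (\<Gamma> v))" using gain_bound[OF v] e by (intro mult_mono) auto
    then show "?g s \<le> (a s)\<^sup>2 * enn2real (\<Gamma> v)" by simp
  qed
  have iT: "integrable lborel (\<lambda>s. indicator {0<..<T} s * (a s)\<^sup>2 * enn2real (\<Gamma> v))"
    using integrable_a2 by (auto simp: set_integrable_def)
  have le: "indicator {0<..<t} s *\<^sub>R ?g s \<le> indicator {0<..<T} s * (a s)\<^sup>2 * enn2real (\<Gamma> v)"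
       "0 \<le> indicator {0<..<t} s *\<^sub>R ?g s" for s
    using g[of s] t by (auto simp: indicator_def)
  have ig: "integrable lborel (\<lambda>s. indicator {0<..<t} s *\<^sub>R ?g s)"
    by (rule Bochner_Integration.integrable_bound[OF iT], measurable)
       (use le in \<open>auto intro!: AE_I2 order_trans[OF _ abs_ge_self]\<close>)
  have "(LINT s:{0<..<t}|lborel. ?g s) \<le> (LINT s|lborel. indicator {0<..<T} s * (a s)\<^sup>2 * enn2real (\<Gamma> v))"
    unfolding set_lebesgue_integral_def by (intro integral_mono ig iT le)
  also have "\<dots> = (LINT \<tau>:{0<..<T}|lborel. (a \<tau>)\<^sup>2) * enn2real (\<Gamma> v)"
    by (simp add: set_lebesgue_integral_def)
  finally have up: "(LINT s:{0<..<t}|lborel. ?g s) \<le> (LINT \<tau>:{0<..<T}|lborel. (a \<tau>)\<^sup>2) * enn2real (\<Gamma> v)" .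
  have lo: "0 \<le> (LINT s:{0<..<t}|lborel. ?g s)"
    unfolding set_lebesgue_integral_def using le(2) by (intro Bochner_Integration.integral_nonneg)
  have "\<bar>F\<^sub>0 (x - t *\<^sub>R v) v * exp (- depletion t x v 0)\<bar> \<le> \<bar>F\<^sub>0 (x - t *\<^sub>R v) v\<bar> * 1"
    unfolding abs_mult using e by (intro mult_mono) auto
  then show ?thesis unfolding duhamel_def using up lo by linarith
qed

text \<open>
  Dominated convergence is applied in turn to the collision integrals, to the exponents and to the
  gain term, all at one fixed velocity.
\<close>

lemma duhamel_diff_tendsto:
  assumes v: "\<Gamma> v < \<infinity>"
    and t: "t \<longlonglongrightarrow> t0" "\<And>n. t n \<le> T" and t': "t' \<longlonglongrightarrow> t0" "\<And>n. t' n \<le> T"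
    and F0: "\<And>y. \<bar>F\<^sub>0 y v\<bar> \<le> C"
    and F0_lim: "(\<lambda>n. F\<^sub>0 (x' n - t' n *\<^sub>R v) v - F\<^sub>0 (x n - t n *\<^sub>R v) v) \<longlonglongrightarrow> 0"
    and f_lim: "AE \<tau> in lborel. AE u in lborel. 0 < \<tau> \<and> \<tau> < t0 \<longrightarrow>
       (\<lambda>n. f \<tau> (x' n - (t' n - \<tau>) *\<^sub>R v) u - f \<tau> (x n - (t n - \<tau>) *\<^sub>R v) u) \<longlonglongrightarrow> 0"
  shows "(\<lambda>n. duhamel F\<^sub>0 (t' n) (x' n) v - duhamel F\<^sub>0 (t n) (x n) v) \<longlonglongrightarrow> 0"
proof -
  let ?y = "\<lambda>n \<tau>. x n - (t n - \<tau>) *\<^sub>R v" and ?y' = "\<lambda>n \<tau>. x' n - (t' n - \<tau>) *\<^sub>R v"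
  let ?E = "\<lambda>n s. exp (- depletion (t n) (x n) v s)" and ?E' = "\<lambda>n s. exp (- depletion (t' n) (x' n) v s)"
  have L_lim: "AE \<tau> in lborel. 0 < \<tau> \<and> \<tau> < t0 \<longrightarrow> (\<lambda>n. loss \<tau> (?y' n \<tau>) v - loss \<tau> (?y n \<tau>) v) \<longlonglongrightarrow> 0"
    using f_lim
  proof eventually_elim
    case (elim \<tau>)
    then show ?case unfolding loss_def
      by (auto intro!: loss_freq_diff_tendsto[OF v a_nonneg[of \<tau>]] f_section_measurable f_nonneg f_le)
  qed
  have Q_lim: "AE \<tau> in lborel. 0 < \<tau> \<and> \<tau> < t0 \<longrightarrow> (\<lambda>n. gain \<tau> (?y' n \<tau>) v - gain \<tau> (?y n \<tau>) v) \<longlonglongrightarrow> 0"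
    using f_lim
  proof eventually_elim
    case (elim \<tau>)
    then show ?case unfolding gain_def
      by (auto intro!: Q_gain_diff_tendsto[OF v a_nonneg[of \<tau>]] f_section_measurable f_nonneg f_le)
  qed
  have dep: "(\<lambda>n. depletion (t' n) (x' n) v s - depletion (t n) (x n) v s) \<longlonglongrightarrow> 0" if s: "0 \<le> s" for s
    unfolding depletion_def
  proof (rule set_integral_moving_endpoint_tendsto[OF _ _ _ _ _ t t' s])
    show "set_integrable lborel {0<..<T} (\<lambda>\<tau>. a \<tau> * \<Lambda> v)" using integrable_a by auto
    show "AE \<tau> in lborel. s < \<tau> \<and> \<tau> < t0 \<longrightarrow> (\<lambda>n. loss \<tau> (?y' n \<tau>) v - loss \<tau> (?y n \<tau>) v) \<longlonglongrightarrow> 0"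
      using L_lim by eventually_elim (use s in auto)
  qed (use loss_bound[OF v] in auto)
  have E_lim: "(\<lambda>n. ?E' n s - ?E n s) \<longlonglongrightarrow> 0" if s: "0 \<le> s" for s
  proof (rule Lim_null_comparison[OF always_eventually])
    show "\<forall>n. norm (?E' n s - ?E n s) \<le> \<bar>depletion (t' n) (x' n) v s - depletion (t n) (x n) v s\<bar>"
      using abs_exp_minus_diff_le[OF depletion_nonneg[OF v] depletion_nonneg[OF v]] by simp
    show "(\<lambda>n. \<bar>depletion (t' n) (x' n) v s - depletion (t n) (x n) v s\<bar>) \<longlonglongrightarrow> 0"
      using dep[OF s] by (rule tendsto_rabs_zero)
  qed
  have E01: "0 \<le> ?E n s" "?E n s \<le> 1" "0 \<le> ?E' n s" "?E' n s \<le> 1" for n s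
    using depletion_nonneg[OF v] by auto
  have prod_lim: "(\<lambda>n. A' n * B' n - A n * B n) \<longlonglongrightarrow> 0"
    if "(\<lambda>n. A' n - A n) \<longlonglongrightarrow> 0" "(\<lambda>n. B' n - B n) \<longlonglongrightarrow> 0" "\<And>n. \<bar>A n\<bar> \<le> c" "\<And>n. \<bar>B' n\<bar> \<le> d"
    for A A' B B' :: "nat \<Rightarrow> real" and c d
  proof -
    have lim0: "(\<lambda>n. d * \<bar>A' n - A n\<bar> + c * \<bar>B' n - B n\<bar>) \<longlonglongrightarrow> 0"
      using tendsto_add[OF tendsto_mult_right_zero[OF tendsto_rabs_zero[OF that(1)], of d]
         tendsto_mult_right_zero[OF tendsto_rabs_zero[OF that(2)], of c]] by simp
    have le: "\<bar>A' n * B' n - A n * B n\<bar> \<le> d * \<bar>A' n - A n\<bar> + c * \<bar>B' n - B n\<bar>" for n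
    proof -
      have "A' n * B' n - A n * B n = B' n * (A' n - A n) + A n * (B' n - B n)" by (simp add: algebra_simps)
      then have "\<bar>A' n * B' n - A n * B n\<bar> \<le> \<bar>B' n * (A' n - A n)\<bar> + \<bar>A n * (B' n - B n)\<bar>"
        by (simp only: abs_triangle_ineq)
      also have "\<dots> = \<bar>B' n\<bar> * \<bar>A' n - A n\<bar> + \<bar>A n\<bar> * \<bar>B' n - B n\<bar>" by (simp only: abs_mult)
      also have "\<dots> \<le> d * \<bar>A' n - A n\<bar> + c * \<bar>B' n - B n\<bar>"
        by (intro add_mono mult_right_mono that) auto
      finally show ?thesis .
    qed
    show ?thesis by (rule Lim_null_comparison[OF always_eventually lim0]) (simp only: real_norm_def le simp_thms)
  qed
  have first: "(\<lambda>n. F\<^sub>0 (x' n - t' n *\<^sub>R v) v * ?E' n 0 - F\<^sub>0 (x n - t n *\<^sub>R v) v * ?E n 0) \<longlonglongrightarrow> 0"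
    by (rule prod_lim[OF F0_lim E_lim[OF order_refl], where c=C and d=1]) (use F0 E01 in auto)
  have second: "(\<lambda>n. (LINT s:{0<..<t' n}|lborel. ?E' n s * gain s (?y' n s) v) - (LINT s:{0<..<t n}|lborel. ?E n s * gain s (?y n s) v)) \<longlonglongrightarrow> 0"
  proof (rule set_integral_moving_endpoint_tendsto[OF _ _ _ _ _ t t' order_refl])
    let ?b = "\<lambda>s. (a s)\<^sup>2 * enn2real (\<Gamma> v)"
    show "set_integrable lborel {0<..<T} ?b" using integrable_a2 by auto
    have "\<bar>e * gain s y v\<bar> \<le> ?b s" if "0 \<le> e" "e \<le> 1" for e s y
    proof -
      have "e * gain s y v \<le> 1 * ?b s" using that gain_bound[OF v] by (intro mult_mono) auto
      then show ?thesis using that gain_bound(1)[OF v] by simp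
    qed
    then show "\<bar>?E n s * gain s (?y n s) v\<bar> \<le> ?b s" "\<bar>?E' n s * gain s (?y' n s) v\<bar> \<le> ?b s" for n s
      using E01 by auto
    show "AE s in lborel. 0 < s \<and> s < t0 \<longrightarrow> (\<lambda>n. ?E' n s * gain s (?y' n s) v - ?E n s * gain s (?y n s) v) \<longlonglongrightarrow> 0"
      using Q_lim
    proof (eventually_elim, intro impI)
      fix s assume *: "0 < s \<and> s < t0 \<longrightarrow> (\<lambda>n. gain s (?y' n s) v - gain s (?y n s) v) \<longlonglongrightarrow> 0" and s: "0 < s \<and> s < t0"
      have q': "\<bar>gain s (?y' n s) v\<bar> \<le> ?b s" for n using gain_bound[OF v] by simp
      have e: "\<bar>?E n s\<bar> \<le> 1" for n using E01[of n s] by simp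
      show "(\<lambda>n. ?E' n s * gain s (?y' n s) v - ?E n s * gain s (?y n s) v) \<longlonglongrightarrow> 0"
        using * s by (intro prod_lim[OF E_lim _ e q']) auto
    qed
  qed measurable
  have "(\<lambda>n. duhamel F\<^sub>0 (t' n) (x' n) v - duhamel F\<^sub>0 (t n) (x n) v) =
    (\<lambda>n. (F\<^sub>0 (x' n - t' n *\<^sub>R v) v * ?E' n 0 - F\<^sub>0 (x n - t n *\<^sub>R v) v * ?E n 0) +
      ((LINT s:{0<..<t' n}|lborel. ?E' n s * gain s (?y' n s) v) - (LINT s:{0<..<t n}|lborel. ?E n s * gain s (?y n s) v)))"
    by (rule ext) (simp add: duhamel_def)
  then show ?thesis using tendsto_add[OF first second] by simp
qed

end

text \<open>
  The signed square \<open>s \<mapsto> s |s|\<close> turns square integrable functions into integrable ones, and its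
  inverse is uniformly continuous.
\<close>

lemma square_diff_le_signed_square_diff:
  fixes a b :: real
  shows "(a - b)\<^sup>2 \<le> 2 * \<bar>a * \<bar>a\<bar> - b * \<bar>b\<bar>\<bar>"
proof -
  have pos: "(x - y)\<^sup>2 \<le> 2 * \<bar>x * x - y * y\<bar>" if "0 \<le> x" "0 \<le> y" for x y :: real
  proof -
    have "(x - y)\<^sup>2 = \<bar>x - y\<bar> * \<bar>x - y\<bar>" by (simp add: power2_eq_square)
    also have "\<dots> \<le> \<bar>x - y\<bar> * (x + y)" using that by (intro mult_left_mono) auto
    also have "\<dots> = \<bar>(x - y) * (x + y)\<bar>" using that by (simp add: abs_mult)
    also have "\<dots> = \<bar>x * x - y * y\<bar>" by (simp add: algebra_simps)
    finally show ?thesis by (rule order_trans) simp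
  qed
  have opp: "(x + y)\<^sup>2 \<le> 2 * (x * x + y * y)" for x y :: real
    using zero_le_power2[of "x - y"] by (simp add: power2_eq_square algebra_simps)
  consider "0 \<le> a" "0 \<le> b" | "0 \<le> a" "b < 0" | "a < 0" "0 \<le> b" | "a < 0" "b < 0" by linarith
  then show ?thesis
  proof cases
    case 1 then show ?thesis using pos[of a b] by simp
  next
    case 2
    then have "a * \<bar>a\<bar> - b * \<bar>b\<bar> = a * a + b * b" by simp
    then show ?thesis using opp[of a "- b"] by simp
  next
    case 3
    then have "a * \<bar>a\<bar> - b * \<bar>b\<bar> = - (a * a + b * b)" by simp
    then show ?thesis using opp[of a "- b"] by simp
  next
    case 4
    then have "a * \<bar>a\<bar> - b * \<bar>b\<bar> = - ((- a) * (- a) - (- b) * (- b))" by simp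
    then have "\<bar>a * \<bar>a\<bar> - b * \<bar>b\<bar>\<bar> = \<bar>(- a) * (- a) - (- b) * (- b)\<bar>" by (simp only: abs_minus_cancel)
    moreover have "(a - b)\<^sup>2 = (- a - - b)\<^sup>2" by (simp add: power2_commute)
    ultimately show ?thesis using pos[of "- a" "- b"] 4 by simp
  qed
qed

lemma borel_measurable_maxwellian [measurable]: "maxwellian \<in> borel_measurable borel"
  unfolding maxwellian_def by measurable

context bounded_profile
begin

text \<open>
  The Maxwellian does not depend on \<open>y\<close> and cancels in the difference, so only \<open>f - c \<mu>\<close> has to be
  square integrable. One subsequence serves almost all \<open>(v, \<tau>, u)\<close> at once, because the convergence is
  obtained in the mean over all three variables.
\<close>

lemma AE_subsequence_along_characteristics:
  fixes c :: real
  assumes L2: "AE \<tau> in lborel. 0 < \<tau> \<and> \<tau> < T \<longrightarrow>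
      integrable lborel (\<lambda>z. (f \<tau> (fst z) (snd z) - c * maxwellian (snd z))\<^sup>2)"
    and t: "t \<longlonglongrightarrow> t0" "\<And>n. t n \<le> T" and t': "t' \<longlonglongrightarrow> t0" "\<And>n. t' n \<le> T"
    and x: "(\<lambda>n. x' n - x n) \<longlonglongrightarrow> 0"
  obtains r :: "nat \<Rightarrow> nat" where "strict_mono r"
    "AE v in lborel. AE \<tau> in lborel. AE u in lborel. 0 < \<tau> \<and> \<tau> < t0 \<longrightarrow>
       (\<lambda>n. f \<tau> (x' (r n) - (t' (r n) - \<tau>) *\<^sub>R v) u - f \<tau> (x (r n) - (t (r n) - \<tau>) *\<^sub>R v) u) \<longlonglongrightarrow> 0"
proof -
  define d where "d n v \<tau> u = (if 0 < \<tau> \<and> \<tau> < t n \<and> \<tau> < t' n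
    then (f \<tau> (x' n - (t' n - \<tau>) *\<^sub>R v) u - f \<tau> (x n - (t n - \<tau>) *\<^sub>R v) u)\<^sup>2 * (p v * p u) else 0)" for n v \<tau> u
  have d_meas [measurable (raw)]: "(\<lambda>w. d n (V w) (S w) (U w)) \<in> borel_measurable M"
    if [measurable]: "V \<in> borel_measurable M" "S \<in> borel_measurable M" "U \<in> borel_measurable M" for M :: "'z measure" and V S U n
    unfolding d_def by measurable
  have d_nonneg: "0 \<le> d n v \<tau> u" for n v \<tau> u using p_pos by (simp add: d_def less_imp_le)
  have d_le: "d n v \<tau> u \<le> indicator {0<..<T} \<tau> * (a \<tau>)\<^sup>2 * (p v * p u)" for n v \<tau> u
  proof (cases "0 < \<tau> \<and> \<tau> < t n \<and> \<tau> < t' n")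
    case True
    let ?y = "x n - (t n - \<tau>) *\<^sub>R v" and ?y' = "x' n - (t' n - \<tau>) *\<^sub>R v"
    have "a \<tau> * p u \<le> a \<tau>" using a_nonneg p_le_1 by (simp add: mult_left_le)
    then have "\<bar>f \<tau> ?y' u - f \<tau> ?y u\<bar> \<le> a \<tau>"
      using f_nonneg[of \<tau> ?y u] f_nonneg[of \<tau> ?y' u] f_le[of \<tau> ?y u] f_le[of \<tau> ?y' u] by linarith
    then have "(f \<tau> ?y' u - f \<tau> ?y u)\<^sup>2 \<le> (a \<tau>)\<^sup>2" by (metis abs_ge_zero power2_abs power_mono)
    then have "(f \<tau> ?y' u - f \<tau> ?y u)\<^sup>2 * (p v * p u) \<le> (a \<tau>)\<^sup>2 * (p v * p u)"
      using p_pos by (intro mult_right_mono) (auto simp: less_imp_le)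
    then show ?thesis using True t(2)[of n] by (simp add: d_def)
  qed (use p_pos in \<open>auto simp: d_def less_imp_le\<close>)
  let ?P = "\<integral>\<^sup>+u. ennreal (p u) \<partial>lborel"
  define D where "D n \<tau> = (\<integral>\<^sup>+v. (\<integral>\<^sup>+u. ennreal (d n v \<tau> u) \<partial>lborel) \<partial>lborel)" for n \<tau>
  have D_le: "D n \<tau> \<le> ennreal ((a \<tau>)\<^sup>2) * indicator {0<..<T} \<tau> * (?P * ?P)" for n \<tau>
  proof -
    have "D n \<tau> \<le> (\<integral>\<^sup>+v. (\<integral>\<^sup>+u. ennreal ((a \<tau>)\<^sup>2) * indicator {0<..<T} \<tau> * ennreal (p v) * ennreal (p u) \<partial>lborel) \<partial>lborel)"
      unfolding D_def
    proof (intro nn_integral_mono)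
      fix v u
      show "ennreal (d n v \<tau> u) \<le> ennreal ((a \<tau>)\<^sup>2) * indicator {0<..<T} \<tau> * ennreal (p v) * ennreal (p u)"
        using ennreal_leI[OF d_le[of n v \<tau> u]] p_pos by (auto simp: indicator_def ennreal_mult less_imp_le mult.assoc split: if_splits)
    qed
    also have "\<dots> = ennreal ((a \<tau>)\<^sup>2) * indicator {0<..<T} \<tau> * (?P * ?P)"
      by (simp add: nn_integral_cmult nn_integral_multc mult.assoc)
    finally show ?thesis .
  qed
  have fin: "(\<integral>\<^sup>+\<tau>. ennreal ((a \<tau>)\<^sup>2) * indicator {0<..<T} \<tau> * (?P * ?P) \<partial>lborel) < \<infinity>"
    using a_finite nn_integral_p_finite by (subst nn_integral_multc) (auto simp: ennreal_mult_less_top)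
  have [measurable]: "D n \<in> borel_measurable borel" for n unfolding D_def by measurable
  have lim: "AE \<tau> in lborel. (\<lambda>n. D n \<tau>) \<longlonglongrightarrow> 0"
    using L2 AE_lborel_singleton[of t0]
  proof eventually_elim
    case (elim \<tau>)
    show ?case
    proof (cases "0 < \<tau> \<and> \<tau> < t0")
      case True
      have "t0 \<le> T" using t by (intro LIMSEQ_le_const2[OF t(1)]) auto
      then have i2: "integrable lborel (\<lambda>z. (f \<tau> (fst z) (snd z) - c * maxwellian (snd z))\<^sup>2)" using elim True by simp
      \<comment> \<open>the signed square of \<open>f - c \<mu>\<close>\<close>
      define g where "g z = (f \<tau> (fst z) (snd z) - c * maxwellian (snd z)) * \<bar>f \<tau> (fst z) (snd z) - c * maxwellian (snd z)\<bar>" for z :: "(real^3) \<times> (real^3)"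
      have "g \<in> borel_measurable (borel \<Otimes>\<^sub>M borel)" unfolding g_def by measurable
      then have gm: "g \<in> borel_measurable lborel" by (simp add: borel_prod)
      have ig: "integrable lborel g"
        by (rule Bochner_Integration.integrable_bound[OF i2 gm]) (auto simp: g_def abs_mult power2_eq_square)
      have *: "(\<lambda>n. \<integral>\<^sup>+v. (\<integral>\<^sup>+u. ennreal (\<bar>g (x' n - (t' n - \<tau>) *\<^sub>R v, u) - g (x n - (t n - \<tau>) *\<^sub>R v, u)\<bar> * (p v * p u)) \<partial>lborel) \<partial>lborel) \<longlonglongrightarrow> 0"
        (is "?E \<longlonglongrightarrow> 0")
        using p_pos p_le_1 nn_integral_p_finite elim
        by (intro mean_continuity_along_characteristics[OF ig _ _ _ _ _ _ _ _ t(1) t'(1) x]) (auto simp: less_imp_le)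
      have [measurable]: "g \<in> borel_measurable (borel \<Otimes>\<^sub>M borel)" by fact
      have le: "D n \<tau> \<le> 2 * ?E n" for n
      proof -
        have "D n \<tau> \<le> (\<integral>\<^sup>+v. (\<integral>\<^sup>+u. 2 * ennreal (\<bar>g (x' n - (t' n - \<tau>) *\<^sub>R v, u) - g (x n - (t n - \<tau>) *\<^sub>R v, u)\<bar> * (p v * p u)) \<partial>lborel) \<partial>lborel)"
          unfolding D_def
        proof (intro nn_integral_mono)
          fix v u
          let ?y = "x n - (t n - \<tau>) *\<^sub>R v" and ?y' = "x' n - (t' n - \<tau>) *\<^sub>R v" and ?m = "c * maxwellian u"
          have w: "0 \<le> p v * p u" using p_pos by (simp add: less_imp_le)
          have "(f \<tau> ?y' u - f \<tau> ?y u)\<^sup>2 = ((f \<tau> ?y' u - ?m) - (f \<tau> ?y u - ?m))\<^sup>2" by simp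
          also have "\<dots> \<le> 2 * \<bar>g (?y', u) - g (?y, u)\<bar>"
            unfolding g_def fst_conv snd_conv by (rule square_diff_le_signed_square_diff)
          finally have "(f \<tau> ?y' u - f \<tau> ?y u)\<^sup>2 * (p v * p u) \<le> 2 * \<bar>g (?y', u) - g (?y, u)\<bar> * (p v * p u)"
            using w by (rule mult_right_mono)
          then have "d n v \<tau> u \<le> 2 * (\<bar>g (?y', u) - g (?y, u)\<bar> * (p v * p u))"
            using w by (auto simp: d_def mult.assoc)
          from ennreal_leI[OF this] show "ennreal (d n v \<tau> u) \<le> 2 * ennreal (\<bar>g (?y', u) - g (?y, u)\<bar> * (p v * p u))"
            using w by (simp add: ennreal_mult)
        qed
        also have "\<dots> = 2 * ?E n"
          by (simp add: nn_integral_cmult)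
        finally show ?thesis .
      qed
      have "(\<lambda>n. 2 * ?E n) \<longlonglongrightarrow> 2 * 0" using * by (intro ennreal_tendsto_cmult) auto
      then have up: "(\<lambda>n. 2 * ?E n) \<longlonglongrightarrow> 0" by simp
      show ?thesis
        by (rule tendsto_sandwich[OF _ _ tendsto_const up]) (simp_all add: le)
    next
      case False
      then consider "\<tau> \<le> 0" | "t0 < \<tau>" using elim by linarith
      then show ?thesis
      proof cases
        case 1
        then have "D n \<tau> = 0" for n by (simp add: D_def d_def)
        then show ?thesis by simp
      next
        case 2
        have "\<forall>\<^sub>F n in sequentially. D n \<tau> = 0"
          using order_tendstoD(2)[OF t(1) 2] by eventually_elim (simp add: D_def d_def)
        then show ?thesis by (rule tendsto_eventually)
      qed
    qed
  qed
  have J: "(\<lambda>n. \<integral>\<^sup>+\<tau>. D n \<tau> \<partial>lborel) \<longlonglongrightarrow> (\<integral>\<^sup>+\<tau>. 0 \<partial>(lborel :: real measure))"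
    by (rule nn_integral_dominated_convergence[where w="\<lambda>\<tau>. ennreal ((a \<tau>)\<^sup>2) * indicator {0<..<T} \<tau> * (?P * ?P)"])
       (use D_le fin lim in auto)
  let ?M = "(lborel :: (real^3) measure) \<Otimes>\<^sub>M ((lborel :: real measure) \<Otimes>\<^sub>M (lborel :: (real^3) measure))"
  let ?H = "\<lambda>n w. d n (fst w) (fst (snd w)) (snd (snd w))"
  have sf: "sigma_finite_measure ((lborel :: real measure) \<Otimes>\<^sub>M (lborel :: (real^3) measure))"
    by (rule sigma_finite_pair_measure) (rule lborel.sigma_finite_measure_axioms)+
  have Hm: "?H n \<in> borel_measurable ?M" for n by measurable
  have HJ: "(\<integral>\<^sup>+w. ennreal (?H n w) \<partial>?M) = (\<integral>\<^sup>+\<tau>. D n \<tau> \<partial>lborel)" for n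
  proof -
    have "(\<integral>\<^sup>+w. ennreal (?H n w) \<partial>?M) = (\<integral>\<^sup>+v. (\<integral>\<^sup>+z. ennreal (?H n (v, z)) \<partial>(lborel \<Otimes>\<^sub>M lborel)) \<partial>lborel)"
      using sigma_finite_measure.nn_integral_fst[OF sf measurable_compose[OF Hm measurable_ennreal, of n]] by simp
    also have "\<dots> = (\<integral>\<^sup>+v. (\<integral>\<^sup>+\<tau>. (\<integral>\<^sup>+u. ennreal (d n v \<tau> u) \<partial>lborel) \<partial>lborel) \<partial>lborel)"
    proof (rule nn_integral_cong)
      fix v :: "real^3"
      have "(\<lambda>z. ennreal (d n v (fst z) (snd z))) \<in> borel_measurable (lborel \<Otimes>\<^sub>M lborel)" by measurable
      from lborel.nn_integral_fst[OF this]
      show "(\<integral>\<^sup>+z. ennreal (?H n (v, z)) \<partial>(lborel \<Otimes>\<^sub>M lborel)) = (\<integral>\<^sup>+\<tau>. (\<integral>\<^sup>+u. ennreal (d n v \<tau> u) \<partial>lborel) \<partial>lborel)"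
        by simp
    qed
    also have "\<dots> = (\<integral>\<^sup>+\<tau>. D n \<tau> \<partial>lborel)"
      unfolding D_def by (rule lborel_pair.Fubini') measurable
    finally show ?thesis .
  qed
  have Hi: "integrable ?M (?H n)" for n
  proof (rule integrableI_nonneg[OF Hm])
    have "(\<integral>\<^sup>+\<tau>. D n \<tau> \<partial>lborel) \<le> (\<integral>\<^sup>+\<tau>. ennreal ((a \<tau>)\<^sup>2) * indicator {0<..<T} \<tau> * (?P * ?P) \<partial>lborel)"
      by (intro nn_integral_mono D_le)
    then show "(\<integral>\<^sup>+w. ennreal (?H n w) \<partial>?M) < \<infinity>" unfolding HJ using fin by (rule le_less_trans)
  qed (simp add: d_nonneg)
  have "(LINT w|?M. norm (?H n w)) = enn2real (\<integral>\<^sup>+\<tau>. D n \<tau> \<partial>lborel)" for n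
  proof -
    have "(LINT w|?M. norm (?H n w)) = (LINT w|?M. ?H n w)" by (simp add: d_nonneg)
    also have "\<dots> = enn2real (\<integral>\<^sup>+w. ennreal (?H n w) \<partial>?M)"
      by (rule integral_eq_nn_integral[OF Hm]) (simp add: d_nonneg)
    finally show ?thesis by (simp only: HJ)
  qed
  moreover have "(\<lambda>n. enn2real (\<integral>\<^sup>+\<tau>. D n \<tau> \<partial>lborel)) \<longlonglongrightarrow> 0"
    by (intro tendsto_enn2real) (use J in auto)
  ultimately have "(\<lambda>n. LINT w|?M. norm (?H n w)) \<longlonglongrightarrow> 0" by simp
  from tendsto_L1_AE_subseq[OF Hi this]
  obtain r where r: "strict_mono r" "AE w in ?M. (\<lambda>n. ?H (r n) w) \<longlonglongrightarrow> 0" by blast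
  have "AE v in lborel. AE z in lborel \<Otimes>\<^sub>M lborel. (\<lambda>n. ?H (r n) (v, z)) \<longlonglongrightarrow> 0"
    by (rule pair_sigma_finite.AE_pair[OF pair_sigma_finite.intro[OF lborel.sigma_finite_measure_axioms sf] r(2)])
  then have "AE v in lborel. AE \<tau> in lborel. AE u in lborel. (\<lambda>n. d (r n) v \<tau> u) \<longlonglongrightarrow> 0"
  proof eventually_elim
    case (elim v)
    from lborel_pair.AE_pair[OF elim] show ?case by simp
  qed
  then have "AE v in lborel. AE \<tau> in lborel. AE u in lborel. 0 < \<tau> \<and> \<tau> < t0 \<longrightarrow>
       (\<lambda>n. f \<tau> (x' (r n) - (t' (r n) - \<tau>) *\<^sub>R v) u - f \<tau> (x (r n) - (t (r n) - \<tau>) *\<^sub>R v) u) \<longlonglongrightarrow> 0"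
  proof eventually_elim
    case (elim v)
    then show ?case
    proof eventually_elim
      case (elim \<tau>)
      then show ?case
      proof (eventually_elim, intro impI)
        fix u assume d0: "(\<lambda>n. d (r n) v \<tau> u) \<longlonglongrightarrow> 0" and \<tau>: "0 < \<tau> \<and> \<tau> < t0"
        let ?e = "\<lambda>n. f \<tau> (x' (r n) - (t' (r n) - \<tau>) *\<^sub>R v) u - f \<tau> (x (r n) - (t (r n) - \<tau>) *\<^sub>R v) u"
        have w: "0 < p v * p u" using p_pos by simp
        have tr: "(\<lambda>n. t (r n)) \<longlonglongrightarrow> t0" "(\<lambda>n. t' (r n)) \<longlonglongrightarrow> t0"
          using LIMSEQ_subseq_LIMSEQ[OF t(1) r(1)] LIMSEQ_subseq_LIMSEQ[OF t'(1) r(1)] by (auto simp: o_def)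
        have "\<forall>\<^sub>F n in sequentially. d (r n) v \<tau> u / (p v * p u) = (?e n)\<^sup>2"
          using order_tendstoD(1)[OF tr(1) conjunct2[OF \<tau>]] order_tendstoD(1)[OF tr(2) conjunct2[OF \<tau>]]
          by eventually_elim (use \<tau> p_pos[of u] p_pos[of v] in \<open>auto simp: d_def\<close>)
        moreover have "(\<lambda>n. d (r n) v \<tau> u / (p v * p u)) \<longlonglongrightarrow> 0"
          unfolding divide_inverse by (rule tendsto_mult_left_zero[OF d0])
        ultimately have "(\<lambda>n. (?e n)\<^sup>2) \<longlonglongrightarrow> 0" by (rule Lim_transform_eventually[rotated])
        then have "(\<lambda>n. sqrt ((?e n)\<^sup>2)) \<longlonglongrightarrow> sqrt 0" by (rule tendsto_real_sqrt)
        then show "?e \<longlonglongrightarrow> 0" by (simp add: tendsto_rabs_zero_iff)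
      qed
    qed
  qed
  with r(1) show ?thesis by (rule that)
qed

end

section \<open>Continuity of the moments\<close>

lemma tendsto_zero_if_subsequences:
  fixes d :: "nat \<Rightarrow> real"
  assumes "\<And>s :: nat \<Rightarrow> nat. strict_mono s \<Longrightarrow> \<exists>r :: nat \<Rightarrow> nat. strict_mono r \<and> (\<lambda>n. d (s (r n))) \<longlonglongrightarrow> 0"
  shows "d \<longlonglongrightarrow> 0"
proof (rule ccontr)
  assume "\<not> d \<longlonglongrightarrow> 0"
  then obtain e where e: "0 < e" "\<not> (\<forall>\<^sub>F n in sequentially. \<bar>d n\<bar> < e)"
    by (auto simp: tendsto_iff)
  have "infinite {n. e \<le> \<bar>d n\<bar>}"
  proof
    assume "finite {n. e \<le> \<bar>d n\<bar>}"
    from finite_nat_bounded[OF this] obtain m where m: "{n. e \<le> \<bar>d n\<bar>} \<subseteq> {..<m}" by blast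
    have "\<bar>d n\<bar> < e" if "m \<le> n" for n
    proof (rule ccontr)
      assume "\<not> \<bar>d n\<bar> < e"
      then have "n \<in> {..<m}" by (intro subsetD[OF m]) simp
      with that show False by simp
    qed
    then have "\<forall>n\<ge>m. \<bar>d n\<bar> < e" by blast
    then show False using e(2) by (auto simp: eventually_sequentially)
  qed
  then obtain s :: "nat \<Rightarrow> nat" where s: "strict_mono s" "\<And>n. e \<le> \<bar>d (s n)\<bar>"
    using infinite_enumerate by (metis mem_Collect_eq)
  obtain r :: "nat \<Rightarrow> nat" where r: "(\<lambda>n. d (s (r n))) \<longlonglongrightarrow> 0" using assms[OF s(1)] by blast
  have "\<forall>\<^sub>F n in sequentially. \<bar>d (s (r n))\<bar> < e" using order_tendstoD(2)[OF tendsto_rabs_zero[OF r] e(1)] .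
  then obtain n where "\<bar>d (s (r n))\<bar> < e" by (auto simp: eventually_sequentially)
  then show False using s(2)[of "r n"] by simp
qed

text \<open>
  The uniform continuity hypothesis on the initial datum controls bounded sets of velocities, and
  the decay of the datum controls the rest.
\<close>

lemma initial_datum_mean_continuity:
  fixes F\<^sub>0 :: "real^3 \<Rightarrow> real^3 \<Rightarrow> real" and P :: "real^3 \<Rightarrow> real"
  assumes F0_measurable: "(\<lambda>(x, v). F\<^sub>0 x v) \<in> borel_measurable borel"
    and P: "integrable lborel P" and F0_le: "\<And>y v. \<bar>F\<^sub>0 y v\<bar> \<le> P v"
    and F0_uniform:
      "\<And>K. \<lbrakk>bounded K; K \<in> sets borel\<rbrakk> \<Longrightarrow>
        ((\<lambda>(\<sigma>, \<delta>). SUP (x, t)\<in>UNIV \<times> {t\<^sub>1..T}. LINT v:K|lborel.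
            \<bar>F\<^sub>0 (x + \<delta> - (t + \<sigma>) *\<^sub>R v) v - F\<^sub>0 (x - t *\<^sub>R v) v\<bar>) \<longlongrightarrow> 0) (at (0, 0))"
    and t: "\<And>n. t n \<in> {t\<^sub>1..T}"
    and tt: "(\<lambda>n. t' n - t n) \<longlonglongrightarrow> 0" and xx: "(\<lambda>n. x' n - x n) \<longlonglongrightarrow> 0"
  shows "(\<lambda>n. LINT v|lborel. \<bar>F\<^sub>0 (x' n - t' n *\<^sub>R v) v - F\<^sub>0 (x n - t n *\<^sub>R v) v\<bar>) \<longlonglongrightarrow> 0"
proof -
  have m: "(\<lambda>z. F\<^sub>0 (fst z) (snd z)) \<in> borel_measurable (borel \<Otimes>\<^sub>M borel)"
    using F0_measurable by (simp add: borel_prod case_prod_beta')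
  have [measurable]: "(\<lambda>v. F\<^sub>0 (y - s *\<^sub>R v) v) \<in> borel_measurable borel" for y s
    using measurable_compose[OF _ m, of "\<lambda>v. (y - s *\<^sub>R v, v)" borel] by simp
  define d where "d y s y' s' v = \<bar>F\<^sub>0 (y' - s' *\<^sub>R v) v - F\<^sub>0 (y - s *\<^sub>R v) v\<bar>" for y s y' s' v
  have [measurable]: "d y s y' s' \<in> borel_measurable borel" for y s y' s' unfolding d_def by measurable
  have d_le: "d y s y' s' v \<le> 2 * P v" "0 \<le> d y s y' s' v" for y s y' s' v
    using F0_le[of "y' - s' *\<^sub>R v" v] F0_le[of "y - s *\<^sub>R v" v] by (auto simp: d_def)
  have P0: "0 \<le> P v" for v using F0_le[of undefined v] by linarith
  have i2P: "integrable lborel (\<lambda>v. 2 * P v)" using P by simp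
  have di: "integrable lborel (d y s y' s')" for y s y' s'
  proof (rule Bochner_Integration.integrable_bound[OF i2P])
    have "norm (d y s y' s' v) \<le> norm (2 * P v)" for v
      unfolding real_norm_def using d_le(1)[of y s y' s' v] d_le(2)[of y s y' s' v] by linarith
    then show "AE v in lborel. norm (d y s y' s' v) \<le> norm (2 * P v)" by (rule AE_I2)
  qed measurable
  have dKi: "integrable lborel (\<lambda>v. indicator K v * d y s y' s' v)" if "K \<in> sets borel" for K y s y' s'
    using integrable_mult_indicator[OF _ di, of K y s y' s'] that by simp
  have PKi: "integrable lborel (\<lambda>v. indicator K v * (2 * P v))" if "K \<in> sets borel" for K
    using integrable_mult_indicator[OF _ i2P, of K] that by simp
  show ?thesis
  proof (rule order_tendstoI)
    fix e :: real assume e: "0 < e"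
    \<comment> \<open>a radius beyond which the decay of the data alone gives half of \<open>e\<close>\<close>
    have "(\<lambda>k. LINT v|lborel. indicator (- cball 0 (real k)) v * (2 * P v)) \<longlonglongrightarrow> (LINT v|(lborel :: (real^3) measure). 0)"
    proof (rule integral_dominated_convergence[where w="\<lambda>v. 2 * P v"])
      show "AE v in lborel. (\<lambda>k. indicator (- cball 0 (real k)) v * (2 * P v)) \<longlonglongrightarrow> 0"
      proof (rule AE_I2)
        fix v :: "real^3"
        obtain m :: nat where "norm v \<le> real m" using real_arch_simple by blast
        then have "\<forall>\<^sub>F k in sequentially. indicator (- cball 0 (real k)) v * (2 * P v) = 0"
          by (auto simp: eventually_sequentially intro!: exI[of _ m])
        then show "(\<lambda>k. indicator (- cball 0 (real k)) v * (2 * P v)) \<longlonglongrightarrow> 0" by (rule tendsto_eventually)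
      qed
    qed (use P P0 in \<open>auto simp: indicator_def\<close>)
    then have "\<forall>\<^sub>F k in sequentially. (LINT v|lborel. indicator (- cball 0 (real k)) v * (2 * P v)) < e/2"
      using e by (intro order_tendstoD) auto
    then obtain k where k: "(LINT v|lborel. indicator (- cball 0 (real k)) v * (2 * P v)) < e/2"
      by (auto simp: eventually_sequentially)
    let ?K = "cball (0::real^3) (real k)"
    define \<Phi> where "\<Phi> = (\<lambda>(\<sigma>, \<delta>). SUP (x, t)\<in>UNIV \<times> {t\<^sub>1..T}. LINT v:?K|lborel.
            \<bar>F\<^sub>0 (x + \<delta> - (t + \<sigma>) *\<^sub>R v) v - F\<^sub>0 (x - t *\<^sub>R v) v\<bar>)"
    have "(\<Phi> \<longlongrightarrow> 0) (at (0, 0))" unfolding \<Phi>_def by (rule F0_uniform) auto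
    \<comment> \<open>the filter of the hypothesis omits \<open>(0, 0)\<close>, which the sequence may hit\<close>
    moreover have "\<Phi> (0, 0) = 0"
      using t[of 0] by (auto simp: \<Phi>_def set_lebesgue_integral_def case_prod_beta' cSUP_const intro!: cSUP_const)
    ultimately have "isCont \<Phi> (0, 0)" by (simp add: isCont_def)
    moreover have "(\<lambda>n. (t' n - t n, x' n - x n)) \<longlonglongrightarrow> (0, 0)" using tt xx by (intro tendsto_intros)
    ultimately have "(\<lambda>n. \<Phi> (t' n - t n, x' n - x n)) \<longlonglongrightarrow> \<Phi> (0, 0)" by (rule isCont_tendsto_compose)
    then have "\<forall>\<^sub>F n in sequentially. \<Phi> (t' n - t n, x' n - x n) < e/2"
      using e \<open>\<Phi> (0, 0) = 0\<close> by (intro order_tendstoD(2)) auto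
    then show "\<forall>\<^sub>F n in sequentially. (LINT v|lborel. \<bar>F\<^sub>0 (x' n - t' n *\<^sub>R v) v - F\<^sub>0 (x n - t n *\<^sub>R v) v\<bar>) < e"
    proof eventually_elim
      case (elim n)
      let ?S = "\<lambda>(y, s). LINT v:?K|lborel. \<bar>F\<^sub>0 (y + (x' n - x n) - (s + (t' n - t n)) *\<^sub>R v) v - F\<^sub>0 (y - s *\<^sub>R v) v\<bar>"
      have bdd: "bdd_above (?S ` (UNIV \<times> {t\<^sub>1..T}))"
      proof (rule bdd_aboveI2)
        fix z :: "(real^3) \<times> real"
        have "?S z = (LINT v|lborel. indicator ?K v * d (fst z) (snd z) (fst z + (x' n - x n)) (snd z + (t' n - t n)) v)"
          by (simp add: set_lebesgue_integral_def d_def case_prod_beta')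
        also have "\<dots> \<le> (LINT v|lborel. 2 * P v)"
          using d_le P0 by (intro integral_mono dKi i2P) (simp_all add: indicator_def)
        finally show "?S z \<le> (LINT v|lborel. 2 * P v)" .
      qed
      have "?S (x n, t n) \<le> (SUP z\<in>UNIV \<times> {t\<^sub>1..T}. ?S z)"
        using t[of n] by (intro cSUP_upper bdd) auto
      also have "(SUP z\<in>UNIV \<times> {t\<^sub>1..T}. ?S z) = \<Phi> (t' n - t n, x' n - x n)" by (simp add: \<Phi>_def)
      finally have "?S (x n, t n) < e/2" using elim by simp
      then have inner: "(LINT v|lborel. indicator ?K v * d (x n) (t n) (x' n) (t' n) v) < e/2"
        by (simp add: set_lebesgue_integral_def d_def)
      have "(LINT v|lborel. d (x n) (t n) (x' n) (t' n) v)
         \<le> (LINT v|lborel. indicator ?K v * d (x n) (t n) (x' n) (t' n) v + indicator (- ?K) v * (2 * P v))"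
        using d_le by (intro integral_mono di Bochner_Integration.integrable_add dKi PKi) (simp_all add: indicator_def)
      also have "\<dots> = (LINT v|lborel. indicator ?K v * d (x n) (t n) (x' n) (t' n) v) + (LINT v|lborel. indicator (- ?K) v * (2 * P v))"
        by (intro Bochner_Integration.integral_add dKi PKi) simp_all
      also have "\<dots> < e" using inner k by linarith
      finally show ?case by (simp add: d_def)
    qed
  next
    fix y :: real assume "y < 0"
    moreover have "0 \<le> (LINT v|lborel. \<bar>F\<^sub>0 (x' n - t' n *\<^sub>R v) v - F\<^sub>0 (x n - t n *\<^sub>R v) v\<bar>)" for n by simp
    ultimately show "\<forall>\<^sub>F n in sequentially. y < (LINT v|lborel. \<bar>F\<^sub>0 (x' n - t' n *\<^sub>R v) v - F\<^sub>0 (x n - t n *\<^sub>R v) v\<bar>)"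
      by (intro always_eventually allI) (rule less_le_trans)
  qed
qed

context bounded_profile
begin

definition majorant :: "real \<Rightarrow> real^3 \<Rightarrow> real" where
  "majorant C v = C * p v + (LINT \<tau>:{0<..<T}|lborel. (a \<tau>)\<^sup>2) * enn2real (\<Gamma> v)"

lemma integrable_p: "integrable lborel p"
  using nn_integral_p_finite p_pos by (intro integrableI_nonneg) (auto simp: less_imp_le)

lemma integrable_majorant: "integrable lborel (\<lambda>v. (1 + (norm v)\<^sup>2) * majorant C v)"
proof -
  have 1: "integrable lborel (\<lambda>v. p v * (1 + (norm v)\<^sup>2))"
    using nn_integral_p_moment p_pos by (intro integrableI_nonneg) (auto simp: less_imp_le)
  have 2: "integrable lborel (\<lambda>v. enn2real (\<Gamma> v) * (1 + (norm v)\<^sup>2))"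
  proof (rule integrableI_nonneg)
    have "(\<integral>\<^sup>+v. ennreal (enn2real (\<Gamma> v) * (1 + (norm v)\<^sup>2)) \<partial>lborel) \<le> (\<integral>\<^sup>+v. \<Gamma> v * ennreal (1 + (norm v)\<^sup>2) \<partial>lborel)"
    proof (rule nn_integral_mono)
      fix v
      have "ennreal (enn2real (\<Gamma> v)) \<le> \<Gamma> v" by (cases "\<Gamma> v") auto
      from mult_right_mono[OF this, of "ennreal (1 + (norm v)\<^sup>2)"]
      show "ennreal (enn2real (\<Gamma> v) * (1 + (norm v)\<^sup>2)) \<le> \<Gamma> v * ennreal (1 + (norm v)\<^sup>2)"
        by (simp add: ennreal_mult del: ennreal_enn2real_if)
    qed
    then show "(\<integral>\<^sup>+v. ennreal (enn2real (\<Gamma> v) * (1 + (norm v)\<^sup>2)) \<partial>lborel) < \<infinity>"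
      using nn_integral_\<Gamma>_moment by (rule le_less_trans)
  qed auto
  let ?c = "LINT \<tau>:{0<..<T}|lborel. (a \<tau>)\<^sup>2"
  have "(\<lambda>v. (1 + (norm v)\<^sup>2) * majorant C v) =
      (\<lambda>v. C * (p v * (1 + (norm v)\<^sup>2)) + ?c * (enn2real (\<Gamma> v) * (1 + (norm v)\<^sup>2)))"
    by (rule ext) (simp add: majorant_def algebra_simps)
  then show ?thesis using 1 2 by simp
qed

text \<open>
  The majorant does not depend on the point \<open>(t, x)\<close>; this makes the velocity tails uniformly small.
\<close>

lemma AE_le_majorant:
  assumes F: "AE v in lborel. F v = duhamel F\<^sub>0 t x v" and t: "t \<le> T"
    and F0: "\<And>y v. \<bar>F\<^sub>0 y v\<bar> \<le> C * p v"
  shows "AE v in lborel. \<bar>F v\<bar> \<le> majorant C v"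
  using F AE_\<Gamma>_finite
proof eventually_elim
  case (elim v)
  then show ?case
    using duhamel_bound[OF elim(2) t, of F\<^sub>0 x] F0[of "x - t *\<^sub>R v" v] by (simp add: majorant_def)
qed

lemma integrable_below_majorant:
  assumes [measurable]: "g \<in> borel_measurable borel" and "AE v in lborel. \<bar>g v\<bar> \<le> majorant C v"
  shows "integrable lborel (\<lambda>v. (1 + (norm v)\<^sup>2) * \<bar>g v\<bar>)"
proof (rule Bochner_Integration.integrable_bound[OF integrable_majorant[of C]])
  show "AE v in lborel. norm ((1 + (norm v)\<^sup>2) * \<bar>g v\<bar>) \<le> norm ((1 + (norm v)\<^sup>2) * majorant C v)"
    using assms(2) by eventually_elim (auto simp: abs_mult intro!: mult_left_mono)
qed measurable

text \<open>
  Along a subsequence the times converge, the initial data converge almost everywhere, and so do the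
  profiles along the characteristics; then the solution converges for almost every velocity, below
  a fixed function with finite second moment.
\<close>

lemma weighted_mean_continuity:
  fixes F :: "real \<Rightarrow> real^3 \<Rightarrow> real^3 \<Rightarrow> real" and F\<^sub>0 :: "real^3 \<Rightarrow> real^3 \<Rightarrow> real" and c :: real
  assumes F_measurable: "\<And>t x. t \<in> {t\<^sub>1..T} \<Longrightarrow> F t x \<in> borel_measurable borel"
    and F_eq: "\<And>t x. t \<in> {t\<^sub>1..T} \<Longrightarrow> AE v in lborel. F t x v = duhamel F\<^sub>0 t x v"
    and L2: "AE \<tau> in lborel. 0 < \<tau> \<and> \<tau> < T \<longrightarrow>
      integrable lborel (\<lambda>z. (f \<tau> (fst z) (snd z) - c * maxwellian (snd z))\<^sup>2)"
    and F0_measurable: "(\<lambda>(x, v). F\<^sub>0 x v) \<in> borel_measurable borel"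
    and F0: "\<And>y v. \<bar>F\<^sub>0 y v\<bar> \<le> C * p v"
    and F0_uniform:
      "\<And>K. \<lbrakk>bounded K; K \<in> sets borel\<rbrakk> \<Longrightarrow>
        ((\<lambda>(\<sigma>, \<delta>). SUP (x, t)\<in>UNIV \<times> {t\<^sub>1..T}. LINT v:K|lborel.
            \<bar>F\<^sub>0 (x + \<delta> - (t + \<sigma>) *\<^sub>R v) v - F\<^sub>0 (x - t *\<^sub>R v) v\<bar>) \<longlongrightarrow> 0) (at (0, 0))"
    and t: "\<And>n. t n \<in> {t\<^sub>1..T}" and t': "\<And>n. t' n \<in> {t\<^sub>1..T}"
    and tt: "(\<lambda>n. t' n - t n) \<longlonglongrightarrow> 0" and xx: "(\<lambda>n. x' n - x n) \<longlonglongrightarrow> 0"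
  shows "(\<lambda>n. LINT v|lborel. (1 + (norm v)\<^sup>2) * \<bar>F (t' n) (x' n) v - F (t n) (x n) v\<bar>) \<longlonglongrightarrow> 0"
proof (rule tendsto_zero_if_subsequences)
  fix s :: "nat \<Rightarrow> nat" assume s: "strict_mono s"
  have "compact {t\<^sub>1..T}" by simp
  then obtain t0 and r1 :: "nat \<Rightarrow> nat" where r1: "strict_mono r1" "((t \<circ> s) \<circ> r1) \<longlonglongrightarrow> t0"
    using t unfolding compact_def by (metis comp_apply)
  define s1 where "s1 = s \<circ> r1"
  have s1: "strict_mono s1" unfolding s1_def using s r1(1) by (rule strict_mono_o)
  have t1: "(\<lambda>n. t (s1 n)) \<longlonglongrightarrow> t0" using r1(2) by (simp add: s1_def o_def)
  have sub: "(\<lambda>n. w (k n)) \<longlonglongrightarrow> l" if "w \<longlonglongrightarrow> l" "strict_mono k" for w :: "nat \<Rightarrow> 'z::topological_space" and k :: "nat \<Rightarrow> nat" and l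
    using LIMSEQ_subseq_LIMSEQ[OF that] by (simp add: o_def)
  have tt1: "(\<lambda>n. t' (s1 n) - t (s1 n)) \<longlonglongrightarrow> 0" by (rule sub[OF tt s1])
  have xx1: "(\<lambda>n. x' (s1 n) - x (s1 n)) \<longlonglongrightarrow> 0" by (rule sub[OF xx s1])
  have t1': "(\<lambda>n. t' (s1 n)) \<longlonglongrightarrow> t0" using tendsto_add[OF tt1 t1] by simp
  let ?dF0 = "\<lambda>n v. F\<^sub>0 (x' n - t' n *\<^sub>R v) v - F\<^sub>0 (x n - t n *\<^sub>R v) v"
  have iP: "integrable lborel (\<lambda>v. C * p v)" using integrable_p by simp
  have mF0: "(\<lambda>z. F\<^sub>0 (fst z) (snd z)) \<in> borel_measurable (borel \<Otimes>\<^sub>M borel)"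
    using F0_measurable by (simp add: borel_prod case_prod_beta')
  have [measurable]: "(\<lambda>v. F\<^sub>0 (y - s *\<^sub>R v) v) \<in> borel_measurable borel" for y s
    using measurable_compose[OF _ mF0, of "\<lambda>v. (y - s *\<^sub>R v, v)" borel] by simp
  have iF0: "integrable lborel (?dF0 n)" for n
  proof (rule Bochner_Integration.integrable_bound)
    show "integrable lborel (\<lambda>v. 2 * (C * p v))" using iP by simp
    show "AE v in lborel. norm (?dF0 n v) \<le> norm (2 * (C * p v))"
    proof (rule AE_I2)
      fix v
      show "norm (?dF0 n v) \<le> norm (2 * (C * p v))"
        using F0[of "x' n - t' n *\<^sub>R v" v] F0[of "x n - t n *\<^sub>R v" v] by simp
    qed
  qed measurable
  have "(\<lambda>n. LINT v|lborel. \<bar>?dF0 (s1 n) v\<bar>) \<longlonglongrightarrow> 0"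
    by (rule initial_datum_mean_continuity[OF F0_measurable iP F0 F0_uniform t tt1 xx1])
  then have "(\<lambda>n. LINT v|lborel. norm (?dF0 (s1 n) v)) \<longlonglongrightarrow> 0" by simp
  from tendsto_L1_AE_subseq[OF iF0 this]
  obtain r2 where r2: "strict_mono r2" "AE v in lborel. (\<lambda>n. ?dF0 (s1 (r2 n)) v) \<longlonglongrightarrow> 0" by blast
  define s2 where "s2 n = s1 (r2 n)" for n
  have l2: "(\<lambda>n. t (s2 n)) \<longlonglongrightarrow> t0" "(\<lambda>n. t' (s2 n)) \<longlonglongrightarrow> t0" "(\<lambda>n. x' (s2 n) - x (s2 n)) \<longlonglongrightarrow> 0"
    unfolding s2_def using sub[OF t1 r2(1)] sub[OF t1' r2(1)] sub[OF xx1 r2(1)] by auto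
  have tT: "t n \<le> T" "t' n \<le> T" for n using t[of n] t'[of n] by auto
  obtain r3 :: "nat \<Rightarrow> nat" where r3: "strict_mono r3"
    "AE v in lborel. AE \<tau> in lborel. AE u in lborel. 0 < \<tau> \<and> \<tau> < t0 \<longrightarrow>
       (\<lambda>n. f \<tau> (x' (s2 (r3 n)) - (t' (s2 (r3 n)) - \<tau>) *\<^sub>R v) u - f \<tau> (x (s2 (r3 n)) - (t (s2 (r3 n)) - \<tau>) *\<^sub>R v) u) \<longlonglongrightarrow> 0"
    by (rule AE_subsequence_along_characteristics[OF L2 l2(1) tT(1) l2(2) tT(2) l2(3)])
  define k where "k n = s2 (r3 n)" for n
  let ?D = "\<lambda>n v. F (t' n) (x' n) v - F (t n) (x n) v"
  have lk: "(\<lambda>n. t (k n)) \<longlonglongrightarrow> t0" "(\<lambda>n. t' (k n)) \<longlonglongrightarrow> t0"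
    unfolding k_def using sub[OF l2(1) r3(1)] sub[OF l2(2) r3(1)] by auto
  have "AE v in lborel. \<forall>n. F (t n) (x n) v = duhamel F\<^sub>0 (t n) (x n) v"
    "AE v in lborel. \<forall>n. F (t' n) (x' n) v = duhamel F\<^sub>0 (t' n) (x' n) v"
    using F_eq t t' by (auto simp: AE_all_countable)
  then have lim: "AE v in lborel. (\<lambda>n. ?D (k n) v) \<longlonglongrightarrow> 0"
    using AE_\<Gamma>_finite r2(2) r3(2)
  proof eventually_elim
    case (elim v)
    have "(\<lambda>n. ?dF0 (k n) v) \<longlonglongrightarrow> 0"
      using sub[OF elim(4) r3(1)] by (simp add: k_def s2_def)
    moreover have "AE \<tau> in lborel. AE u in lborel. 0 < \<tau> \<and> \<tau> < t0 \<longrightarrow>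
       (\<lambda>n. f \<tau> (x' (k n) - (t' (k n) - \<tau>) *\<^sub>R v) u - f \<tau> (x (k n) - (t (k n) - \<tau>) *\<^sub>R v) u) \<longlonglongrightarrow> 0"
      using elim(5) by (simp add: k_def)
    ultimately have "(\<lambda>n. duhamel F\<^sub>0 (t' (k n)) (x' (k n)) v - duhamel F\<^sub>0 (t (k n)) (x (k n)) v) \<longlonglongrightarrow> 0"
      by (intro duhamel_diff_tendsto[OF elim(3) lk(1) tT(1) lk(2) tT(2) F0])
    then show ?case using elim(1,2) by simp
  qed
  have bd: "AE v in lborel. \<bar>?D n v\<bar> \<le> 2 * majorant C v" for n
    using AE_le_majorant[OF F_eq[OF t[of n], of "x n"] tT(1) F0] AE_le_majorant[OF F_eq[OF t'[of n], of "x' n"] tT(2) F0]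
    by eventually_elim linarith
  have [measurable]: "?D n \<in> borel_measurable borel" for n
    using F_measurable[OF t[of n]] F_measurable[OF t'[of n]] by measurable
  have "(\<lambda>n. LINT v|lborel. (1 + (norm v)\<^sup>2) * \<bar>?D (k n) v\<bar>) \<longlonglongrightarrow> (LINT v|(lborel :: (real^3) measure). 0)"
  proof (rule integral_dominated_convergence[where w="\<lambda>v. 2 * ((1 + (norm v)\<^sup>2) * majorant C v)"])
    show "integrable lborel (\<lambda>v. 2 * ((1 + (norm v)\<^sup>2) * majorant C v))" using integrable_majorant by simp
    show "AE v in lborel. norm ((1 + (norm v)\<^sup>2) * \<bar>?D (k n) v\<bar>) \<le> 2 * ((1 + (norm v)\<^sup>2) * majorant C v)" for n
      using bd[of "k n"]
    proof eventually_elim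
      case (elim v)
      have "(1 + (norm v)\<^sup>2) * \<bar>?D (k n) v\<bar> \<le> (1 + (norm v)\<^sup>2) * (2 * majorant C v)"
        using elim by (intro mult_left_mono) auto
      then show ?case by (simp add: abs_mult)
    qed
    show "AE v in lborel. (\<lambda>n. (1 + (norm v)\<^sup>2) * \<bar>?D (k n) v\<bar>) \<longlonglongrightarrow> 0"
      using lim by eventually_elim (intro tendsto_mult_right_zero tendsto_rabs_zero)
  qed measurable
  then have fin: "(\<lambda>n. LINT v|lborel. (1 + (norm v)\<^sup>2) * \<bar>?D (k n) v\<bar>) \<longlonglongrightarrow> 0" by simp
  show "\<exists>r :: nat \<Rightarrow> nat. strict_mono r \<and> (\<lambda>n. LINT v|lborel. (1 + (norm v)\<^sup>2) * \<bar>?D (s (r n)) v\<bar>) \<longlonglongrightarrow> 0"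
  proof (intro exI conjI)
    show "strict_mono (r1 \<circ> (r2 \<circ> r3))" using r1(1) r2(1) r3(1) by (intro strict_mono_o)
    show "(\<lambda>n. LINT v|lborel. (1 + (norm v)\<^sup>2) * \<bar>?D (s ((r1 \<circ> (r2 \<circ> r3)) n)) v\<bar>) \<longlonglongrightarrow> 0"
      using fin by (simp add: k_def s2_def s1_def)
  qed
qed

end

lemma moment_uniformly_continuous:
  fixes F :: "real \<Rightarrow> real^3 \<Rightarrow> real^3 \<Rightarrow> real" and m :: "real^3 \<Rightarrow> 'b::{banach, second_countable_topology}"
  assumes F_measurable: "\<And>t x. t \<in> I \<Longrightarrow> F t x \<in> borel_measurable borel"
    and m [measurable]: "m \<in> borel_measurable borel" and m_le: "\<And>v. norm (m v) \<le> 1 + (norm v)\<^sup>2"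
    and int: "\<And>t x. t \<in> I \<Longrightarrow> integrable lborel (\<lambda>v. (1 + (norm v)\<^sup>2) * \<bar>F t x v\<bar>)"
    and cont: "\<And>t t' x x'. \<lbrakk>\<And>n. t n \<in> I; \<And>n. t' n \<in> I; (\<lambda>n. t' n - t n) \<longlonglongrightarrow> 0; (\<lambda>n. x' n - x n) \<longlonglongrightarrow> 0\<rbrakk> \<Longrightarrow>
        (\<lambda>n. LINT v|lborel. (1 + (norm v)\<^sup>2) * \<bar>F (t' n) (x' n) v - F (t n) (x n) v\<bar>) \<longlonglongrightarrow> 0"
  shows "\<And>t x. t \<in> I \<Longrightarrow> integrable lborel (\<lambda>v. F t x v *\<^sub>R m v)"
    "uniformly_continuous_on (UNIV \<times> I) (\<lambda>(x, t). LINT v|lborel. F t x v *\<^sub>R m v)"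
proof -
  have le: "norm (s *\<^sub>R m v) \<le> (1 + (norm v)\<^sup>2) * \<bar>s\<bar>" for s v
    using mult_right_mono[OF m_le[of v], of "\<bar>s\<bar>"] by (simp add: mult.commute)
  show i: "integrable lborel (\<lambda>v. F t x v *\<^sub>R m v)" if t: "t \<in> I" for t x
  proof (rule Bochner_Integration.integrable_bound[OF int[OF t, of x]])
    show "(\<lambda>v. F t x v *\<^sub>R m v) \<in> borel_measurable lborel" using F_measurable[OF t, of x] by measurable
    show "AE v in lborel. norm (F t x v *\<^sub>R m v) \<le> norm ((1 + (norm v)\<^sup>2) * \<bar>F t x v\<bar>)"
      using le by (intro AE_I2) (simp add: abs_mult)
  qed
  have diff: "norm ((LINT v|lborel. F t' x' v *\<^sub>R m v) - (LINT v|lborel. F t x v *\<^sub>R m v))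
      \<le> (LINT v|lborel. (1 + (norm v)\<^sup>2) * \<bar>F t' x' v - F t x v\<bar>)" if t: "t \<in> I" and t': "t' \<in> I" for t t' x x'
  proof -
    have [measurable]: "F t x \<in> borel_measurable borel" "F t' x' \<in> borel_measurable borel"
      using t t' F_measurable by auto
    have "(LINT v|lborel. F t' x' v *\<^sub>R m v) - (LINT v|lborel. F t x v *\<^sub>R m v) = (LINT v|lborel. F t' x' v *\<^sub>R m v - F t x v *\<^sub>R m v)"
      using i t t' by (intro Bochner_Integration.integral_diff[symmetric]) auto
    also have "\<dots> = (LINT v|lborel. (F t' x' v - F t x v) *\<^sub>R m v)" by (simp only: scaleR_diff_left)
    also have "norm \<dots> \<le> (LINT v|lborel. (1 + (norm v)\<^sup>2) * \<bar>F t' x' v - F t x v\<bar>)"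
    proof (rule Bochner_Integration.integral_norm_bound_integral)
      show "integrable lborel (\<lambda>v. (F t' x' v - F t x v) *\<^sub>R m v)"
        using i[OF t, of x] i[OF t', of x'] by (simp add: scaleR_diff_left)
      have "integrable lborel (\<lambda>v. (1 + (norm v)\<^sup>2) * \<bar>F t' x' v\<bar> + (1 + (norm v)\<^sup>2) * \<bar>F t x v\<bar>)"
        using int[OF t, of x] int[OF t', of x'] by (intro Bochner_Integration.integrable_add)
      then show "integrable lborel (\<lambda>v. (1 + (norm v)\<^sup>2) * \<bar>F t' x' v - F t x v\<bar>)"
      proof (rule Bochner_Integration.integrable_bound)
        have "(1 + (norm v)\<^sup>2) * \<bar>F t' x' v - F t x v\<bar> \<le> (1 + (norm v)\<^sup>2) * (\<bar>F t' x' v\<bar> + \<bar>F t x v\<bar>)" for v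
          by (intro mult_left_mono abs_triangle_ineq4) auto
        then show "AE v in lborel. norm ((1 + (norm v)\<^sup>2) * \<bar>F t' x' v - F t x v\<bar>)
            \<le> norm ((1 + (norm v)\<^sup>2) * \<bar>F t' x' v\<bar> + (1 + (norm v)\<^sup>2) * \<bar>F t x v\<bar>)"
          by (intro AE_I2) (simp add: abs_mult distrib_left)
      qed measurable
    qed (rule le)
    finally show ?thesis .
  qed
  show "uniformly_continuous_on (UNIV \<times> I) (\<lambda>(x, t). LINT v|lborel. F t x v *\<^sub>R m v)"
    unfolding uniformly_continuous_on_sequentially
  proof (intro allI impI, elim conjE)
    fix X Y :: "nat \<Rightarrow> (real^3) \<times> real"
    assume X: "\<forall>n. X n \<in> UNIV \<times> I" and Y: "\<forall>n. Y n \<in> UNIV \<times> I" and XY: "(\<lambda>n. dist (X n) (Y n)) \<longlonglongrightarrow> 0"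
    have tI: "snd (X n) \<in> I" "snd (Y n) \<in> I" for n using X Y by (auto simp: mem_Times_iff)
    have "(\<lambda>n. snd (X n) - snd (Y n)) \<longlonglongrightarrow> 0"
      by (rule Lim_null_comparison[OF always_eventually XY]) (metis dist_norm dist_snd_le)
    moreover have "(\<lambda>n. fst (X n) - fst (Y n)) \<longlonglongrightarrow> 0"
      by (rule Lim_null_comparison[OF always_eventually XY]) (metis dist_norm dist_fst_le)
    ultimately have "(\<lambda>n. LINT v|lborel. (1 + (norm v)\<^sup>2) * \<bar>F (snd (X n)) (fst (X n)) v - F (snd (Y n)) (fst (Y n)) v\<bar>) \<longlonglongrightarrow> 0"
      using tI by (intro cont)
    then show "(\<lambda>n. dist (case X n of (x, t) \<Rightarrow> LINT v|lborel. F t x v *\<^sub>R m v) (case Y n of (x, t) \<Rightarrow> LINT v|lborel. F t x v *\<^sub>R m v)) \<longlonglongrightarrow> 0"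
    proof (rule Lim_null_comparison[OF always_eventually, rotated])
      show "\<forall>n. norm (dist (case X n of (x, t) \<Rightarrow> LINT v|lborel. F t x v *\<^sub>R m v) (case Y n of (x, t) \<Rightarrow> LINT v|lborel. F t x v *\<^sub>R m v))
         \<le> (LINT v|lborel. (1 + (norm v)\<^sup>2) * \<bar>F (snd (X n)) (fst (X n)) v - F (snd (Y n)) (fst (Y n)) v\<bar>)"
        using diff[OF tI(2) tI(1)] by (simp add: dist_norm case_prod_beta')
    qed
  qed
qed

section \<open>A bounded representative of the solution\<close>

text \<open>
  Here \<open>g\<close> is meant to be the solution itself, for which the bounds hold almost everywhere only; \<open>f\<close>
  obeys them everywhere.
\<close>

locale profile_representative = bounded_profile \<gamma> \<beta> h f a T + raw: measurable_profile \<gamma> \<beta> h g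
  for \<gamma> \<beta> h f a T g +
  assumes raw_eq: "AE \<tau> in lborel. 0 < \<tau> \<and> \<tau> < T \<longrightarrow> (AE y in lborel. AE u in lborel. g \<tau> y u = f \<tau> y u)"
begin

text \<open>
  Characteristics are null sets, but the characteristics issuing from one point \<open>(t, x)\<close> with all
  velocities fill the space at each time \<open>\<tau> < t\<close>. So two profiles that agree almost everywhere
  agree on almost all of them.
\<close>

lemma AE_raw_duhamel_eq:
  assumes t: "t \<le> T"
  shows "AE v in lborel. raw.duhamel F\<^sub>0 t x v = duhamel F\<^sub>0 t x v"
proof -
  let ?y = "\<lambda>\<tau> v. x - (t - \<tau>) *\<^sub>R v"
  have "AE \<tau> in lborel. AE v in lborel. 0 < \<tau> \<and> \<tau> < t \<longrightarrow> (AE u in lborel. g \<tau> (?y \<tau> v) u = f \<tau> (?y \<tau> v) u)"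
    using raw_eq
  proof eventually_elim
    case (elim \<tau>)
    show ?case
    proof (cases "0 < \<tau> \<and> \<tau> < t")
      case True
      then have "AE y in lborel. AE u in lborel. g \<tau> y u = f \<tau> y u" using elim t by simp
      from AE_lborel_affine[OF this, of "- (t - \<tau>)" x, unfolded scaleR_minus_left add_uminus_conv_diff] True show ?thesis by simp
    next
      case False
      then show ?thesis by blast
    qed
  qed
  moreover have "Measurable.pred (borel \<Otimes>\<^sub>M borel)
      (\<lambda>z. 0 < fst z \<and> fst z < t \<longrightarrow> (AE u in lborel. g (fst z) (?y (fst z) (snd z)) u = f (fst z) (?y (fst z) (snd z)) u))"
  proof -
    have [measurable]: "Measurable.pred (borel \<Otimes>\<^sub>M borel)
      (\<lambda>z. AE u in lborel. g (fst z) (?y (fst z) (snd z)) u = f (fst z) (?y (fst z) (snd z)) u)"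
      by (rule pred_AE_lborel) measurable
    show ?thesis by measurable
  qed
  ultimately have "AE v in lborel. AE \<tau> in lborel. 0 < \<tau> \<and> \<tau> < t \<longrightarrow> (AE u in lborel. g \<tau> (?y \<tau> v) u = f \<tau> (?y \<tau> v) u)"
    by (subst (asm) AE_lborel_swap) auto
  then show ?thesis
  proof eventually_elim
    case (elim v)
    have eq: "AE \<tau> in lborel. 0 < \<tau> \<and> \<tau> < t \<longrightarrow> raw.loss \<tau> (?y \<tau> v) v = loss \<tau> (?y \<tau> v) v \<and> raw.gain \<tau> (?y \<tau> v) v = gain \<tau> (?y \<tau> v) v"
      using elim
    proof eventually_elim
      case (elim \<tau>)
      have "g \<tau> y \<in> borel_measurable borel" "f \<tau> y \<in> borel_measurable borel" for y by measurable
      with elim show ?case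
        unfolding raw.loss_def loss_def raw.gain_def gain_def by (auto intro!: loss_freq_cong_AE Q_gain_cong_AE)
    qed
    have dep: "raw.depletion t x v s = depletion t x v s" if s: "0 \<le> s" for s
      unfolding raw.depletion_def depletion_def set_lebesgue_integral_def
    proof (rule integral_cong_AE)
      show "AE \<tau> in lborel. indicator {s<..<t} \<tau> *\<^sub>R raw.loss \<tau> (?y \<tau> v) v = indicator {s<..<t} \<tau> *\<^sub>R loss \<tau> (?y \<tau> v) v"
        using eq by eventually_elim (use s in \<open>auto simp: indicator_def\<close>)
    qed measurable
    have "(LINT s:{0<..<t}|lborel. exp (- raw.depletion t x v s) * raw.gain s (?y s v) v)
       = (LINT s:{0<..<t}|lborel. exp (- depletion t x v s) * gain s (?y s v) v)"
      unfolding set_lebesgue_integral_def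
    proof (rule integral_cong_AE)
      show "AE s in lborel. indicator {0<..<t} s *\<^sub>R (exp (- raw.depletion t x v s) * raw.gain s (?y s v) v)
         = indicator {0<..<t} s *\<^sub>R (exp (- depletion t x v s) * gain s (?y s v) v)"
        using eq by eventually_elim (auto simp: indicator_def dep)
    qed measurable
    then show ?case by (simp add: raw.duhamel_def duhamel_def dep)
  qed
qed

end

lemma coll_angle_range:
  assumes "norm \<omega> = 1"
  shows "coll_angle u v \<omega> \<in> {0..pi/2}"
proof -
  have "\<bar>(v - u) \<bullet> \<omega>\<bar> \<le> norm (v - u)" using Cauchy_Schwarz_ineq2[of "v - u" \<omega>] assms by simp
  then have "0 \<le> \<bar>(v - u) \<bullet> \<omega>\<bar> / norm (v - u)" "\<bar>(v - u) \<bullet> \<omega>\<bar> / norm (v - u) \<le> 1"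
    by (auto simp: divide_le_eq_1)
  then show ?thesis unfolding coll_angle_def atLeastAtMost_iff by (intro conjI arccos_lbound arccos_le_pi2) linarith+
qed

text \<open>
  The collision angle takes values in \<open>[0, \<pi>/2]\<close>, hence \<open>h\<close> may be replaced by zero elsewhere.
\<close>

lemma collision_integrals_cong_kernel:
  assumes "\<And>\<theta> z. \<theta> \<in> {0..pi/2} \<Longrightarrow> q \<theta> z = q' \<theta> z"
  shows "loss_freq q = loss_freq q'" "Q_gain q = Q_gain q'"
proof -
  have "norm (snd z) = 1" if "z \<in> space phase_measure" for z
    using that by (auto simp: space_pair_measure space_sphere_measure)
  then have eq: "q (coll_angle (fst z) v (snd z)) (v - fst z) = q' (coll_angle (fst z) v (snd z)) (v - fst z)"
    if "z \<in> space phase_measure" for z v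
    using that by (intro assms coll_angle_range)
  show "loss_freq q = loss_freq q'"
    unfolding loss_freq_def case_prod_beta' by (intro ext Bochner_Integration.integral_cong) (simp_all add: eq)
  show "Q_gain q = Q_gain q'"
    unfolding Q_gain_def case_prod_beta' by (intro ext Bochner_Integration.integral_cong) (simp_all add: eq)
qed

text \<open>
  Measurability in time of the norms is needed before anything can be inferred from the integrals
  that define the time norms: the integral of a nonmeasurable function is only a lower integral, and
  its finiteness does not imply finiteness almost everywhere.
\<close>

lemma borel_measurable_Linf_xv:
  assumes "(\<lambda>z. g (fst z) (fst (snd z)) (snd (snd z))) \<in> borel_measurable (borel \<Otimes>\<^sub>M (borel \<Otimes>\<^sub>M borel))"
  shows "(\<lambda>\<tau>::real. Linf_xv (g \<tau>)) \<in> borel_measurable borel"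
proof (rule borel_measurableI_le)
  fix c :: ennreal
  have g: "(\<lambda>z. g (fst z) (fst (snd z)) (snd (snd z))) \<in> borel_measurable (borel \<Otimes>\<^sub>M borel)"
    using assms by (simp add: borel_prod)
  have m: "(\<lambda>z. ennreal \<bar>g \<tau> (fst z) (snd z)\<bar>) \<in> borel_measurable lborel" for \<tau>
    using measurable_compose[OF measurable_Pair1' g, of \<tau>] by simp
  have "Linf_xv (g \<tau>) \<le> c \<longleftrightarrow> (AE z in lborel. ennreal \<bar>g \<tau> (fst z) (snd z)\<bar> \<le> c)" for \<tau>
  proof
    assume "Linf_xv (g \<tau>) \<le> c"
    then show "AE z in lborel. ennreal \<bar>g \<tau> (fst z) (snd z)\<bar> \<le> c"
      using esssup_AE[of "\<lambda>z. ennreal \<bar>g \<tau> (fst z) (snd z)\<bar>" lborel]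
      by (auto simp: Linf_xv_def case_prod_beta' intro: order_trans)
  next
    assume "AE z in lborel. ennreal \<bar>g \<tau> (fst z) (snd z)\<bar> \<le> c"
    then show "Linf_xv (g \<tau>) \<le> c"
      unfolding Linf_xv_def case_prod_beta' by (intro esssup_I m)
  qed
  moreover have "Measurable.pred borel (\<lambda>\<tau>. AE z in lborel. ennreal \<bar>g \<tau> (fst z) (snd z)\<bar> \<le> c)"
    using g by (intro pred_AE_lborel) measurable
  ultimately show "{\<tau> \<in> space borel. Linf_xv (g \<tau>) \<le> c} \<in> sets borel" by (simp add: pred_def)
qed

lemma borel_measurable_epowr [measurable]: "(\<lambda>a. epowr a p) \<in> borel_measurable borel"
  unfolding epowr_def by measurable

lemma borel_measurable_L2_xv:
  assumes "(\<lambda>z. g (fst z) (fst (snd z)) (snd (snd z))) \<in> borel_measurable (borel \<Otimes>\<^sub>M (borel \<Otimes>\<^sub>M borel))"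
  shows "(\<lambda>\<tau>::real. L2_xv (g \<tau>)) \<in> borel_measurable borel"
proof -
  have g: "(\<lambda>z. g (fst z) (fst (snd z)) (snd (snd z))) \<in> borel_measurable (borel \<Otimes>\<^sub>M borel)"
    using assms by (simp add: borel_prod)
  have "(\<lambda>z. ennreal (\<bar>g (fst z) (fst (snd z)) (snd (snd z))\<bar>\<^sup>2)) \<in> borel_measurable (borel \<Otimes>\<^sub>M lborel)"
    using g by (simp cong: measurable_cong_sets)
  then have [measurable]: "(\<lambda>\<tau>. \<integral>\<^sup>+z. ennreal (\<bar>g \<tau> (fst z) (snd z)\<bar>\<^sup>2) \<partial>lborel) \<in> borel_measurable borel"
    by (intro lborel.borel_measurable_nn_integral) (simp add: case_prod_beta')
  show ?thesis unfolding L2_xv_def case_prod_beta' by measurable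
qed

lemma in_Lp_time_AE_finite:
  assumes "in_Lp_time p T N F" and [measurable]: "(\<lambda>t. N (F t)) \<in> borel_measurable borel"
  shows "AE t in lborel. 0 < t \<and> t < T \<longrightarrow> N (F t) < \<infinity>"
proof -
  have "AE t in lborel. epowr (N (F t)) p * indicator {0<..<T} t \<noteq> \<infinity>"
    using assms(1) unfolding in_Lp_time_def by (intro nn_integral_noteq_infinite) auto
  then show ?thesis by eventually_elim (auto simp: epowr_def less_top split: if_splits)
qed


lemma one_le_weight: "0 \<le> \<beta> \<Longrightarrow> 1 \<le> weight \<beta> v"
  unfolding weight_def by (intro ge_one_powr_ge_zero) auto

lemma borel_measurable_weight [measurable]: "weight \<beta> \<in> borel_measurable borel"
  unfolding weight_def by measurable

text \<open>
  Truncating \<open>F\<close> to the interval from \<open>0\<close> to \<open>a / w\<close>, where \<open>a \<tau>\<close> is the weighted supremum norm at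
  time \<open>\<tau>\<close>, changes it on a null set only, and makes all bounds hold at every point.
\<close>

lemma (in cutoff_kernel) space_X_representative:
  assumes F: "F \<in> space_X (weight \<beta>)" and T: "0 < T"
  obtains f a g c where "profile_representative \<gamma> \<beta> h f a T g" "\<And>\<tau>. 0 < \<tau> \<Longrightarrow> g \<tau> = F \<tau>"
    "AE \<tau> in lborel. 0 < \<tau> \<and> \<tau> < T \<longrightarrow>
      integrable lborel (\<lambda>z. (f \<tau> (fst z) (snd z) - c * maxwellian (snd z))\<^sup>2)"
proof -
  \<comment> \<open>\<open>F\<close> is measurable at positive times only\<close>
  define g where "g \<tau> y u = (if 0 < \<tau> then F \<tau> y u else 0)" for \<tau> y u
  have Fm: "(\<lambda>(t, x, v). F t x v) \<in> borel_measurable (restrict_space borel ({0<..} \<times> UNIV))"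
    and F0: "AE (t, x, v) in lborel. 0 < t \<longrightarrow> 0 \<le> F t x v"
    using F by (auto simp: space_X_def)
  \<comment> \<open>\<open>c\<close> is \<open>1\<close> near the Maxwellian and \<open>0\<close> near vacuum\<close>
  obtain b c where b: "2 < b"
    and L2: "in_Lp_time (b / (b - 1)) T L2_xv (\<lambda>t x v. weight \<beta> v * (F t x v - c * maxwellian v))"
    and Linf: "in_Lp_time b T Linf_xv (\<lambda>t x v. weight \<beta> v * F t x v)"
  proof -
    from F obtain b where b: "2 < b" and or:
      "(\<forall>T'>0. in_Lp_time (b / (b - 1)) T' L2_xv (\<lambda>t x v. weight \<beta> v * (F t x v - maxwellian v)) \<and>
                in_Lp_time b T' Linf_xv (\<lambda>t x v. weight \<beta> v * F t x v)) \<or>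
        (\<forall>T'>0. in_Lp_time (b / (b - 1)) T' L2_xv (\<lambda>t x v. weight \<beta> v * F t x v) \<and>
                in_Lp_time b T' Linf_xv (\<lambda>t x v. weight \<beta> v * F t x v))"
      unfolding space_X_def by blast
    from or show ?thesis
    proof
      assume "\<forall>T'>0. in_Lp_time (b / (b - 1)) T' L2_xv (\<lambda>t x v. weight \<beta> v * (F t x v - maxwellian v)) \<and>
                in_Lp_time b T' Linf_xv (\<lambda>t x v. weight \<beta> v * F t x v)"
      then show ?thesis using T b by (intro that[of b 1]) auto
    next
      assume "\<forall>T'>0. in_Lp_time (b / (b - 1)) T' L2_xv (\<lambda>t x v. weight \<beta> v * F t x v) \<and>
                in_Lp_time b T' Linf_xv (\<lambda>t x v. weight \<beta> v * F t x v)"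
      then show ?thesis using T b by (intro that[of b 0]) auto
    qed
  qed
  have g_measurable: "(\<lambda>z. g (fst z) (fst (snd z)) (snd (snd z))) \<in> borel_measurable (borel \<Otimes>\<^sub>M (borel \<Otimes>\<^sub>M borel))"
  proof -
    have "({0<..} \<times> UNIV :: (real \<times> (real^3) \<times> (real^3)) set) \<inter> space borel \<in> sets borel"
      by (auto intro!: borel_open open_Times)
    from borel_measurable_restrict_space_iff[OF this, of "\<lambda>(t, x, v). F t x v"] Fm
    have "(\<lambda>z. indicator ({0<..} \<times> UNIV) z *\<^sub>R (case z of (t, x, v) \<Rightarrow> F t x v)) \<in> borel_measurable borel" by blast
    also have "(\<lambda>z. indicator ({0<..} \<times> UNIV) z *\<^sub>R (case z of (t, x, v) \<Rightarrow> F t x v)) = (\<lambda>z. g (fst z) (fst (snd z)) (snd (snd z)))"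
      by (rule ext) (auto simp: g_def indicator_def)
    finally show ?thesis by (simp add: borel_prod)
  qed
  interpret raw: measurable_profile \<gamma> \<beta> h g
    by unfold_locales (rule g_measurable)
  have gF: "g \<tau> = F \<tau>" if "0 < \<tau>" for \<tau> using that by (intro ext) (simp add: g_def)
  have swap: "in_Lp_time r T N (\<lambda>t. G (F t)) \<longleftrightarrow> in_Lp_time r T N (\<lambda>t. G (g t))" for r N and G :: "(real^3 \<Rightarrow> real^3 \<Rightarrow> real) \<Rightarrow> real^3 \<Rightarrow> real^3 \<Rightarrow> real"
  proof -
    have "(\<integral>\<^sup>+ t\<in>{0<..<T}. epowr (N (G (F t))) r \<partial>lborel) = (\<integral>\<^sup>+ t\<in>{0<..<T}. epowr (N (G (g t))) r \<partial>lborel)"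
      by (intro nn_integral_cong) (auto simp: indicator_def gF)
    then show ?thesis by (simp add: in_Lp_time_def)
  qed
  define B where "B \<tau> = Linf_xv (\<lambda>y u. weight \<beta> u * g \<tau> y u)" for \<tau>
  have [measurable]: "B \<in> borel_measurable borel"
    unfolding B_def by (rule borel_measurable_Linf_xv) measurable
  define a where "a \<tau> = enn2real (B \<tau>)" for \<tau>
  have [measurable]: "a \<in> borel_measurable borel" unfolding a_def by measurable
  define f where "f \<tau> y u = max 0 (min (g \<tau> y u) (a \<tau> * p u))" for \<tau> y u
  have LinfB: "in_Lp_time b T Linf_xv (\<lambda>t y u. weight \<beta> u * g t y u)"
    using Linf swap[of b Linf_xv "\<lambda>H y u. weight \<beta> u * H y u"] by simp
  have B_fin: "AE \<tau> in lborel. 0 < \<tau> \<and> \<tau> < T \<longrightarrow> B \<tau> < \<infinity>"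
    using in_Lp_time_AE_finite[OF LinfB] by (simp add: B_def[symmetric])
  have a_fin: "(\<integral>\<^sup>+\<tau>. ennreal ((a \<tau>)\<^sup>2) * indicator {0<..<T} \<tau> \<partial>lborel) < \<infinity>"
  proof -
    have le: "ennreal ((a \<tau>)\<^sup>2) \<le> 1 + epowr (B \<tau>) b" for \<tau>
    proof (cases "B \<tau> = \<infinity>")
      case False
      have a0: "0 \<le> a \<tau>" by (simp add: a_def)
      have "(a \<tau>)\<^sup>2 \<le> 1 + a \<tau> powr b"
      proof (cases "a \<tau> \<le> 1")
        case True
        then have "(a \<tau>)\<^sup>2 \<le> 1" using a0 by (simp add: power_le_one)
        then show ?thesis by (simp add: add_increasing2)
      next
        case f: False
        then have "(a \<tau>)\<^sup>2 = a \<tau> powr 2" using a0 by (simp add: powr_numeral)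
        also have "\<dots> \<le> a \<tau> powr b" using f b by (intro powr_mono) auto
        finally show ?thesis by simp
      qed
      then have "ennreal ((a \<tau>)\<^sup>2) \<le> ennreal (1 + a \<tau> powr b)" by (rule ennreal_leI)
      also have "\<dots> = 1 + epowr (B \<tau>) b" using False by (simp add: epowr_def a_def)
      finally show ?thesis .
    qed (simp add: epowr_def)
    have "(\<integral>\<^sup>+\<tau>. ennreal ((a \<tau>)\<^sup>2) * indicator {0<..<T} \<tau> \<partial>lborel)
       \<le> (\<integral>\<^sup>+\<tau>. indicator {0<..<T} \<tau> + epowr (B \<tau>) b * indicator {0<..<T} \<tau> \<partial>lborel)"
      using le by (intro nn_integral_mono) (auto simp: indicator_def)
    also have "\<dots> = emeasure lborel {0<..<T} + (\<integral>\<^sup>+\<tau>. epowr (B \<tau>) b * indicator {0<..<T} \<tau> \<partial>lborel)"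
      by (subst nn_integral_add) auto
    also have "\<dots> < \<infinity>"
      using LinfB emeasure_bounded_finite[of "{0<..<T}"]
      by (simp add: in_Lp_time_def B_def[symmetric] ennreal_add_less_top)
    finally show ?thesis .
  qed
  have ae_z: "AE \<tau> in lborel. 0 < \<tau> \<and> \<tau> < T \<longrightarrow> (AE z in lborel. g \<tau> (fst z) (snd z) = f \<tau> (fst z) (snd z))"
  proof -
    have "AE z in (lborel :: real measure) \<Otimes>\<^sub>M (lborel :: ((real^3) \<times> (real^3)) measure). 0 < fst z \<longrightarrow> 0 \<le> F (fst z) (fst (snd z)) (snd (snd z))"
      unfolding lborel_prod using F0 by (simp add: case_prod_beta')
    from lborel_pair.AE_pair[OF this]
    have "AE \<tau> in lborel. AE z in (lborel :: ((real^3) \<times> (real^3)) measure). 0 < \<tau> \<longrightarrow> 0 \<le> F \<tau> (fst z) (snd z)" by simp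
    then show ?thesis using B_fin
    proof eventually_elim
      case (elim \<tau>)
      show ?case
      proof
        assume \<tau>: "0 < \<tau> \<and> \<tau> < T"
        have "AE z in lborel. ennreal \<bar>weight \<beta> (snd z) * g \<tau> (fst z) (snd z)\<bar> \<le> B \<tau>"
          using esssup_AE[of "\<lambda>z. ennreal \<bar>weight \<beta> (snd z) * g \<tau> (fst z) (snd z)\<bar>" lborel]
          by (simp add: B_def Linf_xv_def case_prod_beta')
        with elim(1) show "AE z in lborel. g \<tau> (fst z) (snd z) = f \<tau> (fst z) (snd z)"
        proof eventually_elim
          case (elim z)
          let ?y = "fst z" and ?u = "snd z"
          have "B \<tau> = ennreal (a \<tau>)" using \<open>0 < \<tau> \<and> \<tau> < T \<longrightarrow> B \<tau> < \<infinity>\<close> \<tau> by (simp add: a_def)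
          with elim(2) have "ennreal \<bar>weight \<beta> ?u * g \<tau> ?y ?u\<bar> \<le> ennreal (a \<tau>)" by (simp only:)
          then have "\<bar>weight \<beta> ?u * g \<tau> ?y ?u\<bar> \<le> a \<tau>" by (simp add: ennreal_le_iff a_def)
          then have "p ?u * (weight \<beta> ?u * g \<tau> ?y ?u) \<le> p ?u * a \<tau>"
            using p_pos[of ?u] by (intro mult_left_mono) auto
          moreover have "p ?u * (weight \<beta> ?u * g \<tau> ?y ?u) = g \<tau> ?y ?u"
            by (simp add: mult.assoc[symmetric] p_weight)
          ultimately have "g \<tau> ?y ?u \<le> a \<tau> * p ?u" by (simp only: mult.commute)
          moreover have "0 \<le> g \<tau> ?y ?u" using elim(1) \<tau> by (simp add: g_def)
          ultimately show ?case by (simp add: f_def)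
        qed
      qed
    qed
  qed
  have rep: "profile_representative \<gamma> \<beta> h f a T g"
  proof unfold_locales
    show "(\<lambda>z. f (fst z) (fst (snd z)) (snd (snd z))) \<in> borel_measurable (borel \<Otimes>\<^sub>M (borel \<Otimes>\<^sub>M borel))"
      unfolding f_def by measurable
    show "f \<tau> y u \<le> a \<tau> * p u" for \<tau> y u using p_pos[of u] by (simp add: f_def a_def less_imp_le)
    show "AE \<tau> in lborel. 0 < \<tau> \<and> \<tau> < T \<longrightarrow> (AE y in lborel. AE u in lborel. g \<tau> y u = f \<tau> y u)"
      using ae_z
    proof eventually_elim
      case (elim \<tau>)
      show ?case
      proof
        assume "0 < \<tau> \<and> \<tau> < T"
        with elim have "AE z in (lborel :: (real^3) measure) \<Otimes>\<^sub>M (lborel :: (real^3) measure). g \<tau> (fst z) (snd z) = f \<tau> (fst z) (snd z)"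
          unfolding lborel_prod by blast
        from lborel_pair.AE_pair[OF this] show "AE y in lborel. AE u in lborel. g \<tau> y u = f \<tau> y u" by simp
      qed
    qed
    show "(\<integral>\<^sup>+\<tau>. ennreal ((a \<tau>)\<^sup>2) * indicator {0<..<T} \<tau> \<partial>lborel) < \<infinity>" by (rule a_fin)
  qed (auto simp: f_def a_def)
  interpret rep: profile_representative \<gamma> \<beta> h f a T g by (rule rep)
  define E where "E \<tau> y u = weight \<beta> u * (g \<tau> y u - c * maxwellian u)" for \<tau> y u
  have L2E: "in_Lp_time (b / (b - 1)) T L2_xv E"
    using L2 swap[of "b / (b - 1)" L2_xv "\<lambda>H y u. weight \<beta> u * (H y u - c * maxwellian u)"] unfolding E_def[abs_def] by simp
  have "(\<lambda>\<tau>. L2_xv (E \<tau>)) \<in> borel_measurable borel"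
    by (rule borel_measurable_L2_xv) (unfold E_def, measurable)
  from in_Lp_time_AE_finite[OF L2E this] ae_z
  have "AE \<tau> in lborel. 0 < \<tau> \<and> \<tau> < T \<longrightarrow> integrable lborel (\<lambda>z. (f \<tau> (fst z) (snd z) - c * maxwellian (snd z))\<^sup>2)"
  proof eventually_elim
    case (elim \<tau>)
    show ?case
    proof
      assume \<tau>: "0 < \<tau> \<and> \<tau> < T"
      have fin: "(\<integral>\<^sup>+z. ennreal (\<bar>E \<tau> (fst z) (snd z)\<bar>\<^sup>2) \<partial>lborel) < \<infinity>"
        using elim(1) \<tau> by (auto simp: L2_xv_def epowr_def case_prod_beta' less_top split: if_splits)
      have m: "(\<lambda>z. (f \<tau> (fst z) (snd z) - c * maxwellian (snd z))\<^sup>2) \<in> borel_measurable lborel"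
      proof -
        have "(\<lambda>z. (f \<tau> (fst z) (snd z) - c * maxwellian (snd z))\<^sup>2) \<in> borel_measurable (borel \<Otimes>\<^sub>M borel)" by measurable
        then show ?thesis by (simp add: borel_prod)
      qed
      show "integrable lborel (\<lambda>z. (f \<tau> (fst z) (snd z) - c * maxwellian (snd z))\<^sup>2)"
      proof (rule integrableI_nonneg[OF m])
        have "(\<integral>\<^sup>+z. ennreal ((f \<tau> (fst z) (snd z) - c * maxwellian (snd z))\<^sup>2) \<partial>lborel) \<le> (\<integral>\<^sup>+z. ennreal (\<bar>E \<tau> (fst z) (snd z)\<bar>\<^sup>2) \<partial>lborel)"
        proof (rule nn_integral_mono_AE)
          have "AE z in lborel. g \<tau> (fst z) (snd z) = f \<tau> (fst z) (snd z)" using elim(2) \<tau> by simp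
          then show "AE z in lborel. ennreal ((f \<tau> (fst z) (snd z) - c * maxwellian (snd z))\<^sup>2) \<le> ennreal (\<bar>E \<tau> (fst z) (snd z)\<bar>\<^sup>2)"
          proof eventually_elim
            case (elim z)
            have w: "1 \<le> weight \<beta> (snd z)" using beta by (intro one_le_weight) auto
            define e where "e = f \<tau> (fst z) (snd z) - c * maxwellian (snd z)"
            have "1 * \<bar>e\<bar> \<le> weight \<beta> (snd z) * \<bar>e\<bar>" using w by (intro mult_right_mono) auto
            also have "\<dots> = \<bar>E \<tau> (fst z) (snd z)\<bar>" using w elim by (simp add: E_def e_def abs_mult)
            finally have "\<bar>e\<bar>\<^sup>2 \<le> \<bar>E \<tau> (fst z) (snd z)\<bar>\<^sup>2" by (intro power_mono) auto
            then show ?case by (intro ennreal_leI) (simp add: e_def)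
          qed
        qed
        then show "(\<integral>\<^sup>+z. ennreal ((f \<tau> (fst z) (snd z) - c * maxwellian (snd z))\<^sup>2) \<partial>lborel) < \<infinity>"
          using fin by (rule le_less_trans)
      qed simp
    qed
  qed
  with rep gF show ?thesis by (rule that)
qed

theorem theorem1p2:
  fixes \<gamma> \<beta> t\<^sub>1 T :: real
    and h :: "real \<Rightarrow> real"
    and q :: "real \<Rightarrow> real^3 \<Rightarrow> real"
    and F\<^sub>0 :: "real^3 \<Rightarrow> real^3 \<Rightarrow> real"
    and F :: "real \<Rightarrow> real^3 \<Rightarrow> real^3 \<Rightarrow> real"
  assumes gamma: "-3 < \<gamma>" "\<gamma> \<le> 1"
    and h_nonneg: "\<And>\<theta>. \<theta> \<in> {0..pi/2} \<Longrightarrow> 0 \<le> h \<theta>"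
    and h_integrable: "set_integrable lborel {0..pi/2} h"
    and q: "\<And>\<theta> z. q \<theta> z = norm z powr \<gamma> * h \<theta>"
    and beta: "8 + 2 * max 0 \<gamma> < \<beta>"
    and F0_measurable: "(\<lambda>(x, v). F\<^sub>0 x v) \<in> borel_measurable borel"
    and F0_nonneg: "\<And>x v. 0 \<le> F\<^sub>0 x v"
    and F0_bounded: "bdd_above (range (\<lambda>(x, v). weight \<beta> v * \<bar>F\<^sub>0 x v\<bar>))"
    and F0_continuous:
      "\<And>x t K. \<lbrakk>0 < t; bounded K; K \<in> sets borel\<rbrakk> \<Longrightarrow>
        ((\<lambda>(\<sigma>, \<delta>). LINT v:K|lborel.
            \<bar>F\<^sub>0 (x + \<delta> - (t + \<sigma>) *\<^sub>R v) v - F\<^sub>0 (x - t *\<^sub>R v) v\<bar>) \<longlongrightarrow> 0) (at (0, 0))"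
    and times: "0 < t\<^sub>1" "t\<^sub>1 < T"
    and F0_uniform:
      "\<And>K. \<lbrakk>bounded K; K \<in> sets borel\<rbrakk> \<Longrightarrow>
        ((\<lambda>(\<sigma>, \<delta>). SUP (x, t)\<in>UNIV \<times> {t\<^sub>1..T}. LINT v:K|lborel.
            \<bar>F\<^sub>0 (x + \<delta> - (t + \<sigma>) *\<^sub>R v) v - F\<^sub>0 (x - t *\<^sub>R v) v\<bar>) \<longlongrightarrow> 0) (at (0, 0))"
    and F_solution: "duhamel_solution q F\<^sub>0 F"
    and F_X: "F \<in> space_X (weight \<beta>)"
  shows "(\<forall>x. \<forall>t\<in>{t\<^sub>1..T}.
            integrable lborel (\<lambda>v. F t x v) \<and>
            integrable lborel (\<lambda>v. F t x v *\<^sub>R v) \<and>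
            integrable lborel (\<lambda>v. (norm v)\<^sup>2 * F t x v)) \<and>
         uniformly_continuous_on (UNIV \<times> {t\<^sub>1..T}) (\<lambda>(x, t). LINT v|lborel. F t x v) \<and>
         uniformly_continuous_on (UNIV \<times> {t\<^sub>1..T}) (\<lambda>(x, t). LINT v|lborel. F t x v *\<^sub>R v) \<and>
         uniformly_continuous_on (UNIV \<times> {t\<^sub>1..T}) (\<lambda>(x, t). LINT v|lborel. (norm v)\<^sup>2 * F t x v)"
proof -
  \<comment> \<open>nothing is assumed about \<open>h\<close> outside \<open>[0, \<pi>/2]\<close>, where the collision angle has no values\<close>
  define hh where "hh \<theta> = indicator {0..pi/2} \<theta> * h \<theta>" for \<theta>
  have hh_int: "integrable lborel hh" using h_integrable by (simp add: set_integrable_def hh_def[abs_def])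
  have hh_nonneg: "0 \<le> hh \<theta>" for \<theta> using h_nonneg[of \<theta>] by (simp add: hh_def indicator_def)
  interpret K: cutoff_kernel \<gamma> \<beta> hh
  proof
    show "hh \<in> borel_measurable borel" using borel_measurable_integrable[OF hh_int] by simp
    have "(\<integral>\<^sup>+\<theta>. ennreal (hh \<theta>) * indicator {0..pi/2} \<theta> \<partial>lborel) \<le> (\<integral>\<^sup>+\<theta>. ennreal (hh \<theta>) \<partial>lborel)"
      by (intro nn_integral_mono) (auto simp: indicator_def)
    also have "\<dots> = ennreal (LINT \<theta>|lborel. hh \<theta>)"
      using hh_nonneg by (intro nn_integral_eq_integral hh_int) auto
    finally show "(\<integral>\<^sup>+\<theta>. ennreal (hh \<theta>) * indicator {0..pi/2} \<theta> \<partial>lborel) < \<infinity>"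
      by (rule le_less_trans) simp
  qed (use gamma beta hh_nonneg in auto)
  have kernel: "loss_freq q = loss_freq K.q" "Q_gain q = Q_gain K.q"
    by (rule collision_integrals_cong_kernel, simp add: q K.q_def hh_def)+
  have "0 < T" using times by simp
  then obtain f a g c where rep: "profile_representative \<gamma> \<beta> hh f a T g" and gF: "\<And>\<tau>. 0 < \<tau> \<Longrightarrow> g \<tau> = F \<tau>"
    and L2: "AE \<tau> in lborel. 0 < \<tau> \<and> \<tau> < T \<longrightarrow>
      integrable lborel (\<lambda>z. (f \<tau> (fst z) (snd z) - c * maxwellian (snd z))\<^sup>2)"
    by (rule K.space_X_representative[OF F_X]) (rule that)
  interpret R: profile_representative \<gamma> \<beta> hh f a T g by (rule rep)
  let ?I = "{t\<^sub>1..T}"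
  have pos: "0 < t" if "t \<in> ?I" for t using that times by simp
  have F_measurable: "F t x \<in> borel_measurable borel" if "t \<in> ?I" for t x
  proof -
    have "g t x \<in> borel_measurable borel" by measurable
    then show ?thesis using gF[OF pos[OF that]] by simp
  qed
  have F_raw: "F t x v = R.raw.duhamel F\<^sub>0 t x v" if t: "0 < t" for t x v
  proof -
    have dep: "(LINT \<tau>:{s<..<t}|lborel. g_char q F \<tau> t x v) = R.raw.depletion t x v s" if "0 \<le> s" for s
      unfolding R.raw.depletion_def
    proof (rule set_lebesgue_integral_cong)
      show "\<forall>\<tau>. \<tau> \<in> {s<..<t} \<longrightarrow> g_char q F \<tau> t x v = R.raw.loss \<tau> (x - (t - \<tau>) *\<^sub>R v) v"
        using that by (auto simp: g_char_def kernel R.raw.loss_def gF)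
    qed simp
    have "(LINT s:{0<..<t}|lborel. exp (- (LINT \<tau>:{s<..<t}|lborel. g_char q F \<tau> t x v)) *
             Q_gain q (F s (x - (t - s) *\<^sub>R v)) (F s (x - (t - s) *\<^sub>R v)) v)
        = (LINT s:{0<..<t}|lborel. exp (- R.raw.depletion t x v s) * R.raw.gain s (x - (t - s) *\<^sub>R v) v)"
      by (rule set_lebesgue_integral_cong) (auto simp: dep kernel R.raw.gain_def gF)
    then show ?thesis
      using F_solution t by (simp add: duhamel_solution_def R.raw.duhamel_def dep)
  qed
  have F_eq: "AE v in lborel. F t x v = R.duhamel F\<^sub>0 t x v" if "t \<in> ?I" for t x
    using R.AE_raw_duhamel_eq[of t F\<^sub>0 x] that pos[OF that] F_raw by auto
  obtain C where C: "weight \<beta> v * \<bar>F\<^sub>0 y v\<bar> \<le> C" for y v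
    using F0_bounded by (auto simp: bdd_above_def)
  have F0_le: "\<bar>F\<^sub>0 y v\<bar> \<le> C * K.p v" for y v
  proof -
    have "K.p v * (weight \<beta> v * \<bar>F\<^sub>0 y v\<bar>) \<le> K.p v * C"
      using K.p_pos[of v] by (intro mult_left_mono C) auto
    moreover have "K.p v * (weight \<beta> v * \<bar>F\<^sub>0 y v\<bar>) = \<bar>F\<^sub>0 y v\<bar>"
      using K.p_weight[of v] by (simp add: mult.assoc[symmetric])
    ultimately show ?thesis by (simp add: mult.commute)
  qed
  have int: "integrable lborel (\<lambda>v. (1 + (norm v)\<^sup>2) * \<bar>F t x v\<bar>)" if "t \<in> ?I" for t x
    by (rule R.integrable_below_majorant[OF F_measurable[OF that] R.AE_le_majorant[OF F_eq[OF that] _ F0_le]]) (use that in simp)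
  have cont: "(\<lambda>n. LINT v|lborel. (1 + (norm v)\<^sup>2) * \<bar>F (t' n) (x' n) v - F (t n) (x n) v\<bar>) \<longlonglongrightarrow> 0"
    if "\<And>n. t n \<in> ?I" "\<And>n. t' n \<in> ?I" "(\<lambda>n. t' n - t n) \<longlonglongrightarrow> 0" "(\<lambda>n. x' n - x n) \<longlonglongrightarrow> 0" for t t' x x'
    by (rule R.weighted_mean_continuity[OF F_measurable F_eq L2 F0_measurable F0_le F0_uniform that])
  have le: "norm v \<le> 1 + (norm v)\<^sup>2" for v :: "real^3"
  proof -
    have "2 * norm v \<le> 1 + (norm v)\<^sup>2"
      using zero_le_power2[of "norm v - 1"] by (simp add: power2_diff)
    then show ?thesis using norm_ge_zero[of v] by linarith
  qed
  have density: "\<And>t x. t \<in> ?I \<Longrightarrow> integrable lborel (\<lambda>v. F t x v *\<^sub>R (1::real))"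
    "uniformly_continuous_on (UNIV \<times> ?I) (\<lambda>(x, t). LINT v|lborel. F t x v *\<^sub>R (1::real))"
    using moment_uniformly_continuous[of ?I F "\<lambda>v. 1::real"] F_measurable int cont by auto
  have momentum: "\<And>t x. t \<in> ?I \<Longrightarrow> integrable lborel (\<lambda>v. F t x v *\<^sub>R v)"
    "uniformly_continuous_on (UNIV \<times> ?I) (\<lambda>(x, t). LINT v|lborel. F t x v *\<^sub>R v)"
    using moment_uniformly_continuous[of ?I F "\<lambda>v. v"] F_measurable int cont le by auto
  have energy: "\<And>t x. t \<in> ?I \<Longrightarrow> integrable lborel (\<lambda>v. F t x v *\<^sub>R (norm v)\<^sup>2)"
    "uniformly_continuous_on (UNIV \<times> ?I) (\<lambda>(x, t). LINT v|lborel. F t x v *\<^sub>R (norm v)\<^sup>2)"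
    using moment_uniformly_continuous[of ?I F "\<lambda>v. (norm v)\<^sup>2"] F_measurable int cont by auto
  show ?thesis
  proof (intro conjI allI ballI)
    fix x t assume t: "t \<in> ?I"
    show "integrable lborel (\<lambda>v. F t x v)" using density(1)[OF t, of x] by simp
    show "integrable lborel (\<lambda>v. F t x v *\<^sub>R v)" using momentum(1)[OF t, of x] by simp
    show "integrable lborel (\<lambda>v. (norm v)\<^sup>2 * F t x v)" using energy(1)[OF t, of x] by (simp add: mult.commute)
  next
    show "uniformly_continuous_on (UNIV \<times> ?I) (\<lambda>(x, t). LINT v|lborel. F t x v)" using density(2) by simp
    show "uniformly_continuous_on (UNIV \<times> ?I) (\<lambda>(x, t). LINT v|lborel. F t x v *\<^sub>R v)" using momentum(2) by simp
    show "uniformly_continuous_on (UNIV \<times> ?I) (\<lambda>(x, t). LINT v|lborel. (norm v)\<^sup>2 * F t x v)"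
      using energy(2) by (simp add: mult.commute)
  qed
qed

end
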